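(* Let $T$ be the quasi-nilpotent DT-operator in the tracial $W^*$-probability space $(M,\tau)$. Let $\lambda\in\mathbb C$ and put $T_\lambda=T-\lambda 1$. Then the scalar-valued $\mathcal R$-transform of $T_\lambda^*T_\lambda$ with respect to $\tau$ is given by $$\mathcal R^{\mathbb C}_{T_\lambda^*T_\lambda}(z)=-\frac{1}{(1-z)\log(1-z)}-\frac1z+\frac{|\lambda|^2}{1-z}$$ for $z$ in some neighborhood of $0$ (the right-hand side being extended to $z=0$ by continuity).
   Context: The quasi-nilpotent DT-operator $T$ is realized as follows. Let $(M,\tau)$ be a von Neumann algebra with faithful normal tracial state, containing a pair $(D_0,X)$ of free selfadjoint elements such that $D_0$ has the uniform distribution on $[0,1]$ and $X$ is standard semicircular (distribution $\frac1{2\pi}\sqrt{4-t^2}\,1_{[-2,2]}(t)\,dt$). For $N\in\mathbb N$ put $T_N=\sum_{j=1}^{2^N}p_{N,j}Xq_{N,j}$ with $p_{N,j}=1_{[\frac{j-1}{2^N},\frac{j}{2^N}]}(D_0)$ and $q_{N,j}=1_{[\frac{j}{2^N},1]}(D_0)$. Then $(T_N)$ converges in norm and $T$ is its limit. (Equivalently, in $*$-moments $T$ is the limit as $n\to\infty$ of strictly upper triangular $n\times n$ random matrices whose entries above the diagonal are i.i.d. complex Gaussian with real and imaginary parts independent of mean $0$ and variance $\frac1{2n}$.) For $a\in M$, the scalar Cauchy transform is $G_a(\zeta)=\tau((\zeta 1-a)^{-1})$ for $|\zeta|$ large; it is invertible with respect to composition near $\infty$, and the scalar $\mathcal R$-transform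 is $\mathcal R_a^{\mathbb C}(z)=G_a^{\langle -1\rangle}(z)-\frac1z$ for $z\neq 0$ near $0$, extended analytically to $z=0$. $\log$ is the principal branch. *)

theory Defs
  imports "HOL-Complex_Analysis.Complex_Analysis" "HOL-Probability.Probability"
begin

section \<open>Complex Hilbert spaces and bounded operators\<close>

class chilbert_space = banach +
  fixes scaleC :: "complex \<Rightarrow> 'a \<Rightarrow> 'a"  (infixr "*\<^sub>C" 75)
    and cinner :: "'a \<Rightarrow> 'a \<Rightarrow> complex"
  assumes scaleC_add_right: "c *\<^sub>C (x + y) = c *\<^sub>C x + c *\<^sub>C y"
    and scaleC_add_left: "(c + d) *\<^sub>C x = c *\<^sub>C x + d *\<^sub>C x"
    and scaleC_scaleC: "c *\<^sub>C d *\<^sub>C x = (c * d) *\<^sub>C x"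
    and scaleR_scaleC: "r *\<^sub>R x = complex_of_real r *\<^sub>C x"
    and cinner_add_left: "cinner (x + y) z = cinner x z + cinner y z"
    and cinner_scaleC_left: "cinner (c *\<^sub>C x) y = c * cinner x y"
    and cinner_commute: "cinner y x = cnj (cinner x y)"
    and norm_eq_sqrt_cinner: "norm x = sqrt (Re (cinner x x))"

lemma cinner_self_eq_norm: "cinner x x = complex_of_real ((norm x)\<^sup>2)"
  for x :: "'h::chilbert_space"
proof -
  have "Re (cinner x x) = (norm x)\<^sup>2"
    using norm_eq_sqrt_cinner[of x] norm_ge_zero[of x]
    by (metis real_sqrt_ge_0_iff real_sqrt_pow2)
  moreover have "Im (cinner x x) = 0"
    using arg_cong[OF cinner_commute[of x x], of Im] by simp
  ultimately show ?thesis
    by (simp add: complex_eq_iff)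
qed

lemma norm_scaleC: "norm (c *\<^sub>C x) = cmod c * norm x"
  for x :: "'h::chilbert_space"
proof -
  have "cinner (c *\<^sub>C x) (c *\<^sub>C x) = c * (cnj c * cnj (cinner x x))"
    by (metis cinner_scaleC_left cinner_commute complex_cnj_mult)
  also have "\<dots> = complex_of_real ((cmod c * norm x)\<^sup>2)"
    by (simp add: cinner_self_eq_norm power_mult_distrib mult.assoc[symmetric]
        complex_norm_square[symmetric])
  finally have "(norm (c *\<^sub>C x))\<^sup>2 = (cmod c * norm x)\<^sup>2"
    by (metis cinner_self_eq_norm of_real_eq_iff)
  then show ?thesis
    by (simp add: power2_eq_iff_nonneg)
qed

lemma bounded_linear_scaleC: "bounded_linear (\<lambda>x :: 'h::chilbert_space. c *\<^sub>C x)"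
  by (rule bounded_linear_intro[where K = "cmod c"])
    (simp_all add: scaleC_add_right scaleR_scaleC scaleC_scaleC norm_scaleC mult.commute)

text \<open>
  The library type \<open>'h \<Rightarrow>\<^sub>L 'h\<close> consists of the bounded \<^emph>\<open>real\<close>-linear maps; \<open>B(H)\<close> is its
  subset of complex-linear ones.  Multiples of the identity are \<open>scalar_op c\<close>, and the
  scalar multiple \<open>c a\<close> of an operator is \<open>scalar_op c o\<^sub>L a\<close>.
\<close>

type_synonym 'h bop = "'h \<Rightarrow>\<^sub>L 'h"

definition clinear_ops :: "'h::chilbert_space bop set" where
  "clinear_ops = {a. \<forall>c x. blinfun_apply a (c *\<^sub>C x) = c *\<^sub>C blinfun_apply a x}"

lift_definition scalar_op :: "complex \<Rightarrow> 'h::chilbert_space bop" is scaleC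
  by (rule bounded_linear_scaleC)

definition adj :: "'h::chilbert_space bop \<Rightarrow> 'h bop" where
  "adj a = (THE b. \<forall>x y. cinner (blinfun_apply a x) y = cinner x (blinfun_apply b y))"

definition op_inverse :: "'h::chilbert_space bop \<Rightarrow> 'h bop" where
  "op_inverse a = (THE b. a o\<^sub>L b = id_blinfun \<and> b o\<^sub>L a = id_blinfun)"

definition op_power :: "'h::chilbert_space bop \<Rightarrow> nat \<Rightarrow> 'h bop" where
  "op_power a n = (((o\<^sub>L) a) ^^ n) id_blinfun"

definition op_le :: "'h::chilbert_space bop \<Rightarrow> 'h bop \<Rightarrow> bool" where
  "op_le a b \<longleftrightarrow> (\<forall>x. cinner (blinfun_apply (b - a) x) x \<in> \<real>\<^sub>\<ge>\<^sub>0)"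


section \<open>Tracial von Neumann algebras\<close>

definition commutant :: "'h::chilbert_space bop set \<Rightarrow> 'h bop set" where
  "commutant S = {b \<in> clinear_ops. \<forall>a\<in>S. a o\<^sub>L b = b o\<^sub>L a}"

definition von_neumann_algebra :: "'h::chilbert_space bop set \<Rightarrow> bool" where
  "von_neumann_algebra M \<longleftrightarrow>
     M \<subseteq> clinear_ops \<and> (\<forall>a\<in>M. adj a \<in> M) \<and> commutant (commutant M) = M"

text \<open>
  A functional on \<open>M\<close> is a function on all operators of which only the values on \<open>M\<close> matter.
  Normality: preservation of suprema of upward directed, bounded sets of positive elements;
  the supremum is taken in the order of \<open>M\<close>.
\<close>

definition normal_functional :: "'h::chilbert_space bop set \<Rightarrow> ('h bop \<Rightarrow> complex) \<Rightarrow> bool" where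
  "normal_functional M \<tau> \<longleftrightarrow>
     (\<forall>D s. D \<noteq> {} \<and> D \<subseteq> M \<and> s \<in> M
        \<and> (\<forall>a\<in>D. op_le 0 a)
        \<and> (\<forall>a\<in>D. \<forall>b\<in>D. \<exists>c\<in>D. op_le a c \<and> op_le b c)
        \<and> (\<forall>a\<in>D. op_le a s)
        \<and> (\<forall>b\<in>M. (\<forall>a\<in>D. op_le a b) \<longrightarrow> op_le s b)
      \<longrightarrow> Re (\<tau> s) = (SUP a\<in>D. Re (\<tau> a)))"

definition tracial_W_star_space :: "'h::chilbert_space bop set \<Rightarrow> ('h bop \<Rightarrow> complex) \<Rightarrow> bool" where
  "tracial_W_star_space M \<tau> \<longleftrightarrow>
     von_neumann_algebra M
     \<and> (\<forall>a\<in>M. \<forall>b\<in>M. \<tau> (a + b) = \<tau> a + \<tau> b)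
     \<and> (\<forall>c. \<forall>a\<in>M. \<tau> (scalar_op c o\<^sub>L a) = c * \<tau> a)
     \<and> \<tau> id_blinfun = 1
     \<and> (\<forall>a\<in>M. \<tau> (adj a o\<^sub>L a) \<in> \<real>\<^sub>\<ge>\<^sub>0)
     \<and> (\<forall>a\<in>M. \<tau> (adj a o\<^sub>L a) = 0 \<longrightarrow> a = 0)
     \<and> (\<forall>a\<in>M. \<forall>b\<in>M. \<tau> (a o\<^sub>L b) = \<tau> (b o\<^sub>L a))
     \<and> normal_functional M \<tau>"


section \<open>Distributions, freeness and spectral projections\<close>

definition has_distribution ::
  "('h::chilbert_space bop \<Rightarrow> complex) \<Rightarrow> 'h bop \<Rightarrow> real measure \<Rightarrow> bool" where
  "has_distribution \<tau> a \<mu> \<longleftrightarrow>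
     prob_space \<mu> \<and> sets \<mu> = sets borel \<and> (\<exists>r. AE t in \<mu>. \<bar>t\<bar> \<le> r)
     \<and> (\<forall>n. \<tau> (op_power a n) = complex_of_real (\<integral>t. t ^ n \<partial>\<mu>))"

definition semicircle_distribution :: "real measure" where
  "semicircle_distribution =
     density lborel (\<lambda>t. ennreal (1 / (2 * pi) * sqrt (4 - t\<^sup>2) * indicator {-2..2} t))"

inductive_set star_algebra_generated :: "'h::chilbert_space bop set \<Rightarrow> 'h bop set"
  for S :: "'h::chilbert_space bop set" where
  gen: "a \<in> S \<Longrightarrow> a \<in> star_algebra_generated S"
| one: "id_blinfun \<in> star_algebra_generated S"
| add: "a \<in> star_algebra_generated S \<Longrightarrow> b \<in> star_algebra_generated S
    \<Longrightarrow> a + b \<in> star_algebra_generated S"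
| scale: "a \<in> star_algebra_generated S \<Longrightarrow> scalar_op c o\<^sub>L a \<in> star_algebra_generated S"
| mult: "a \<in> star_algebra_generated S \<Longrightarrow> b \<in> star_algebra_generated S
    \<Longrightarrow> a o\<^sub>L b \<in> star_algebra_generated S"
| adj: "a \<in> star_algebra_generated S \<Longrightarrow> adj a \<in> star_algebra_generated S"

definition free_family ::
  "('h::chilbert_space bop \<Rightarrow> complex) \<Rightarrow> ('i \<Rightarrow> 'h bop set) \<Rightarrow> bool" where
  "free_family \<tau> A \<longleftrightarrow>
     (\<forall>as is. as \<noteq> [] \<and> length is = length as
        \<and> (\<forall>k < length as. as ! k \<in> A (is ! k) \<and> \<tau> (as ! k) = 0)
        \<and> (\<forall>k. Suc k < length as \<longrightarrow> is ! k \<noteq> is ! Suc k)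
      \<longrightarrow> \<tau> (foldr (o\<^sub>L) as id_blinfun) = 0)"

definition free_pair ::
  "('h::chilbert_space bop \<Rightarrow> complex) \<Rightarrow> 'h bop \<Rightarrow> 'h bop \<Rightarrow> bool" where
  "free_pair \<tau> a b \<longleftrightarrow>
     free_family \<tau> (\<lambda>i::bool. star_algebra_generated (if i then {a} else {b}))"

text \<open>
  \<open>spectral_measure D E\<close>: \<open>E\<close> is a projection-valued Borel measure with
  \<open>\<langle>D x, x\<rangle> = \<integral> t d\<langle>E(t) x, x\<rangle>\<close> for all \<open>x\<close>, so that \<open>E B\<close> is \<open>1\<^sub>B(D)\<close> in the Borel functional
  calculus of the selfadjoint operator \<open>D\<close>.  By the spectral theorem such an \<open>E\<close> exists and is
  determined on Borel sets.
\<close>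

definition spectral_measure ::
  "'h::chilbert_space bop \<Rightarrow> (real set \<Rightarrow> 'h bop) \<Rightarrow> bool" where
  "spectral_measure D E \<longleftrightarrow>
     (\<forall>B \<in> sets borel. E B \<in> clinear_ops \<and> adj (E B) = E B)
     \<and> (\<forall>A \<in> sets borel. \<forall>B \<in> sets borel. E (A \<inter> B) = E A o\<^sub>L E B)
     \<and> E UNIV = id_blinfun
     \<and> (\<forall>A :: nat \<Rightarrow> real set. range A \<subseteq> sets borel \<and> disjoint_family A \<longrightarrow>
          (\<forall>x. (\<lambda>n. blinfun_apply (E (A n)) x) sums blinfun_apply (E (\<Union>n. A n)) x))
     \<and> (\<forall>x. has_bochner_integral
          (measure_of UNIV (sets borel) (\<lambda>B. ennreal (Re (cinner (blinfun_apply (E B) x) x))))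
          complex_of_real (cinner (blinfun_apply D x) x))"


section \<open>The quasi-nilpotent DT-operator\<close>

definition DT_approx :: "(real set \<Rightarrow> 'h::chilbert_space bop) \<Rightarrow> 'h bop \<Rightarrow> nat \<Rightarrow> 'h bop" where
  "DT_approx E X N =
     (\<Sum>j = 1..2 ^ N. E {(real j - 1) / 2 ^ N .. real j / 2 ^ N} o\<^sub>L X o\<^sub>L E {real j / 2 ^ N .. 1})"

definition quasinilpotent_DT ::
  "'h::chilbert_space bop set \<Rightarrow> ('h bop \<Rightarrow> complex) \<Rightarrow> 'h bop \<Rightarrow> bool" where
  "quasinilpotent_DT M \<tau> T \<longleftrightarrow>
     (\<exists>D\<^sub>0 X E. D\<^sub>0 \<in> M \<and> X \<in> M \<and> adj D\<^sub>0 = D\<^sub>0 \<and> adj X = X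
        \<and> free_pair \<tau> D\<^sub>0 X
        \<and> has_distribution \<tau> D\<^sub>0 (uniform_measure lborel {0..1})
        \<and> has_distribution \<tau> X semicircle_distribution
        \<and> spectral_measure D\<^sub>0 E
        \<and> DT_approx E X \<longlonglongrightarrow> T)"


section \<open>The scalar R-transform\<close>

definition cauchy_transform ::
  "('h::chilbert_space bop \<Rightarrow> complex) \<Rightarrow> 'h bop \<Rightarrow> complex \<Rightarrow> complex" where
  "cauchy_transform \<tau> a \<zeta> = \<tau> (op_inverse (scalar_op \<zeta> - a))"

text \<open>
  The three conditions determine \<open>K\<close> on a punctured neighbourhood of \<open>0\<close>: \<open>G\<close> is injective
  near \<open>\<infinity>\<close> by the first, and \<open>K z\<close> is the solution near \<open>\<infinity>\<close> of \<open>G \<zeta> = z\<close> by the other two.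
\<close>

definition inverse_near_infinity :: "(complex \<Rightarrow> complex) \<Rightarrow> (complex \<Rightarrow> complex) \<Rightarrow> bool" where
  "inverse_near_infinity G K \<longleftrightarrow>
     (\<forall>\<^sub>F \<zeta> in at_infinity. K (G \<zeta>) = \<zeta>)
     \<and> (\<forall>\<^sub>F z in at 0. G (K z) = z)
     \<and> filterlim K at_infinity (at 0)"

text \<open>
  Only the germ at \<open>0\<close> of \<open>R_transform \<tau> a\<close> is meaningful; \<open>remove_sings\<close> supplies the
  extension to \<open>0\<close>.
\<close>

definition R_transform ::
  "('h::chilbert_space bop \<Rightarrow> complex) \<Rightarrow> 'h bop \<Rightarrow> complex \<Rightarrow> complex" where
  "R_transform \<tau> a =
     (let K = (SOME K. inverse_near_infinity (cauchy_transform \<tau> a) K)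
      in remove_sings (\<lambda>z. K z - 1 / z))"

end

theory Submission
  imports Defs
begin

text \<open>
  Put \<open>n = 2\<^sup>N\<close> and let \<open>p\<^sub>k\<close> be the spectral projection of \<open>D\<^sub>0\<close> for the \<open>k\<close>-th of \<open>n\<close> intervals of length
  \<open>1/n\<close>, so that \<open>T\<^sub>N\<close> is the sum of the \<open>p\<^sub>j X p\<^sub>k\<close> with \<open>j < k\<close>.  Freeness and semicircularity amount to the
  Schwinger--Dyson equation \<open>\<tau>(X P) = (\<tau> \<otimes> \<tau>)(\<partial>P)\<close>, where \<open>\<partial>\<close> is the free difference quotient with
  respect to \<open>X\<close>.  With \<open>S = T\<^sub>N - \<lambda>\<close>, \<open>Q = (1 - z S\<^sup>*S)\<close> inverted and \<open>Q' = (1 - z S S\<^sup>*)\<close> inverted, it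
  becomes a closed system of scalar equations for \<open>a\<^sub>k = \<tau>(p\<^sub>k Q)\<close>, \<open>d\<^sub>k = \<tau>(p\<^sub>k Q')\<close>, \<open>\<tau>(p\<^sub>k S Q)\<close> and
  \<open>\<tau>(p\<^sub>k S\<^sup>* Q')\<close>.  Let \<open>A\<^sub>k = 1 - z \<Sum>\<^sub>m\<^sub><\<^sub>k d\<^sub>m\<close>, \<open>B\<^sub>k = 1 - z \<Sum>\<^sub>m\<^sub>\<ge>\<^sub>k a\<^sub>m\<close> and
  \<open>\<Delta>\<^sub>k = A\<^sub>k B\<^sub>k\<^sub>+\<^sub>1 - z |\<lambda>|\<^sup>2\<close>.  The system says that
  \<open>A\<^sub>k\<^sub>+\<^sub>1 / A\<^sub>k = B\<^sub>k / B\<^sub>k\<^sub>+\<^sub>1 = 1 - z / (n \<Delta>\<^sub>k)\<close>.  So \<open>A\<^sub>k B\<^sub>k\<close> does not depend on \<open>k\<close>, which for small \<open>z\<close>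
  forces \<open>\<Delta>\<^sub>k\<close> to be a constant \<open>\<Delta>\<close>, and
  \<open>1 - z \<tau>(Q) = (1 - z / (n \<Delta>))\<^sup>n = (\<Delta> + z |\<lambda>|\<^sup>2) (1 - z / (n \<Delta>))\<close>.  In the limit \<open>N \<rightarrow> \<infinity>\<close> the value
  \<open>g = z \<tau>(Q)\<close> of the Cauchy transform at \<open>1/z\<close> satisfies \<open>1 - g = exp (- z / \<Delta>)\<close> with
  \<open>\<Delta> = 1 - g - z |\<lambda>|\<^sup>2\<close>; eliminating \<open>\<Delta>\<close> expresses \<open>1/z\<close> through \<open>g\<close>.
\<close>

text \<open>Three obstacles shape the proof. Freeness is given for the star-algebras generated by
  D_0 and X, whereas the p_k are limits of polynomials in D_0 only in the L2 norm of \<tau>. The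
  Schwinger--Dyson identity is therefore proved for polynomials, written in Chebyshev polynomials of
  X and centred words, and the graph of (\<tau> \<otimes> id) \<partial> is then closed in the L2
  norm; resolvents enter as norm limits of iterates. Next, \<open>has_distribution\<close>
  prescribes moments, so \<tau>(p_k) = 1/n has to be extracted from them by normality of \<tau>,
  along polynomials decreasing to an indicator. Finally, a resolvent differentiates into two terms,
  and the scalar system closes because the triangle is strict: of j < k and k < j at most one holds,
  so one of the two terms vanishes at every position. Finite n replaces a differential equation by
  telescoping products, and the bounds on z do not depend on N, so one neighbourhood of 0 survives
  the limit.\<close>

notation blinfun_compose  (infixl "\<ast>" 70)

abbreviation op_scale :: "complex \<Rightarrow> 'h::chilbert_space bop \<Rightarrow> 'h bop"  (infixr "\<odot>" 75) where
  "c \<odot> a \<equiv> scalar_op c \<ast> a"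

section \<open>Adjoints\<close>

lemma cinner_add_right: "cinner x (y + z) = cinner x y + cinner x z"
  by (metis cinner_add_left cinner_commute complex_cnj_add)

lemma cinner_scaleC_right: "cinner x (c *\<^sub>C y) = cnj c * cinner x y"
  by (metis cinner_scaleC_left cinner_commute complex_cnj_mult)

lemma scaleC_one [simp]: "1 *\<^sub>C x = x"
  using scaleR_scaleC[of 1 x] by simp

lemma cinner_scaleR_left: "cinner (r *\<^sub>R x) y = of_real r * cinner x y"
  by (simp add: scaleR_scaleC cinner_scaleC_left)

lemma cinner_scaleR_right: "cinner x (r *\<^sub>R y) = of_real r * cinner x y"
  by (simp add: scaleR_scaleC cinner_scaleC_right)

lemma cinner_minus_left: "cinner (- x) y = - cinner x y"
  using cinner_scaleR_left[of "-1" x y] by simp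

lemma cinner_minus_right: "cinner x (- y) = - cinner x y"
  using cinner_scaleR_right[of x "-1" y] by simp

lemma cinner_diff_left: "cinner (x - y) z = cinner x z - cinner y z"
  using cinner_add_left[of x "- y" z] by (simp add: cinner_minus_left)

lemma cinner_diff_right: "cinner x (y - z) = cinner x y - cinner x z"
  using cinner_add_right[of x y "- z"] by (simp add: cinner_minus_right)

lemma cinner_zero [simp]: "cinner 0 x = 0" "cinner x 0 = 0"
  using cinner_diff_left[of x x x] cinner_diff_right[of x x x] cinner_diff_left[of x x] cinner_diff_right[of _ x x]
  by simp_all

lemmas cinner_simps = cinner_add_left cinner_add_right cinner_diff_left cinner_diff_right
  cinner_minus_left cinner_minus_right cinner_scaleC_left cinner_scaleC_right
  cinner_scaleR_left cinner_scaleR_right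

lemma Re_cinner_commute: "Re (cinner y x) = Re (cinner x y)"
  using arg_cong[OF cinner_commute[of x y], of Re] by (simp only: complex_cnj) simp

lemma norm_add_sq: "(norm (x + y))\<^sup>2 = (norm x)\<^sup>2 + 2 * Re (cinner x y) + (norm y)\<^sup>2"
  for x y :: "'h::chilbert_space"
proof -
  have sq: "(norm u)\<^sup>2 = Re (cinner u u)" for u :: 'h
    using arg_cong[OF cinner_self_eq_norm[of u], of Re] by (simp only: Re_complex_of_real)
  show ?thesis
    unfolding sq cinner_add_left cinner_add_right using Re_cinner_commute[of y x] by simp
qed

lemma norm_diff_sq: "(norm (x - y))\<^sup>2 = (norm x)\<^sup>2 - 2 * Re (cinner x y) + (norm y)\<^sup>2"
  for x y :: "'h::chilbert_space"
  using norm_add_sq[of x "- y"] by (simp add: cinner_simps)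

lemma Cauchy_Schwarz_cinner: "cmod (cinner x y) \<le> norm x * norm y"
proof (cases "y = 0")
  case False
  define c where "c = cinner x y / of_real ((norm y)\<^sup>2)"
  have "0 \<le> (norm (x - c *\<^sub>C y))\<^sup>2" by simp
  also have "\<dots> = (norm x)\<^sup>2 - 2 * Re (cnj c * cinner x y) + (cmod c)\<^sup>2 * (norm y)\<^sup>2"
    by (simp add: norm_diff_sq cinner_simps norm_scaleC power_mult_distrib)
  also have "Re (cnj c * cinner x y) = (cmod (cinner x y))\<^sup>2 / (norm y)\<^sup>2"
    by (simp add: c_def complex_cnj_divide complex_norm_square[symmetric] mult.commute
        flip: of_real_power of_real_divide)
  also have "(cmod c)\<^sup>2 * (norm y)\<^sup>2 = (cmod (cinner x y))\<^sup>2 / (norm y)\<^sup>2"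
    using False by (simp add: c_def norm_divide norm_mult power_divide power2_eq_square)
  finally have "(cmod (cinner x y))\<^sup>2 / (norm y)\<^sup>2 \<le> (norm x)\<^sup>2" by simp
  then have "(cmod (cinner x y))\<^sup>2 \<le> (norm x * norm y)\<^sup>2"
    using False by (simp add: field_simps power_mult_distrib)
  then show ?thesis by (rule power2_le_imp_le) simp
qed simp

lemma bounded_bilinear_cinner: "bounded_bilinear (cinner :: 'h::chilbert_space \<Rightarrow> 'h \<Rightarrow> complex)"
  by unfold_locales (auto simp: cinner_simps scaleR_conv_of_real Cauchy_Schwarz_cinner intro!: exI[of _ 1])

lemma bounded_bilinear_scaleC: "bounded_bilinear (scaleC :: complex \<Rightarrow> 'h::chilbert_space \<Rightarrow> 'h)"
  by unfold_locales (auto simp: scaleC_add_left scaleC_add_right scaleR_scaleC scaleC_scaleC norm_scaleC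
      scaleR_conv_of_real mult.commute intro!: exI[of _ 1])

lemmas tendsto_cinner = bounded_bilinear.tendsto[OF bounded_bilinear_cinner]
lemmas tendsto_scaleC = bounded_bilinear.tendsto[OF bounded_bilinear_scaleC]
lemmas tendsto_compose_op = bounded_bilinear.tendsto[OF bounded_bilinear_blinfun_compose]
lemmas tendsto_apply_op = bounded_bilinear.tendsto[OF bounded_bilinear_blinfun_apply]

lemma cinner_ext:
  assumes "\<And>x. cinner x y = cinner x z" shows "y = z"
proof -
  have "cinner (y - z) (y - z) = 0" using assms by (simp add: cinner_diff_right)
  then show ?thesis by (simp add: cinner_self_eq_norm)
qed

text \<open>The representing vector minimises J x = |x|^2 - 2 Re f(x). By the parallelogram law a
  minimising sequence is Cauchy, so completeness yields a minimiser y; the first variation of J at y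
  gives the real part of the identity, and replacing x by ix gives the imaginary part.\<close>

lemma Riesz_representation:
  fixes f :: "'h::chilbert_space \<Rightarrow> complex"
  assumes add: "\<And>x y. f (x + y) = f x + f y"
    and scale: "\<And>c x. f (c *\<^sub>C x) = c * f x"
    and bound: "\<And>x. cmod (f x) \<le> K * norm x"
  shows "\<exists>y. \<forall>x. f x = cinner x y"
proof -
  define J where "J x = (norm x)\<^sup>2 - 2 * Re (f x)" for x
  have fR: "f (r *\<^sub>R x) = of_real r * f x" for r x
    by (simp add: scaleR_scaleC scale)
  have J_lower: "- K\<^sup>2 \<le> J x" for x
  proof -
    have "Re (f x) \<le> K * norm x"
      using bound[of x] complex_Re_le_cmod[of "f x"] by linarith
    moreover have "0 \<le> (norm x - K)\<^sup>2" by simp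
    ultimately show ?thesis unfolding J_def by (simp add: power2_diff mult.commute)
  qed
  then have bdd: "bdd_below (range J)" by (intro bdd_belowI[of _ "- K\<^sup>2"]) auto
  define m where "m = Inf (range J)"
  have m_le: "m \<le> J x" for x unfolding m_def using bdd by (auto intro: cInf_lower)
  have "\<exists>x. J x < m + 1 / (real n + 1)" for n
    using cInf_lessD[of "range J" "m + 1 / (real n + 1)"] unfolding m_def
    by (force simp: add_pos_nonneg)
  then obtain X where X: "\<And>n. J (X n) < m + 1 / (real n + 1)" by metis
  \<comment> \<open>The parallelogram law for J: the linear parts cancel, so two near-minimisers are
    close because J at their midpoint is at least m.\<close>
  have par: "(norm (x - y))\<^sup>2 = 2 * J x + 2 * J y - 4 * J ((1/2) *\<^sub>R (x + y))" for x y
  proof -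
    have "4 * J ((1/2) *\<^sub>R (x + y)) = (norm (x + y))\<^sup>2 - 4 * Re (f x) - 4 * Re (f y)"
      unfolding J_def fR by (simp add: add power_divide add_divide_distrib)
    moreover have "J x = (norm x)\<^sup>2 - 2 * Re (f x)" "J y = (norm y)\<^sup>2 - 2 * Re (f y)"
      by (simp_all add: J_def)
    ultimately show ?thesis unfolding norm_diff_sq norm_add_sq by linarith
  qed
  have dist: "(norm (X i - X j))\<^sup>2 \<le> 4 / (real n + 1)" if "n \<le> i" "n \<le> j" for i j n
  proof -
    have "1 / (real i + 1) \<le> 1 / (real n + 1)" "1 / (real j + 1) \<le> 1 / (real n + 1)"
      using that by (auto intro!: divide_left_mono)
    then show ?thesis
      using X[of i] X[of j] m_le[of "(1/2) *\<^sub>R (X i + X j)"] par[of "X i" "X j"] by linarith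
  qed
  have "Cauchy X"
  proof (rule metric_CauchyI)
    fix e :: real assume e: "0 < e"
    obtain n :: nat where n: "4 / e\<^sup>2 < real n" using reals_Archimedean2 by blast
    have "4 / (real n + 1) < e\<^sup>2"
    proof -
      have "4 < e\<^sup>2 * real n" using n e by (simp add: field_simps)
      also have "\<dots> \<le> e\<^sup>2 * (real n + 1)" by (intro mult_left_mono) auto
      finally show ?thesis by (simp add: field_simps)
    qed
    then have "(norm (X i - X j))\<^sup>2 < e\<^sup>2" if "n \<le> i" "n \<le> j" for i j
      using dist[OF that] by linarith
    then have "dist (X i) (X j) < e" if "n \<le> i" "n \<le> j" for i j
      unfolding dist_norm using that e by (intro power2_less_imp_less[of _ e]) auto
    then show "\<exists>N. \<forall>i\<ge>N. \<forall>j\<ge>N. dist (X i) (X j) < e" by blast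
  qed
  then obtain y where y: "X \<longlonglongrightarrow> y" using Cauchy_convergent convergent_def by blast
  have "bounded_linear f"
    using bound by (intro bounded_linear_intro[where K = K])
      (auto simp: add fR scaleR_conv_of_real mult.commute)
  then have "(\<lambda>n. J (X n)) \<longlonglongrightarrow> J y"
    unfolding J_def by (intro tendsto_intros y bounded_linear.tendsto[OF _ y])
  moreover have "(\<lambda>n. m + 1 / (real n + 1)) \<longlonglongrightarrow> m + 0"
    by (intro tendsto_intros) (use LIMSEQ_inverse_real_of_nat in \<open>simp add: inverse_eq_divide add.commute\<close>)
  ultimately have "J y \<le> m"
    using X LIMSEQ_le[of "\<lambda>n. J (X n)" "J y" "\<lambda>n. m + 1 / (real n + 1)" "m + 0"]
    by (auto intro: less_imp_le)
  then have Jmin: "J y \<le> J x" for x using m_le[of x] by linarith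
  have Re_f: "Re (f x) = Re (cinner x y)" for x
  proof -
    define g where "g = Re (cinner y x) - Re (f x)"
    have quad: "0 \<le> 2 * t * g + t\<^sup>2 * (norm x)\<^sup>2" for t
    proof -
      have "J (y + t *\<^sub>R x) = J y + 2 * t * g + t\<^sup>2 * (norm x)\<^sup>2"
        by (simp add: J_def norm_add_sq add fR g_def cinner_simps power_mult_distrib algebra_simps)
      with Jmin[of "y + t *\<^sub>R x"] show ?thesis by linarith
    qed
    have "g = 0"
    proof (rule ccontr)
      assume g: "g \<noteq> 0"
      \<comment> \<open>\<open>quad\<close> fails at t = -g/d. The summand 1 keeps d positive when x
        = 0.\<close>
      define d where "d = (norm x)\<^sup>2 + 1"
      have d: "d > 0" unfolding d_def by (simp add: add_nonneg_pos)
      have "2 * (- g / d) * g + (- g / d)\<^sup>2 * (norm x)\<^sup>2 = - (g\<^sup>2 / d\<^sup>2) * (d + 1)"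
      proof -
        have n: "(norm x)\<^sup>2 = d - 1" by (simp add: d_def)
        show ?thesis unfolding n using d by (simp add: field_simps power2_eq_square)
      qed
      moreover have "(g\<^sup>2 / d\<^sup>2) * (d + 1) > 0" using g d by simp
      ultimately show False using quad[of "- g / d"] by linarith
    qed
    then show ?thesis by (simp add: g_def Re_cinner_commute)
  qed
  have "Im (f x) = Im (cinner x y)" for x
    using Re_f[of "\<i> *\<^sub>C x"] by (simp add: scale cinner_scaleC_left)
  then show ?thesis using Re_f by (auto simp: complex_eq_iff)
qed

section \<open>Existence and uniqueness of the adjoint\<close>

lemma clinear_opsD: "a \<in> clinear_ops \<Longrightarrow> blinfun_apply a (c *\<^sub>C x) = c *\<^sub>C blinfun_apply a x"
  by (simp add: clinear_ops_def)

text \<open>Riesz applied to x \<mapsto> <a x, y> for each y. Uniqueness in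
  \<open>cinner_ext\<close> makes the result linear in y, and Cauchy--Schwarz tested with x = b y
  makes it bounded. This gives the definite description \<open>adj\<close> a value.\<close>

lemma adj_exists:
  assumes a: "a \<in> clinear_ops"
  shows "\<exists>b \<in> clinear_ops. \<forall>x y. cinner (blinfun_apply a x) y = cinner x (blinfun_apply b y)"
proof -
  have "\<exists>z. \<forall>x. cinner (blinfun_apply a x) y = cinner x z" for y
  proof (rule Riesz_representation[where K = "norm a * norm y"])
    show "cmod (cinner (blinfun_apply a x) y) \<le> norm a * norm y * norm x" for x
      using Cauchy_Schwarz_cinner[of "blinfun_apply a x" y]
        mult_right_mono[OF norm_blinfun[of a x], of "norm y"] by (simp add: mult_ac)
  qed (simp_all add: blinfun.add_right cinner_simps clinear_opsD[OF a])
  then obtain b where b: "\<And>x y. cinner (blinfun_apply a x) y = cinner x (b y)" by metis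
  have b_add: "b (y + z) = b y + b z" for y z
    by (rule cinner_ext) (simp add: b[symmetric] cinner_add_right)
  have b_scale: "b (c *\<^sub>C y) = c *\<^sub>C b y" for c y
    by (rule cinner_ext) (simp add: b[symmetric] cinner_scaleC_right)
  have b_bound: "norm (b y) \<le> norm y * norm a" for y
  proof -
    have "(norm (b y))\<^sup>2 = cmod (cinner (b y) (b y))"
      by (simp add: cinner_self_eq_norm norm_power)
    also have "\<dots> = cmod (cinner (blinfun_apply a (b y)) y)" by (simp add: b)
    also have "\<dots> \<le> norm (blinfun_apply a (b y)) * norm y" by (rule Cauchy_Schwarz_cinner)
    also have "\<dots> \<le> norm a * norm (b y) * norm y"
      by (intro mult_right_mono norm_blinfun) simp
    finally have "norm (b y) * norm (b y) \<le> norm (b y) * (norm y * norm a)"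
      by (simp add: power2_eq_square mult_ac)
    then show ?thesis
      by (metis mult_le_cancel_left_pos mult_nonneg_nonneg norm_ge_zero order_le_less)
  qed
  have lin: "bounded_linear b"
    by (rule bounded_linear_intro[where K = "norm a"]) (auto simp: b_add b_scale scaleR_scaleC b_bound)
  show ?thesis
    by (rule bexI[of _ "Blinfun b"])
      (auto simp: clinear_ops_def bounded_linear_Blinfun_apply[OF lin] b b_scale)
qed

text \<open>Resolves the definite description in \<open>adj\<close>, which asks for the pairing
  identity alone; the rules for adjoints below reduce to checking that identity.\<close>

lemma adj_eqI:
  assumes "\<And>x y. cinner (blinfun_apply a x) y = cinner x (blinfun_apply b y)"
  shows "adj a = b"
  unfolding adj_def
proof (rule the_equality)
  fix b' assume "\<forall>x y. cinner (blinfun_apply a x) y = cinner x (blinfun_apply b' y)"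
  then have "cinner x (blinfun_apply b' y) = cinner x (blinfun_apply b y)" for x y
    using assms[of x y] by simp
  then show "b' = b" by (intro blinfun_eqI cinner_ext)
qed (use assms in blast)

lemma
  assumes "a \<in> clinear_ops"
  shows cinner_adj: "cinner (blinfun_apply a x) y = cinner x (blinfun_apply (adj a) y)"
    and adj_clinear: "adj a \<in> clinear_ops"
proof -
  obtain b where b: "b \<in> clinear_ops"
    "\<And>x y. cinner (blinfun_apply a x) y = cinner x (blinfun_apply b y)"
    using adj_exists[OF assms] by blast
  have "adj a = b" by (rule adj_eqI) (rule b(2))
  then show "cinner (blinfun_apply a x) y = cinner x (blinfun_apply (adj a) y)" "adj a \<in> clinear_ops"
    using b by auto
qed

lemma cinner_adj':
  assumes "a \<in> clinear_ops"
  shows "cinner x (blinfun_apply a y) = cinner (blinfun_apply (adj a) x) y"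
  using arg_cong[OF cinner_adj[OF assms, of y x], of cnj] by (simp flip: cinner_commute)

section \<open>Algebra of complex-linear operators\<close>

lemma clinear_zero [simp]: "0 \<in> clinear_ops"
  by (simp add: clinear_ops_def bounded_bilinear.zero_right[OF bounded_bilinear_scaleC])

lemma clinear_id [simp]: "id_blinfun \<in> clinear_ops"
  by (simp add: clinear_ops_def)

lemma clinear_scalar [simp]: "scalar_op c \<in> clinear_ops"
  by (simp add: clinear_ops_def scalar_op.rep_eq scaleC_scaleC mult.commute)

lemma clinear_add: "a \<in> clinear_ops \<Longrightarrow> b \<in> clinear_ops \<Longrightarrow> a + b \<in> clinear_ops"
  by (simp add: clinear_ops_def blinfun.add_left scaleC_add_right)

lemma clinear_compose: "a \<in> clinear_ops \<Longrightarrow> b \<in> clinear_ops \<Longrightarrow> a \<ast> b \<in> clinear_ops"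
  by (simp add: clinear_ops_def)

lemma clinear_diff: "a \<in> clinear_ops \<Longrightarrow> b \<in> clinear_ops \<Longrightarrow> a - b \<in> clinear_ops"
  by (simp add: clinear_ops_def blinfun.diff_left
      bounded_bilinear.diff_right[OF bounded_bilinear_scaleC])

lemma clinear_sum: "(\<And>i. i \<in> I \<Longrightarrow> a i \<in> clinear_ops) \<Longrightarrow> sum a I \<in> clinear_ops"
  by (induction I rule: infinite_finite_induct) (auto intro: clinear_add)

lemma clinear_limit:
  assumes "\<And>n. a n \<in> clinear_ops" "a \<longlonglongrightarrow> b"
  shows "b \<in> clinear_ops"
proof -
  have "blinfun_apply b (c *\<^sub>C x) = c *\<^sub>C blinfun_apply b x" for c x
  proof (rule LIMSEQ_unique)
    show "(\<lambda>n. blinfun_apply (a n) (c *\<^sub>C x)) \<longlonglongrightarrow> blinfun_apply b (c *\<^sub>C x)"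
      by (intro tendsto_apply_op assms tendsto_const)
    show "(\<lambda>n. blinfun_apply (a n) (c *\<^sub>C x)) \<longlonglongrightarrow> c *\<^sub>C blinfun_apply b x"
      unfolding clinear_opsD[OF assms(1)] by (intro tendsto_scaleC tendsto_apply_op assms tendsto_const)
  qed
  then show ?thesis by (simp add: clinear_ops_def)
qed

lemma compose_assoc: "(a \<ast> b) \<ast> c = a \<ast> (b \<ast> c)"
  for a :: "'c::real_normed_vector \<Rightarrow>\<^sub>L 'd::real_normed_vector"
    and b :: "'b::real_normed_vector \<Rightarrow>\<^sub>L 'c" and c :: "'a::real_normed_vector \<Rightarrow>\<^sub>L 'b"
  by (rule blinfun_eqI) simp

lemma compose_id [simp]: "a \<ast> id_blinfun = a" "id_blinfun \<ast> a = a"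
  by (rule blinfun_eqI; simp)+

lemmas compose_simps = compose_assoc bounded_bilinear.add_left[OF bounded_bilinear_blinfun_compose]
  bounded_bilinear.add_right[OF bounded_bilinear_blinfun_compose]
  bounded_bilinear.diff_left[OF bounded_bilinear_blinfun_compose]
  bounded_bilinear.diff_right[OF bounded_bilinear_blinfun_compose]
  bounded_bilinear.minus_left[OF bounded_bilinear_blinfun_compose]
  bounded_bilinear.minus_right[OF bounded_bilinear_blinfun_compose]
  bounded_bilinear.sum_left[OF bounded_bilinear_blinfun_compose]
  bounded_bilinear.sum_right[OF bounded_bilinear_blinfun_compose]

lemma scalar_op_apply [simp]: "blinfun_apply (scalar_op c) x = c *\<^sub>C x"
  by (simp add: scalar_op.rep_eq)

lemma scalar_op_mult: "scalar_op (c * d) = c \<odot> scalar_op d"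
  by (rule blinfun_eqI) (simp add: scaleC_scaleC)

lemma scalar_op_add: "scalar_op (c + d) = scalar_op c + scalar_op d"
  by (rule blinfun_eqI) (simp add: scaleC_add_left blinfun.add_left)

lemma scalar_op_one [simp]: "scalar_op 1 = id_blinfun"
  by (rule blinfun_eqI) simp

lemma scalar_op_zero [simp]: "scalar_op 0 = 0"
  by (rule blinfun_eqI) (simp add: bounded_bilinear.zero_left[OF bounded_bilinear_scaleC])

lemma scalar_op_of_real: "of_real r \<odot> a = r *\<^sub>R a"
  by (rule blinfun_eqI) (simp add: scaleR_scaleC blinfun.scaleR_left)

lemma scalar_op_minus: "scalar_op (- c) = - scalar_op c"
  by (rule blinfun_eqI)
    (simp add: blinfun.minus_left bounded_bilinear.minus_left[OF bounded_bilinear_scaleC])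

lemma scalar_op_diff: "scalar_op (c - d) = scalar_op c - scalar_op d"
  using scalar_op_add[of c "- d"] by (simp add: scalar_op_minus)

lemma scalar_op_commute: "a \<in> clinear_ops \<Longrightarrow> a \<ast> scalar_op c = c \<odot> a"
  by (rule blinfun_eqI) (simp add: clinear_opsD)

lemma scalar_op_commute_left: "a \<in> clinear_ops \<Longrightarrow> a \<ast> (c \<odot> b) = c \<odot> (a \<ast> b)"
  by (rule blinfun_eqI) (simp add: clinear_opsD)

lemma norm_scalar_op_compose: "norm (c \<odot> a) \<le> cmod c * norm a"
proof (rule norm_blinfun_bound)
  show "norm (blinfun_apply (c \<odot> a) x) \<le> cmod c * norm a * norm x" for x
    using norm_blinfun[of a x] by (simp add: norm_scaleC mult.assoc mult_left_mono)
qed simp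

lemma tendsto_scalar_op:
  "(a \<longlongrightarrow> b) F \<Longrightarrow> ((\<lambda>i. c \<odot> a i) \<longlongrightarrow> c \<odot> b) F"
  by (intro tendsto_compose_op tendsto_const)

section \<open>Calculus of adjoints and their norms\<close>

lemma adj_adj: "a \<in> clinear_ops \<Longrightarrow> adj (adj a) = a"
  by (rule adj_eqI) (simp add: cinner_adj')

lemma adj_add:
  "a \<in> clinear_ops \<Longrightarrow> b \<in> clinear_ops \<Longrightarrow> adj (a + b) = adj a + adj b"
  by (rule adj_eqI) (simp add: blinfun.add_left cinner_simps cinner_adj)

lemma adj_diff:
  "a \<in> clinear_ops \<Longrightarrow> b \<in> clinear_ops \<Longrightarrow> adj (a - b) = adj a - adj b"
  by (rule adj_eqI) (simp add: blinfun.diff_left cinner_simps cinner_adj)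

lemma adj_compose:
  "a \<in> clinear_ops \<Longrightarrow> b \<in> clinear_ops \<Longrightarrow> adj (a \<ast> b) = adj b \<ast> adj a"
  by (rule adj_eqI) (simp add: cinner_adj)

lemma adj_scalar_op [simp]: "adj (scalar_op c) = scalar_op (cnj c)"
  by (rule adj_eqI) (simp add: cinner_simps)

lemma adj_id [simp]: "adj id_blinfun = id_blinfun"
  by (rule adj_eqI) simp

lemma adj_zero [simp]: "adj 0 = 0"
  by (rule adj_eqI) simp

lemma adj_scale: "a \<in> clinear_ops \<Longrightarrow> adj (c \<odot> a) = cnj c \<odot> adj a"
  by (simp add: adj_compose scalar_op_commute adj_clinear)

lemma adj_sum: "(\<And>i. i \<in> I \<Longrightarrow> a i \<in> clinear_ops) \<Longrightarrow> adj (sum a I) = (\<Sum>i\<in>I. adj (a i))"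
  by (induction I rule: infinite_finite_induct) (auto simp: adj_add clinear_sum)

lemma norm_adj_le:
  assumes "a \<in> clinear_ops" shows "norm (adj a) \<le> norm a"
proof (rule norm_blinfun_bound)
  fix y
  let ?b = "blinfun_apply (adj a) y"
  have "(norm ?b)\<^sup>2 = cmod (cinner ?b ?b)" by (simp add: cinner_self_eq_norm norm_power)
  also have "\<dots> = cmod (cinner (blinfun_apply a ?b) y)" by (simp add: cinner_adj[OF assms])
  also have "\<dots> \<le> norm (blinfun_apply a ?b) * norm y" by (rule Cauchy_Schwarz_cinner)
  also have "\<dots> \<le> norm a * norm ?b * norm y" by (intro mult_right_mono norm_blinfun) simp
  finally have "norm ?b * norm ?b \<le> norm ?b * (norm a * norm y)"
    by (simp add: power2_eq_square mult_ac)
  then show "norm ?b \<le> norm a * norm y"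
    by (metis mult_le_cancel_left_pos mult_nonneg_nonneg norm_ge_zero order_le_less)
qed simp

lemma tendsto_adj:
  assumes "\<And>n. a n \<in> clinear_ops" "b \<in> clinear_ops" "a \<longlonglongrightarrow> b"
  shows "(\<lambda>n. adj (a n)) \<longlonglongrightarrow> adj b"
proof -
  have "norm (adj (a n) - adj b) \<le> norm (a n - b)" for n
    using norm_adj_le[OF clinear_diff[OF assms(1,2)]] by (simp add: adj_diff assms)
  moreover have "(\<lambda>n. norm (a n - b)) \<longlonglongrightarrow> 0"
    using assms(3) by (simp add: tendsto_norm_zero LIM_zero)
  ultimately have "(\<lambda>n. adj (a n) - adj b) \<longlonglongrightarrow> 0"
    by (rule Lim_null_comparison[OF always_eventually[OF allI]])
  then show ?thesis by (simp add: LIM_zero_cancel)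
qed

text \<open>Polarisation bounds Re <h x, y> by the quadratic form, and y is then taken proportional
  to h x. This is the passage from spectral integrals, which control quadratic forms, to operator
  norms.\<close>

lemma norm_selfadjoint_le:
  assumes h: "h \<in> clinear_ops" "adj h = h" and d: "0 \<le> d"
    and q: "\<And>x. \<bar>Re (cinner (blinfun_apply h x) x)\<bar> \<le> d * (norm x)\<^sup>2"
  shows "norm h \<le> d"
proof (rule norm_blinfun_bound[OF d])
  have pol: "Re (cinner (blinfun_apply h x) y) \<le> d * ((norm x)\<^sup>2 + (norm y)\<^sup>2) / 2" for x y
  proof -
    have "4 * Re (cinner (blinfun_apply h x) y) =
      Re (cinner (blinfun_apply h (x + y)) (x + y)) - Re (cinner (blinfun_apply h (x - y)) (x - y))"
      using cinner_adj[OF h(1), of y x] h(2) Re_cinner_commute[of y "blinfun_apply h x"]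
      by (simp add: blinfun.add_right blinfun.diff_right cinner_simps)
    also have "\<dots> \<le> d * (norm (x + y))\<^sup>2 + d * (norm (x - y))\<^sup>2"
      using q[of "x + y"] q[of "x - y"] by linarith
    also have "\<dots> = 2 * (d * ((norm x)\<^sup>2 + (norm y)\<^sup>2))"
      by (simp add: norm_add_sq norm_diff_sq algebra_simps)
    finally show ?thesis by simp
  qed
  fix x
  let ?y = "blinfun_apply h x"
  show "norm ?y \<le> d * norm x"
  proof (cases "?y = 0 \<or> x = 0")
    case False
    \<comment> \<open>Scaling h x to the length of x balances the two squares in
      \<open>pol\<close>.\<close>
    define s where "s = norm x / norm ?y"
    have s: "s > 0" using False by (simp add: s_def)
    have "s * (norm ?y)\<^sup>2 \<le> d * ((norm x)\<^sup>2 + (s * norm ?y)\<^sup>2) / 2"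
      using pol[of x "s *\<^sub>R ?y"] s by (simp add: cinner_simps cinner_self_eq_norm)
    also have "s * norm ?y = norm x" using False by (simp add: s_def)
    finally have "norm x * norm ?y \<le> norm x * (d * norm x)"
      using False by (simp add: s_def power2_eq_square mult_ac)
    then show ?thesis using False by simp
  qed (use d in auto)
qed

section \<open>The trace as a bounded functional\<close>

locale tracial_algebra =
  fixes M :: "'h::chilbert_space bop set" and \<tau> :: "'h bop \<Rightarrow> complex"
  assumes tracial: "tracial_W_star_space M \<tau>"
begin

lemma M_clinear [simp]: "a \<in> M \<Longrightarrow> a \<in> clinear_ops"
  using tracial by (auto simp: tracial_W_star_space_def von_neumann_algebra_def)

lemma M_adj [simp]: "a \<in> M \<Longrightarrow> adj a \<in> M"
  using tracial by (auto simp: tracial_W_star_space_def von_neumann_algebra_def)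

text \<open>The double commutant turns membership in M into commutation with a fixed set of
  operators, a condition stable under sums, products and pointwise limits.\<close>

lemma M_iff: "a \<in> M \<longleftrightarrow> a \<in> clinear_ops \<and> (\<forall>b \<in> commutant M. b \<ast> a = a \<ast> b)"
proof -
  have "M = commutant (commutant M)"
    using tracial by (simp add: tracial_W_star_space_def von_neumann_algebra_def)
  then have "a \<in> M \<longleftrightarrow> a \<in> commutant (commutant M)" by simp
  then show ?thesis unfolding commutant_def[of "commutant M"] by simp
qed

lemma M_commute: "a \<in> M \<Longrightarrow> b \<in> commutant M \<Longrightarrow> b \<ast> a = a \<ast> b"
  using M_iff by blast

lemma M_memI:
  "a \<in> clinear_ops \<Longrightarrow> (\<And>b. b \<in> commutant M \<Longrightarrow> b \<ast> a = a \<ast> b) \<Longrightarrow> a \<in> M"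
  using M_iff by blast

lemma M_id [simp]: "id_blinfun \<in> M" by (rule M_memI) simp_all

lemma M_scalar_op [simp]: "scalar_op c \<in> M"
  by (rule M_memI) (auto simp: scalar_op_commute commutant_def)

lemma M_zero [simp]: "0 \<in> M" using M_scalar_op[of 0] by simp

lemma M_add [simp]: "a \<in> M \<Longrightarrow> b \<in> M \<Longrightarrow> a + b \<in> M"
  by (rule M_memI) (simp_all add: clinear_add compose_simps M_commute[of a] M_commute[of b])

lemma M_diff [simp]: "a \<in> M \<Longrightarrow> b \<in> M \<Longrightarrow> a - b \<in> M"
  by (rule M_memI) (simp_all add: clinear_diff compose_simps M_commute[of a] M_commute[of b])

lemma M_compose [simp]:
  assumes "a \<in> M" "b \<in> M" shows "a \<ast> b \<in> M"
proof -
  have "c \<ast> (a \<ast> b) = a \<ast> b \<ast> c" if "c \<in> commutant M" for c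
  proof -
    have "c \<ast> (a \<ast> b) = (c \<ast> a) \<ast> b" by (simp only: compose_assoc)
    also have "\<dots> = a \<ast> (c \<ast> b)" by (simp only: M_commute[OF assms(1) that] compose_assoc)
    also have "\<dots> = a \<ast> b \<ast> c" by (simp only: M_commute[OF assms(2) that] compose_assoc)
    finally show ?thesis .
  qed
  then show ?thesis using clinear_compose[OF M_clinear[OF assms(1)] M_clinear[OF assms(2)]]
    by (rule M_memI[rotated])
qed

lemma M_scaleR [simp]: "a \<in> M \<Longrightarrow> r *\<^sub>R a \<in> M"
  unfolding scalar_op_of_real[symmetric] by (rule M_compose[OF M_scalar_op])

lemma M_sum [simp]: "(\<And>i. i \<in> I \<Longrightarrow> a i \<in> M) \<Longrightarrow> sum a I \<in> M"
  by (induction I rule: infinite_finite_induct) auto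

text \<open>Pointwise rather than norm convergence is needed here, since it is the mode in which
  polynomials in D reach a spectral projection.\<close>

lemma M_strong_limit:
  assumes a: "\<And>n. a n \<in> M" and lim: "\<And>x. (\<lambda>n. blinfun_apply (a n) x) \<longlonglongrightarrow> blinfun_apply b x"
  shows "b \<in> M"
proof -
  have "blinfun_apply b (c *\<^sub>C x) = c *\<^sub>C blinfun_apply b x" for c x
  proof (rule LIMSEQ_unique[OF lim])
    show "(\<lambda>n. blinfun_apply (a n) (c *\<^sub>C x)) \<longlonglongrightarrow> c *\<^sub>C blinfun_apply b x"
      unfolding clinear_opsD[OF M_clinear[OF a]] by (intro tendsto_scaleC lim tendsto_const)
  qed
  moreover have "blinfun_apply d (blinfun_apply b x) = blinfun_apply b (blinfun_apply d x)"
    if d: "d \<in> commutant M" for d x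
  proof (rule LIMSEQ_unique)
    show "(\<lambda>n. blinfun_apply d (blinfun_apply (a n) x)) \<longlonglongrightarrow> blinfun_apply d (blinfun_apply b x)"
      by (intro tendsto_apply_op lim tendsto_const)
    have "blinfun_apply d (blinfun_apply (a n) x) = blinfun_apply (a n) (blinfun_apply d x)" for n
      using M_commute[OF a[of n] d] by (metis blinfun_apply_blinfun_compose)
    then show "(\<lambda>n. blinfun_apply d (blinfun_apply (a n) x)) \<longlonglongrightarrow> blinfun_apply b (blinfun_apply d x)"
      using lim by simp
  qed
  ultimately show ?thesis
    by (intro M_memI) (auto simp: clinear_ops_def intro!: blinfun_eqI)
qed

lemma M_limit: "(\<And>n. a n \<in> M) \<Longrightarrow> a \<longlonglongrightarrow> b \<Longrightarrow> b \<in> M"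
  by (rule M_strong_limit) (auto intro: tendsto_apply_op)

lemma adj_M_simps [simp]:
  "a \<in> M \<Longrightarrow> adj (adj a) = a"
  "a \<in> M \<Longrightarrow> b \<in> M \<Longrightarrow> adj (a + b) = adj a + adj b"
  "a \<in> M \<Longrightarrow> b \<in> M \<Longrightarrow> adj (a - b) = adj a - adj b"
  "a \<in> M \<Longrightarrow> b \<in> M \<Longrightarrow> adj (a \<ast> b) = adj b \<ast> adj a"
  by (simp_all add: adj_adj adj_add adj_diff adj_compose)

lemma adj_scale_M: "a \<in> M \<Longrightarrow> adj (c \<odot> a) = cnj c \<odot> adj a"
  by (rule adj_scale) (rule M_clinear)

lemma adj_scaleR [simp]: "a \<in> M \<Longrightarrow> adj (r *\<^sub>R a) = r *\<^sub>R adj a"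
  using adj_scale[of a "of_real r"] by (simp add: scalar_op_of_real)

lemma tau_add: "a \<in> M \<Longrightarrow> b \<in> M \<Longrightarrow> \<tau> (a + b) = \<tau> a + \<tau> b"
  and tau_scale: "a \<in> M \<Longrightarrow> \<tau> (c \<odot> a) = c * \<tau> a"
  and tau_id: "\<tau> id_blinfun = 1"
  and tau_square: "a \<in> M \<Longrightarrow> \<tau> (adj a \<ast> a) \<in> \<real>\<^sub>\<ge>\<^sub>0"
  and tau_faithful: "a \<in> M \<Longrightarrow> \<tau> (adj a \<ast> a) = 0 \<Longrightarrow> a = 0"
  and tau_trace: "a \<in> M \<Longrightarrow> b \<in> M \<Longrightarrow> \<tau> (a \<ast> b) = \<tau> (b \<ast> a)"
proof -
  note t = tracial[unfolded tracial_W_star_space_def, THEN conjunct2]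
  note t2 = t[THEN conjunct2]
  note t3 = t2[THEN conjunct2]
  note t4 = t3[THEN conjunct2]
  note t5 = t4[THEN conjunct2]
  note t6 = t5[THEN conjunct2]
  show "a \<in> M \<Longrightarrow> b \<in> M \<Longrightarrow> \<tau> (a + b) = \<tau> a + \<tau> b" by (rule t[THEN conjunct1, rule_format])
  show "a \<in> M \<Longrightarrow> \<tau> (c \<odot> a) = c * \<tau> a" by (rule t2[THEN conjunct1, rule_format])
  show "\<tau> id_blinfun = 1" by (rule t3[THEN conjunct1])
  show "a \<in> M \<Longrightarrow> \<tau> (adj a \<ast> a) \<in> \<real>\<^sub>\<ge>\<^sub>0" by (rule t4[THEN conjunct1, rule_format])
  show "a \<in> M \<Longrightarrow> \<tau> (adj a \<ast> a) = 0 \<Longrightarrow> a = 0" by (rule t5[THEN conjunct1, rule_format])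
  show "a \<in> M \<Longrightarrow> b \<in> M \<Longrightarrow> \<tau> (a \<ast> b) = \<tau> (b \<ast> a)" by (rule t6[THEN conjunct1, rule_format])
qed

lemma tau_scalar_op: "\<tau> (scalar_op c) = c"
  using tau_scale[of id_blinfun c] by (simp add: tau_id)

lemma tau_zero: "\<tau> 0 = 0"
  using tau_scale[of 0 0] by simp

lemma tau_scaleR: "a \<in> M \<Longrightarrow> \<tau> (r *\<^sub>R a) = of_real r * \<tau> a"
  using tau_scale[of a "of_real r"] by (simp add: scalar_op_of_real)

lemma tau_diff: "a \<in> M \<Longrightarrow> b \<in> M \<Longrightarrow> \<tau> (a - b) = \<tau> a - \<tau> b"
  using tau_add[of "a - b" b] by simp

lemma tau_sum: "(\<And>i. i \<in> I \<Longrightarrow> a i \<in> M) \<Longrightarrow> \<tau> (sum a I) = (\<Sum>i\<in>I. \<tau> (a i))"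
  by (induction I rule: infinite_finite_induct) (auto simp: tau_add tau_zero)

text \<open>The square root of \<open>1 - x\<close> is \<open>1 - y\<close> for the fixed point \<open>y\<close> of the contraction \<open>y \<mapsto> (x + y\<^sup>2) / 2\<close>.\<close>

lemma square_root_near_id:
  assumes x: "x \<in> M" "adj x = x" "norm x < 1"
  shows "\<exists>y\<in>M. adj y = y \<and> (id_blinfun - y) \<ast> (id_blinfun - y) = id_blinfun - x"
proof -
  define r where "r = norm x"
  define S where "S = {y \<in> M. adj y = y \<and> norm y \<le> r}"
  define f where "f y = (1/2) *\<^sub>R (x + y \<ast> y)" for y
  have r: "0 \<le> r" "r < 1" using x by (auto simp: r_def)
  have "closed S"
  proof (unfold closed_sequential_limits, intro allI impI, elim conjE)
    fix u l assume u: "\<forall>n. u n \<in> S" and lim: "u \<longlonglongrightarrow> l"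
    have l: "l \<in> M" using M_limit[OF _ lim] u by (auto simp: S_def)
    have "(\<lambda>n. adj (u n)) \<longlonglongrightarrow> adj l"
      by (rule tendsto_adj) (use u l lim in \<open>auto simp: S_def\<close>)
    moreover have "(\<lambda>n. adj (u n)) = u" using u by (auto simp: S_def)
    ultimately have "adj l = l" using lim LIMSEQ_unique by metis
    moreover have "norm l \<le> r"
      by (rule LIMSEQ_le_const2[OF tendsto_norm[OF lim]]) (use u in \<open>auto simp: S_def\<close>)
    ultimately show "l \<in> S" using l by (simp add: S_def)
  qed
  note S_complete = complete_eq_closed[THEN iffD2, OF this]
  have "0 \<in> S" using r by (simp add: S_def)
  moreover have "f ` S \<subseteq> S"
  proof safe
    fix y assume y: "y \<in> S"
    have "norm (f y) \<le> (r + r * r) / 2"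
      using norm_triangle_ineq[of x "y \<ast> y"] norm_blinfun_compose[of y y] y r
        mult_mono[of "norm y" r "norm y" r] by (simp add: f_def S_def r_def)
    also have "\<dots> \<le> r" using mult_left_mono[of r 1 r] r by simp
    finally show "f y \<in> S" using y x by (simp add: S_def f_def)
  qed
  moreover have "dist (f y) (f z) \<le> r * dist y z" if yz: "y \<in> S" "z \<in> S" for y z
  proof -
    have "f y - f z = (1/2) *\<^sub>R (y \<ast> (y - z) + (y - z) \<ast> z)"
      by (simp add: f_def compose_simps flip: scaleR_diff_right)
    then have "norm (f y - f z) \<le> (norm (y \<ast> (y - z)) + norm ((y - z) \<ast> z)) / 2"
      using norm_triangle_ineq[of "y \<ast> (y - z)" "(y - z) \<ast> z"] by simp
    also have "\<dots> \<le> (norm y * norm (y - z) + norm (y - z) * norm z) / 2"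
      by (intro divide_right_mono add_mono norm_blinfun_compose) simp
    also have "\<dots> \<le> (r * norm (y - z) + norm (y - z) * r) / 2"
      using yz by (intro divide_right_mono add_mono mult_left_mono mult_right_mono) (auto simp: S_def)
    finally show ?thesis by (simp add: dist_norm mult.commute)
  qed
  ultimately obtain y where y: "y \<in> S" "f y = y"
    using Banach_fix[OF S_complete, of r f] r by blast
  have "2 *\<^sub>R y = x + y \<ast> y"
    using arg_cong[OF y(2), of "scaleR 2"] by (simp add: f_def)
  then have "(id_blinfun - y) \<ast> (id_blinfun - y) = id_blinfun - x"
    by (simp add: compose_simps scaleR_2 algebra_simps)
  then show ?thesis using y by (auto simp: S_def)
qed

text \<open>For r > |x| the operator r - x equals r (1 - y)^2 with y selfadjoint in M, so r adj(c) c
  - adj(c) x c is r adj(e) e with e = (1 - y) c and has nonnegative trace. Positivity on squares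
  thus yields the norm bounds for \<tau>; the conjugation by c is what later makes left
  multiplication bounded in \<open>norm2\<close>.\<close>

lemma tau_conj_square_le:
  assumes x: "x \<in> M" "adj x = x" and c: "c \<in> M"
  shows "\<tau> (adj c \<ast> (x \<ast> c)) \<in> \<real>"
    and "Re (\<tau> (adj c \<ast> (x \<ast> c))) \<le> norm x * Re (\<tau> (adj c \<ast> c))"
proof -
  define t where "t = Re (\<tau> (adj c \<ast> c))"
  have tc: "\<tau> (adj c \<ast> c) = of_real t"
    using tau_square[OF c] by (auto simp: t_def nonneg_Reals_def)
  have key: "of_real r * of_real t - \<tau> (adj c \<ast> (x \<ast> c)) \<in> \<real>\<^sub>\<ge>\<^sub>0" if r: "norm x < r" for r
  proof -
    have r0: "r > 0" using r norm_ge_zero[of x] by linarith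
    have "norm ((1/r) *\<^sub>R x) < 1" using r r0 by simp
    then obtain y where y: "y \<in> M" "adj y = y"
      "(id_blinfun - y) \<ast> (id_blinfun - y) = id_blinfun - (1/r) *\<^sub>R x"
      using square_root_near_id[of "(1/r) *\<^sub>R x"] x by auto
    define e where "e = (id_blinfun - y) \<ast> c"
    have e: "e \<in> M" using y c by (simp add: e_def)
    have "adj e \<ast> e = adj c \<ast> ((id_blinfun - y) \<ast> (id_blinfun - y)) \<ast> c"
      using y(1,2) c by (simp add: e_def compose_assoc)
    also have "\<dots> = adj c \<ast> c - (1/r) *\<^sub>R (adj c \<ast> (x \<ast> c))"
      unfolding y(3) by (simp add: compose_simps
          bounded_bilinear.scaleR_left[OF bounded_bilinear_blinfun_compose]
          bounded_bilinear.scaleR_right[OF bounded_bilinear_blinfun_compose])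
    finally have "\<tau> (adj e \<ast> e) = of_real t - of_real (1/r) * \<tau> (adj c \<ast> (x \<ast> c))"
      using x c by (simp add: tau_diff tau_scaleR tc)
    then have "of_real r * of_real t - \<tau> (adj c \<ast> (x \<ast> c)) = of_real r * \<tau> (adj e \<ast> e)"
      using r0 by (simp add: field_simps)
    then show ?thesis using tau_square[OF e] r0 by (auto simp: nonneg_Reals_def)
        (metis of_real_mult mult_nonneg_nonneg less_imp_le)
  qed
  have im: "Im (\<tau> (adj c \<ast> (x \<ast> c))) = 0"
    using key[of "norm x + 1"] by (auto simp: complex_nonneg_Reals_iff)
  then show "\<tau> (adj c \<ast> (x \<ast> c)) \<in> \<real>" by (simp add: complex_is_Real_iff)
  have le: "Re (\<tau> (adj c \<ast> (x \<ast> c))) \<le> r * t" if "norm x < r" for r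
    using key[OF that] by (auto simp: complex_nonneg_Reals_iff)
  have t0: "0 \<le> t" using tau_square[OF c] by (auto simp: t_def complex_nonneg_Reals_iff)
  show "Re (\<tau> (adj c \<ast> (x \<ast> c))) \<le> norm x * Re (\<tau> (adj c \<ast> c))"
    unfolding t_def[symmetric]
  \<comment> \<open>The slack in r is e/(t + 1) rather than e/t because t may vanish.\<close>
  proof (rule field_le_epsilon)
    fix e :: real assume e: "e > 0"
    have "Re (\<tau> (adj c \<ast> (x \<ast> c))) \<le> (norm x + e / (t + 1)) * t"
      using e t0 by (intro le) simp
    also have "\<dots> = norm x * t + e * (t / (t + 1))" by (simp add: algebra_simps)
    also have "e * (t / (t + 1)) \<le> e"
      using e t0 by (intro mult_left_le) (auto simp: divide_le_eq)
    finally show "Re (\<tau> (adj c \<ast> (x \<ast> c))) \<le> norm x * t + e" by simp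
  qed
qed

lemma tau_selfadjoint:
  assumes "x \<in> M" "adj x = x"
  shows "\<tau> x \<in> \<real>" "Re (\<tau> x) \<le> norm x"
  using tau_conj_square_le[OF assms M_id] by (simp_all add: tau_id)

text \<open>Selfadjoint elements have real trace; this is applied to a + adj a and to i (a - adj
  a).\<close>

lemma tau_adj:
  assumes a: "a \<in> M" shows "\<tau> (adj a) = cnj (\<tau> a)"
proof -
  have "\<tau> (a + adj a) \<in> \<real>" using a by (intro tau_selfadjoint) (auto simp: add.commute)
  moreover have "\<tau> (\<i> \<odot> (a - adj a)) \<in> \<real>"
    using a by (intro tau_selfadjoint) (auto simp: adj_scale_M scalar_op_minus compose_simps simp del: adj_M_simps(4))
  ultimately show ?thesis using a
    by (simp add: tau_add tau_diff tau_scale complex_is_Real_iff complex_eq_iff)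
qed

text \<open>\<tau> is known to be positive on elements adj(a) a, while spectral calculus produces
  positive quadratic forms. With h = |a| - a the numerical radius gives |h| \<le> |a|, so Re
  \<tau>(h) \<le> |a|, which says Re \<tau>(a) \<ge> 0.\<close>

lemma tau_positive:
  assumes a: "a \<in> M" "adj a = a" and pos: "\<And>x. 0 \<le> Re (cinner (blinfun_apply a x) x)"
  shows "0 \<le> Re (\<tau> a)"
proof -
  define h where "h = norm a *\<^sub>R id_blinfun - a"
  have "norm h \<le> norm a"
  proof (rule norm_selfadjoint_le)
    fix x
    have "Re (cinner (blinfun_apply a x) x) \<le> norm a * (norm x)\<^sup>2"
      using complex_Re_le_cmod[of "cinner (blinfun_apply a x) x"]
        Cauchy_Schwarz_cinner[of "blinfun_apply a x" x]
        mult_right_mono[OF norm_blinfun[of a x] norm_ge_zero[of x]]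
      by (simp add: power2_eq_square mult.assoc)
    then show "\<bar>Re (cinner (blinfun_apply h x) x)\<bar> \<le> norm a * (norm x)\<^sup>2"
      using pos[of x]
      by (simp add: h_def blinfun.diff_left blinfun.scaleR_left cinner_simps cinner_self_eq_norm)
  qed (use a in \<open>simp_all add: h_def\<close>)
  moreover have "Re (\<tau> h) \<le> norm h"
    using a by (intro tau_selfadjoint) (simp_all add: h_def)
  moreover have "\<tau> h = of_real (norm a) - \<tau> a"
    using a by (simp add: h_def tau_diff tau_scaleR tau_id)
  ultimately show ?thesis by simp
qed

text \<open>The norm of L2(M, \<tau>). An indicator function is in general no uniform limit of
  polynomials, but in this norm the spectral projections of intervals are limits of polynomials in
  D.\<close>

definition norm2 :: "'h bop \<Rightarrow> real" where
  "norm2 a = sqrt (Re (\<tau> (adj a \<ast> a)))"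

lemma norm2_nonneg: "a \<in> M \<Longrightarrow> 0 \<le> norm2 a"
  using tau_square[of a] by (simp add: norm2_def complex_nonneg_Reals_iff)

lemma norm2_sq: "a \<in> M \<Longrightarrow> (norm2 a)\<^sup>2 = Re (\<tau> (adj a \<ast> a))"
  using tau_square[of a] by (simp add: norm2_def complex_nonneg_Reals_iff)

lemma tau_adj_self: "a \<in> M \<Longrightarrow> \<tau> (adj a \<ast> a) = of_real ((norm2 a)\<^sup>2)"
  using tau_square[of a] by (simp add: norm2_def complex_nonneg_Reals_iff complex_eq_iff)

lemma Cauchy_Schwarz_tau:
  assumes a: "a \<in> M" and b: "b \<in> M"
  shows "cmod (\<tau> (adj a \<ast> b)) \<le> norm2 a * norm2 b"
proof (cases "norm2 a = 0")
  case True
  then have "a = 0" using tau_faithful[OF a] tau_adj_self[OF a] by simp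
  then show ?thesis by (simp add: norm2_def tau_zero)
next
  case False
  define q where "q = (norm2 a)\<^sup>2"
  define w where "w = \<tau> (adj a \<ast> b)"
  define c where "c = w / of_real q"
  have q: "q > 0" using False by (simp add: q_def)
  have w': "\<tau> (adj b \<ast> a) = cnj w"
    using tau_adj[of "adj a \<ast> b"] a b by (simp add: w_def)
  define e where "e = b - c \<odot> a"
  have e: "e \<in> M" using a b by (simp add: e_def)
  have "adj e \<ast> e = adj b \<ast> b - c \<odot> (adj b \<ast> a) - cnj c \<odot> (adj a \<ast> b) + (cnj c * c) \<odot> (adj a \<ast> a)"
    using a b
    by (simp add: e_def adj_scale_M compose_simps scalar_op_commute_left[of "adj b"]
        scalar_op_commute_left[of "adj a"] scalar_op_commute_left[of "scalar_op (cnj c)" c]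
        scalar_op_mult algebra_simps del: adj_M_simps(4))
  then have "\<tau> (adj e \<ast> e) = \<tau> (adj b \<ast> b) - c * cnj w - cnj c * w + cnj c * c * of_real q"
    using a b by (simp add: tau_add tau_diff tau_scale w' tau_adj_self q_def flip: w_def)
  also have "cnj c * c * of_real q = cnj c * w"
    using q by (simp add: c_def)
  also have "c * cnj w = of_real ((cmod w)\<^sup>2 / q)"
    unfolding complex_norm_square c_def of_real_divide by simp
  finally have "\<tau> (adj e \<ast> e) = of_real ((norm2 b)\<^sup>2 - (cmod w)\<^sup>2 / q)"
    using b by (simp add: tau_adj_self)
  then have "(cmod w)\<^sup>2 / q \<le> (norm2 b)\<^sup>2"
    using tau_square[OF e] by (simp del: of_real_diff of_real_divide of_real_power)
  then have "(cmod w)\<^sup>2 \<le> (norm2 a * norm2 b)\<^sup>2"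
    using q by (simp add: q_def field_simps power_mult_distrib)
  then show ?thesis unfolding w_def
    by (rule power2_le_imp_le) (simp add: a b norm2_nonneg)
qed

lemma norm2_compose_left:
  assumes "a \<in> M" "c \<in> M" shows "norm2 (a \<ast> c) \<le> norm a * norm2 c"
proof (rule power2_le_imp_le)
  have "(norm2 (a \<ast> c))\<^sup>2 = Re (\<tau> (adj c \<ast> ((adj a \<ast> a) \<ast> c)))"
    using assms by (simp add: norm2_sq compose_assoc)
  also have "\<dots> \<le> norm (adj a \<ast> a) * (norm2 c)\<^sup>2"
    using assms unfolding norm2_sq[OF assms(2)] by (intro tau_conj_square_le) auto
  also have "norm (adj a \<ast> a) \<le> norm a * norm a"
    using norm_blinfun_compose[of "adj a" a] mult_right_mono[OF norm_adj_le[of a] norm_ge_zero[of a]] assms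
    by simp
  finally show "(norm2 (a \<ast> c))\<^sup>2 \<le> (norm a * norm2 c)\<^sup>2"
    by (simp add: power_mult_distrib power2_eq_square mult_right_mono mult_ac)
qed (simp add: assms norm2_nonneg)

lemma norm2_adj: "a \<in> M \<Longrightarrow> norm2 (adj a) = norm2 a"
  unfolding norm2_def by (simp add: tau_trace)

text \<open>The trace property makes the adjoint isometric in \<open>norm2\<close>, and the adjoint
  exchanges right and left multiplication.\<close>

lemma norm2_compose_right:
  assumes "a \<in> M" "c \<in> M" shows "norm2 (c \<ast> a) \<le> norm2 c * norm a"
proof -
  have "norm2 (c \<ast> a) = norm2 (adj a \<ast> adj c)"
    using norm2_adj[of "c \<ast> a"] assms by simp
  also have "\<dots> \<le> norm (adj a) * norm2 (adj c)" using assms by (intro norm2_compose_left) auto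
  also have "\<dots> \<le> norm a * norm2 c"
    using assms by (simp add: norm2_adj norm_adj_le mult_right_mono norm2_nonneg)
  finally show ?thesis by (simp add: mult.commute)
qed

lemma norm2_id [simp]: "norm2 id_blinfun = 1"
  by (simp add: norm2_def tau_id)

lemma norm2_le_norm: "a \<in> M \<Longrightarrow> norm2 a \<le> norm a"
  using norm2_compose_left[of a id_blinfun] by simp

lemma tau_le_norm2: "a \<in> M \<Longrightarrow> cmod (\<tau> a) \<le> norm2 a"
  using Cauchy_Schwarz_tau[of id_blinfun a] by simp

lemma tau_le_norm: "a \<in> M \<Longrightarrow> cmod (\<tau> a) \<le> norm a"
  using tau_le_norm2 norm2_le_norm order_trans by blast

lemma norm2_triangle:
  assumes a: "a \<in> M" and b: "b \<in> M" shows "norm2 (a + b) \<le> norm2 a + norm2 b"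
proof (rule power2_le_imp_le)
  have ab: "Re (\<tau> (adj a \<ast> b)) \<le> norm2 a * norm2 b"
    using Cauchy_Schwarz_tau[OF a b] complex_Re_le_cmod order_trans by blast
  have "Re (\<tau> (adj b \<ast> a)) = Re (\<tau> (adj a \<ast> b))"
    using tau_adj[of "adj a \<ast> b"] a b by simp
  then have "(norm2 (a + b))\<^sup>2 = (norm2 a)\<^sup>2 + 2 * Re (\<tau> (adj a \<ast> b)) + (norm2 b)\<^sup>2"
    using a b by (simp add: norm2_sq compose_simps tau_add)
  with ab show "(norm2 (a + b))\<^sup>2 \<le> (norm2 a + norm2 b)\<^sup>2" by (simp add: power2_sum)
qed (simp add: a b norm2_nonneg)

lemma norm2_zero [simp]: "norm2 0 = 0"
  by (simp add: norm2_def tau_zero)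

lemma norm2_minus_commute: "norm2 (a - b) = norm2 (b - a)" if "a \<in> M" "b \<in> M"
proof -
  have "adj (a - b) \<ast> (a - b) = adj (b - a) \<ast> (b - a)"
    using that by (simp add: compose_simps algebra_simps)
  then show ?thesis by (simp add: norm2_def)
qed

lemma norm2_triangle_diff:
  "a \<in> M \<Longrightarrow> b \<in> M \<Longrightarrow> c \<in> M \<Longrightarrow> norm2 (a - c) \<le> norm2 (a - b) + norm2 (b - c)"
  using norm2_triangle[of "a - b" "b - c"] by simp

lemma norm2_scale: "a \<in> M \<Longrightarrow> norm2 (c \<odot> a) \<le> cmod c * norm2 a"
proof -
  assume a: "a \<in> M"
  have "norm (scalar_op c :: 'h bop) \<le> cmod c * norm (id_blinfun :: 'h bop)"
    using norm_scalar_op_compose[of c id_blinfun] by simp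
  also have "\<dots> \<le> cmod c * 1" by (intro mult_left_mono norm_blinfun_id_le) simp
  finally have "norm (scalar_op c :: 'h bop) \<le> cmod c" by simp
  then have "norm (scalar_op c :: 'h bop) * norm2 a \<le> cmod c * norm2 a"
    by (rule mult_right_mono) (rule norm2_nonneg[OF a])
  then show ?thesis using norm2_compose_left[of "scalar_op c" a] a by simp
qed

lemma tau_tendsto:
  assumes "\<And>n. a n \<in> M" "a \<longlonglongrightarrow> b" shows "(\<lambda>n. \<tau> (a n)) \<longlonglongrightarrow> \<tau> b"
proof -
  have b: "b \<in> M" using M_limit assms by blast
  have "(\<lambda>n. \<tau> (a n) - \<tau> b) \<longlonglongrightarrow> 0"
  proof (rule Lim_null_comparison)
    show "\<forall>\<^sub>F n in sequentially. norm (\<tau> (a n) - \<tau> b) \<le> norm (a n - b)"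
      using tau_le_norm[OF M_diff[OF assms(1) b]] by (simp add: tau_diff assms b)
    show "(\<lambda>n. norm (a n - b)) \<longlonglongrightarrow> 0" using assms(2) by (simp add: tendsto_norm_zero LIM_zero)
  qed
  then show ?thesis by (rule LIM_zero_cancel)
qed

end

section \<open>Functional calculus of a spectral measure\<close>

lemma op_power_Suc [simp]: "op_power a (Suc n) = a \<ast> op_power a n"
  and op_power_0 [simp]: "op_power a 0 = id_blinfun"
  by (simp_all add: op_power_def)

locale spectral_resolution =
  fixes D :: "'h::chilbert_space bop" and E :: "real set \<Rightarrow> 'h bop"
  assumes spectral: "spectral_measure D E"
    and D_clinear: "D \<in> clinear_ops" and D_adj: "adj D = D"
begin

section \<open>The projection-valued measure and its scalar measures\<close>

lemma E_clinear [simp]: "B \<in> sets borel \<Longrightarrow> E B \<in> clinear_ops"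
  and E_adj [simp]: "B \<in> sets borel \<Longrightarrow> adj (E B) = E B"
  and E_Int: "A \<in> sets borel \<Longrightarrow> B \<in> sets borel \<Longrightarrow> E (A \<inter> B) = E A \<ast> E B"
  and E_UNIV [simp]: "E UNIV = id_blinfun"
  and E_sums: "range F \<subseteq> sets borel \<Longrightarrow> disjoint_family F \<Longrightarrow>
    (\<lambda>n. blinfun_apply (E (F n)) x) sums blinfun_apply (E (\<Union>n. F n)) x"
  using spectral by (simp_all add: spectral_measure_def)

lemma E_empty [simp]: "E {} = 0"
proof (rule blinfun_eqI)
  fix x
  have "(\<lambda>n::nat. blinfun_apply (E {}) x) sums blinfun_apply (E (\<Union>n::nat. {})) x"
    by (rule E_sums) (auto simp: disjoint_family_on_def)
  then have "(\<lambda>n::nat. blinfun_apply (E {}) x) \<longlonglongrightarrow> 0"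
    by (intro summable_LIMSEQ_zero sums_summable)
  then show "blinfun_apply (E {}) x = blinfun_apply 0 x" by (simp add: LIMSEQ_const_iff)
qed

lemma E_Un:
  assumes "A \<in> sets borel" "B \<in> sets borel" "A \<inter> B = {}"
  shows "E (A \<union> B) = E A + E B"
proof (rule blinfun_eqI)
  fix x
  have "(\<lambda>n. blinfun_apply (E (binaryset A B n)) x) sums blinfun_apply (E (\<Union>n. binaryset A B n)) x"
    by (rule E_sums) (use assms in \<open>auto simp: disjoint_family_on_def binaryset_def split: if_splits\<close>)
  moreover have "(\<lambda>n. blinfun_apply (E (binaryset A B n)) x) sums (blinfun_apply (E A) x + blinfun_apply (E B) x)"
    by (rule binaryset_sums[of "\<lambda>S. blinfun_apply (E S) x"]) simp
  ultimately show "blinfun_apply (E (A \<union> B)) x = blinfun_apply (E A + E B) x"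
    by (simp add: UN_binaryset_eq blinfun.add_left sums_unique2)
qed

lemma cinner_E:
  assumes "B \<in> sets borel"
  shows "cinner (blinfun_apply (E B) x) x = of_real ((norm (blinfun_apply (E B) x))\<^sup>2)"
proof -
  have "blinfun_apply (E B) (blinfun_apply (E B) x) = blinfun_apply (E B) x"
    using E_Int[OF assms assms] by (metis Int_absorb blinfun_apply_blinfun_compose)
  then have "cinner (blinfun_apply (E B) x) x = cinner (blinfun_apply (E B) x) (blinfun_apply (E B) x)"
    using cinner_adj[OF E_clinear[OF assms], of "blinfun_apply (E B) x" x] assms by simp
  then show ?thesis by (simp only: cinner_self_eq_norm)
qed

definition vmeasure :: "'h \<Rightarrow> real measure" where
  "vmeasure x = measure_of UNIV (sets borel) (\<lambda>B. ennreal (Re (cinner (blinfun_apply (E B) x) x)))"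

lemma sets_vmeasure [simp, measurable_cong]: "sets (vmeasure x) = sets borel"
  and space_vmeasure [simp]: "space (vmeasure x) = UNIV"
  unfolding vmeasure_def
  by (simp_all add: sigma_algebra.sets_measure_of_eq sets.sigma_sets_eq[of borel, simplified]
      space_measure_of_conv)

text \<open>\<open>measure_of\<close> takes the intended values once its set function is known to be
  a measure; countable additivity is derived from \<open>E_sums\<close>. The values are squared
  norms because E B is a projection.\<close>

lemma emeasure_vmeasure:
  assumes B: "B \<in> sets borel"
  shows "emeasure (vmeasure x) B = ennreal ((norm (blinfun_apply (E B) x))\<^sup>2)"
proof -
  have "emeasure (vmeasure x) B = ennreal (Re (cinner (blinfun_apply (E B) x) x))"
    unfolding vmeasure_def
  proof (rule emeasure_measure_of_sigma[OF _ _ _ B])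
    show "sigma_algebra UNIV (sets borel :: real set set)"
      using sets.sigma_algebra_axioms[of "borel :: real measure"] by simp
    show "positive (sets borel) (\<lambda>B. ennreal (Re (cinner (blinfun_apply (E B) x) x)))"
      by (simp add: positive_def)
    show "countably_additive (sets borel) (\<lambda>B. ennreal (Re (cinner (blinfun_apply (E B) x) x)))"
    proof (rule countably_additiveI)
      fix F :: "nat \<Rightarrow> real set"
      assume F: "range F \<subseteq> sets borel" "disjoint_family F"
      have "(\<lambda>n. Re (cinner (blinfun_apply (E (F n)) x) x)) sums
          Re (cinner (blinfun_apply (E (\<Union>n. F n)) x) x)"
        using bounded_linear.sums[OF bounded_bilinear.bounded_linear_left[OF bounded_bilinear_cinner]
            E_sums[OF F]] by (rule sums_Re)
      then show "(\<Sum>i. ennreal (Re (cinner (blinfun_apply (E (F i)) x) x))) =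
          ennreal (Re (cinner (blinfun_apply (E (\<Union> (range F))) x) x))"
        using F by (intro suminf_ennreal_eq) (auto simp: cinner_E)
    qed
  qed
  then show ?thesis using B by (simp add: cinner_E del: of_real_power)
qed

lemma finite_vmeasure: "finite_measure (vmeasure x)"
  by (rule finite_measureI) (simp add: emeasure_vmeasure)

lemma measure_vmeasure: "B \<in> sets borel \<Longrightarrow> measure (vmeasure x) B = (norm (blinfun_apply (E B) x))\<^sup>2"
  by (simp add: measure_def emeasure_vmeasure)

lemma vmeasure_D:
  shows integrable_vmeasure_D: "integrable (vmeasure x) (\<lambda>t. t)"
    and integral_vmeasure_D: "(\<integral>t. t \<partial>vmeasure x) = Re (cinner (blinfun_apply D x) x)"
proof -
  have h: "has_bochner_integral (vmeasure x) complex_of_real (cinner (blinfun_apply D x) x)"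
    using spectral by (simp add: spectral_measure_def vmeasure_def)
  show "integrable (vmeasure x) (\<lambda>t. t)"
    using integrable_Re[OF integrable.intros[OF h]] by simp
  have "(\<integral>t. t \<partial>vmeasure x) = (\<integral>t. Re (complex_of_real t) \<partial>vmeasure x)" by simp
  also have "\<dots> = Re (\<integral>t. complex_of_real t \<partial>vmeasure x)"
    by (rule integral_Re[OF integrable.intros[OF h]])
  finally show "(\<integral>t. t \<partial>vmeasure x) = Re (cinner (blinfun_apply D x) x)"
    using arg_cong[OF has_bochner_integral_integral_eq[OF h], of Re] by simp
qed

lemma integrable_vmeasure_bounded:
  fixes f :: "real \<Rightarrow> real"
  assumes "f \<in> borel_measurable borel" "AE t in vmeasure x. \<bar>f t\<bar> \<le> K"
  shows "integrable (vmeasure x) f"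
  by (rule finite_measure.integrable_const_bound[OF finite_vmeasure]) (use assms in auto)

lemma integral_vmeasure_bound:
  fixes f :: "real \<Rightarrow> real"
  assumes f: "f \<in> borel_measurable borel" "AE t in vmeasure x. \<bar>f t\<bar> \<le> K"
  shows "\<bar>\<integral>t. f t \<partial>vmeasure x\<bar> \<le> K * (norm x)\<^sup>2"
proof -
  interpret finite_measure "vmeasure x" by (rule finite_vmeasure)
  have i: "integrable (vmeasure x) f" by (rule integrable_vmeasure_bounded[OF f])
  have "\<bar>\<integral>t. f t \<partial>vmeasure x\<bar> \<le> (\<integral>t. \<bar>f t\<bar> \<partial>vmeasure x)"
    by (rule integral_abs_bound)
  also have "\<dots> \<le> (\<integral>t. K \<partial>vmeasure x)"
    using i f(2) by (intro integral_mono_AE) auto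
  also have "\<dots> = K * (norm x)\<^sup>2" by (simp add: measure_vmeasure mult.commute)
  finally show ?thesis .
qed

text \<open>Simple functions paired with their operators. As this is a relation, independence of the
  chosen representation by indicators never has to be proved.\<close>

inductive step :: "(real \<Rightarrow> real) \<Rightarrow> 'h bop \<Rightarrow> bool" where
  indicator: "B \<in> sets borel \<Longrightarrow> step (indicator B) (E B)"
| scale: "step f a \<Longrightarrow> step (\<lambda>t. r * f t) (r *\<^sub>R a)"
| add: "step f a \<Longrightarrow> step g b \<Longrightarrow> step (\<lambda>t. f t + g t) (a + b)"

lemma clinear_scaleR: "a \<in> clinear_ops \<Longrightarrow> r *\<^sub>R a \<in> clinear_ops"
  unfolding scalar_op_of_real[symmetric] by (rule clinear_compose[OF clinear_scalar])

lemma step_properties: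
  assumes "step f a"
  shows "a \<in> clinear_ops \<and> adj a = a \<and> f \<in> borel_measurable borel \<and> (\<exists>K. \<forall>t. \<bar>f t\<bar> \<le> K)
    \<and> (\<forall>x. cinner (blinfun_apply a x) x = of_real (\<integral>t. f t \<partial>vmeasure x))"
  using assms
proof induction
  case (indicator B)
  have "\<bar>indicator B t\<bar> \<le> (1::real)" for t by (simp add: indicator_def)
  then have "\<exists>K. \<forall>t. \<bar>indicator B t\<bar> \<le> (K::real)" by blast
  with indicator show ?case by (auto simp: measure_vmeasure cinner_E)
next
  case (scale f a r)
  then obtain K where "\<And>t. \<bar>f t\<bar> \<le> K" by blast
  then have "\<And>t. \<bar>r * f t\<bar> \<le> \<bar>r\<bar> * K" by (simp add: abs_mult mult_left_mono)
  moreover have "adj (r *\<^sub>R a) = r *\<^sub>R adj a"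
    using scale adj_scale[of a "of_real r"] by (simp add: scalar_op_of_real)
  ultimately show ?case using scale
    by (auto simp: clinear_scaleR blinfun.scaleR_left cinner_simps)
next
  case (add f a g b)
  then obtain K L where K: "\<And>t. \<bar>f t\<bar> \<le> K" and L: "\<And>t. \<bar>g t\<bar> \<le> L" by blast
  then have "\<bar>f t + g t\<bar> \<le> K + L" for t by (meson abs_triangle_ineq add_mono order_trans)
  moreover have "integrable (vmeasure x) f" "integrable (vmeasure x) g" for x
    using add K L by (auto intro: integrable_vmeasure_bounded)
  ultimately show ?case using add
    by (auto simp: clinear_add adj_add blinfun.add_left cinner_simps)
qed

lemma step_zero: "step (\<lambda>t. 0) 0"
  using step.indicator[of "{}"] by (simp add: indicator_def[abs_def])

lemma step_sum: "finite I \<Longrightarrow> (\<And>i. i \<in> I \<Longrightarrow> step (f i) (a i)) \<Longrightarrow> step (\<lambda>t. \<Sum>i\<in>I. f i t) (sum a I)"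
  by (induction I rule: finite_induct) (auto intro: step_zero step.add)

lemma step_mult:
  assumes "step f a" "step g b"
  shows "step (\<lambda>t. f t * g t) (a \<ast> b)"
  using assms(1)
proof induction
  case (indicator A)
  show ?case using assms(2)
  proof induction
    case (indicator B)
    then show ?case using \<open>A \<in> sets borel\<close> step.indicator[of "A \<inter> B"]
      by (simp add: E_Int indicator_inter_arith[abs_def])
  next
    case (scale g b r)
    then show ?case using step.scale[OF scale.IH, of r]
      by (simp add: bounded_bilinear.scaleR_right[OF bounded_bilinear_blinfun_compose] mult.left_commute)
  next
    case (add g b g' b')
    then show ?case using step.add[OF add.IH]
      by (simp add: compose_simps distrib_left)
  qed
next
  case (scale f a r)
  then show ?case using step.scale[OF scale.IH, of r]
    by (simp add: bounded_bilinear.scaleR_left[OF bounded_bilinear_blinfun_compose] mult.assoc)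
next
  case (add f a f' a')
  then show ?case using step.add[OF add.IH]
    by (simp add: compose_simps distrib_right)
qed

text \<open>Closure of \<open>step\<close> under uniform convergence of functions together with norm
  convergence of operators. Uniformity on the whole line keeps f bounded, so D enters through the
  truncated identity function.\<close>

definition fcalc :: "(real \<Rightarrow> real) \<Rightarrow> 'h bop \<Rightarrow> bool" where
  "fcalc f a \<longleftrightarrow> (\<exists>F A. (\<forall>n. step (F n) (A n)) \<and> A \<longlonglongrightarrow> a \<and> uniform_limit UNIV F f sequentially)"

lemma fcalc_step: "step f a \<Longrightarrow> fcalc f a"
  unfolding fcalc_def
  by (rule exI[of _ "\<lambda>_. f"], rule exI[of _ "\<lambda>_. a"]) (simp add: uniform_limit_const)

lemma fcalc_scale:
  assumes "fcalc f a" shows "fcalc (\<lambda>t. r * f t) (r *\<^sub>R a)"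
proof -
  obtain F A where "\<And>n. step (F n) (A n)" "A \<longlonglongrightarrow> a" "uniform_limit UNIV F f sequentially"
    using assms unfolding fcalc_def by blast
  then show ?thesis unfolding fcalc_def
    by (intro exI[of _ "\<lambda>n t. r * F n t"] exI[of _ "\<lambda>n. r *\<^sub>R A n"])
      (auto intro!: step.scale tendsto_intros bounded_linear.uniform_limit[OF bounded_linear_mult_right])
qed

lemma fcalc_add:
  assumes "fcalc f a" "fcalc g b" shows "fcalc (\<lambda>t. f t + g t) (a + b)"
proof -
  obtain F A where "\<And>n. step (F n) (A n)" "A \<longlonglongrightarrow> a" "uniform_limit UNIV F f sequentially"
    using assms(1) unfolding fcalc_def by blast
  moreover obtain G B where "\<And>n. step (G n) (B n)" "B \<longlonglongrightarrow> b" "uniform_limit UNIV G g sequentially"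
    using assms(2) unfolding fcalc_def by blast
  ultimately show ?thesis unfolding fcalc_def
    by (intro exI[of _ "\<lambda>n t. F n t + G n t"] exI[of _ "\<lambda>n. A n + B n"])
      (auto intro!: step.add tendsto_add uniform_limit_add)
qed

lemma fcalc_diff: "fcalc f a \<Longrightarrow> fcalc g b \<Longrightarrow> fcalc (\<lambda>t. f t - g t) (a - b)"
  using fcalc_add[OF _ fcalc_scale[of g b "-1"], of f a] by simp

lemma fcalc_sum:
  "finite I \<Longrightarrow> (\<And>i. i \<in> I \<Longrightarrow> fcalc (f i) (a i)) \<Longrightarrow> fcalc (\<lambda>t. \<Sum>i\<in>I. f i t) (sum a I)"
  by (induction I rule: finite_induct) (auto intro: fcalc_step step_zero fcalc_add)

lemma fcalc_bounded:
  assumes "fcalc f a" shows "\<exists>K. \<forall>t. \<bar>f t\<bar> \<le> K"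
proof -
  obtain F A where F: "\<And>n. step (F n) (A n)" "uniform_limit UNIV F f sequentially"
    using assms unfolding fcalc_def by blast
  obtain n where n: "\<And>t. \<bar>F n t - f t\<bar> < 1"
    using F(2) unfolding uniform_limit_iff dist_real_def eventually_sequentially
    by (metis UNIV_I order_refl zero_less_one)
  obtain K where K: "\<And>t. \<bar>F n t\<bar> \<le> K" using step_properties[OF F(1)[of n]] by blast
  have "\<bar>f t\<bar> \<le> K + 1" for t using n[of t] K[of t] by linarith
  then show ?thesis by blast
qed

lemma fcalc_mult:
  assumes "fcalc f a" "fcalc g b" shows "fcalc (\<lambda>t. f t * g t) (a \<ast> b)"
proof -
  obtain F A where F: "\<And>n. step (F n) (A n)" "A \<longlonglongrightarrow> a" "uniform_limit UNIV F f sequentially"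
    using assms(1) unfolding fcalc_def by blast
  obtain G B where G: "\<And>n. step (G n) (B n)" "B \<longlonglongrightarrow> b" "uniform_limit UNIV G g sequentially"
    using assms(2) unfolding fcalc_def by blast
  have "bounded (f ` UNIV)" "bounded (g ` UNIV)"
    using fcalc_bounded[OF assms(1)] fcalc_bounded[OF assms(2)] by (auto simp: bounded_iff)
  then have "uniform_limit UNIV (\<lambda>n t. F n t * G n t) (\<lambda>t. f t * g t) sequentially"
    by (rule uniform_lim_mult[OF F(3) G(3)])
  moreover have "(\<lambda>n. A n \<ast> B n) \<longlonglongrightarrow> a \<ast> b" by (rule tendsto_compose_op[OF F(2) G(2)])
  ultimately show ?thesis unfolding fcalc_def using step_mult[OF F(1) G(1)]
    by (intro exI[of _ "\<lambda>n t. F n t * G n t"] exI[of _ "\<lambda>n. A n \<ast> B n"]) simp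
qed

lemma fcalc_properties:
  assumes "fcalc f a"
  shows fcalc_clinear: "a \<in> clinear_ops" and fcalc_adj: "adj a = a"
    and fcalc_measurable: "f \<in> borel_measurable borel"
    and fcalc_integrable: "integrable (vmeasure x) f"
    and fcalc_cinner: "cinner (blinfun_apply a x) x = of_real (\<integral>t. f t \<partial>vmeasure x)"
proof -
  obtain F A where F: "\<And>n. step (F n) (A n)" "A \<longlonglongrightarrow> a" "uniform_limit UNIV F f sequentially"
    using assms unfolding fcalc_def by blast
  show a: "a \<in> clinear_ops"
    using F(1) step_properties by (intro clinear_limit[OF _ F(2)]) blast
  have "(\<lambda>n. adj (A n)) \<longlonglongrightarrow> adj a"
    using F(1) step_properties by (intro tendsto_adj[OF _ a F(2)]) blast
  moreover have "(\<lambda>n. adj (A n)) = A" using F(1) step_properties by blast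
  ultimately show "adj a = a" using F(2) LIMSEQ_unique by metis
  have Fm: "F n \<in> borel_measurable borel" for n using step_properties[OF F(1)] by blast
  have "(\<lambda>n. F n t) \<longlonglongrightarrow> f t" for t by (rule tendsto_uniform_limitI[OF F(3)]) simp
  then show fm: "f \<in> borel_measurable borel"
    by (rule borel_measurable_LIMSEQ_real[of borel F]) (auto simp: Fm)
  show fi: "integrable (vmeasure x) f"
    using fcalc_bounded[OF assms] fm by (auto intro: integrable_vmeasure_bounded)
  have Fi: "integrable (vmeasure x) (F n)" for n
    using step_properties[OF F(1)[of n]] by (auto intro: integrable_vmeasure_bounded)
  have "(\<lambda>n. \<integral>t. F n t \<partial>vmeasure x) \<longlonglongrightarrow> (\<integral>t. f t \<partial>vmeasure x)"
  proof (rule LIMSEQ_I)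
    fix e :: real assume e: "e > 0"
    define d where "d = e / ((norm x)\<^sup>2 + 1)"
    have d: "d > 0" using e by (simp add: d_def add_nonneg_pos)
    obtain N where N: "\<And>n t. n \<ge> N \<Longrightarrow> \<bar>F n t - f t\<bar> < d"
      using F(3) d unfolding uniform_limit_iff dist_real_def eventually_sequentially
      by (metis UNIV_I)
    have "norm ((\<integral>t. F n t \<partial>vmeasure x) - (\<integral>t. f t \<partial>vmeasure x)) < e" if "n \<ge> N" for n
    proof -
      have "\<bar>\<integral>t. F n t - f t \<partial>vmeasure x\<bar> \<le> d * (norm x)\<^sup>2"
        using N[OF that] Fm fm by (intro integral_vmeasure_bound) (auto intro: less_imp_le)
      also have "\<dots> < d * ((norm x)\<^sup>2 + 1)" using d by simp
      also have "\<dots> = e" by (simp add: d_def add_nonneg_eq_0_iff)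
      finally show ?thesis using Fi fi by simp
    qed
    then show "\<exists>N. \<forall>n\<ge>N. norm ((\<integral>t. F n t \<partial>vmeasure x) - (\<integral>t. f t \<partial>vmeasure x)) < e" by blast
  qed
  then have "(\<lambda>n. complex_of_real (\<integral>t. F n t \<partial>vmeasure x)) \<longlonglongrightarrow> of_real (\<integral>t. f t \<partial>vmeasure x)"
    by (rule tendsto_of_real)
  moreover have "(\<lambda>n. complex_of_real (\<integral>t. F n t \<partial>vmeasure x)) = (\<lambda>n. cinner (blinfun_apply (A n) x) x)"
    using step_properties[OF F(1)] by auto
  moreover have "(\<lambda>n. cinner (blinfun_apply (A n) x) x) \<longlonglongrightarrow> cinner (blinfun_apply a x) x"
    by (intro tendsto_cinner tendsto_apply_op F(2) tendsto_const)
  ultimately show "cinner (blinfun_apply a x) x = of_real (\<integral>t. f t \<partial>vmeasure x)"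
    using LIMSEQ_unique by metis
qed

lemma fcalc_id: "fcalc (\<lambda>t. 1) id_blinfun"
  using fcalc_step[OF step.indicator[of UNIV]] by (simp add: indicator_def[abs_def])

text \<open>For y in the range of this projection, \<open>vmeasure y\<close> lives where s t - r is
  positive, while the integral of s t - r is s <D y, y> - r |y|^2 \<le> 0. Hence the measure
  vanishes and y = 0. The sign s covers both ends of the spectrum.\<close>

lemma spectral_measure_support:
  assumes s: "s = 1 \<or> s = -1" and r: "norm D \<le> r"
  shows "E {t. r < s * t} = 0"
proof (rule blinfun_eqI)
  fix x
  let ?B = "{t. r < s * t}"
  have B: "?B \<in> sets borel" by simp
  define y where "y = blinfun_apply (E ?B) x"
  have "E (- ?B) \<ast> E ?B = 0"
    using E_Int[of "- ?B" ?B] B by simp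
  then have "blinfun_apply (E (- ?B)) y = 0"
    by (metis blinfun_apply_blinfun_compose y_def blinfun.zero_left)
  then have "emeasure (vmeasure y) (- ?B) = 0" by (simp add: emeasure_vmeasure B)
  then have ae: "AE t in vmeasure y. t \<in> ?B"
    by (intro AE_I[of _ _ "- ?B"]) auto
  interpret finite_measure "vmeasure y" by (rule finite_vmeasure)
  have i: "integrable (vmeasure y) (\<lambda>t. s * t - r)"
    using integrable_vmeasure_D[of y] by simp
  have "\<bar>Re (cinner (blinfun_apply D y) y)\<bar> \<le> r * (norm y)\<^sup>2"
  proof -
    have "\<bar>Re (cinner (blinfun_apply D y) y)\<bar> \<le> norm (blinfun_apply D y) * norm y"
      using abs_Re_le_cmod Cauchy_Schwarz_cinner order_trans by blast
    also have "\<dots> \<le> norm D * norm y * norm y" by (intro mult_right_mono norm_blinfun) simp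
    also have "\<dots> \<le> r * norm y * norm y" by (intro mult_right_mono r) simp_all
    finally show ?thesis by (simp add: power2_eq_square mult.assoc)
  qed
  then have "(\<integral>t. s * t - r \<partial>vmeasure y) \<le> 0"
    using integrable_vmeasure_D[of y] s
    by (auto simp: integral_vmeasure_D measure_vmeasure mult.commute)
  moreover have nn: "AE t in vmeasure y. 0 \<le> s * t - r"
    using ae by eventually_elim auto
  moreover have "0 \<le> (\<integral>t. s * t - r \<partial>vmeasure y)"
    by (rule integral_nonneg_AE[OF nn])
  ultimately have "AE t in vmeasure y. s * t - r = 0"
    using integral_nonneg_eq_0_iff_AE[OF i nn] by simp
  with ae have "AE t in vmeasure y. False" by eventually_elim auto
  then have "emeasure (vmeasure y) UNIV = 0" by (simp add: AE_iff_measurable[of UNIV])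
  then have "y = 0" by (simp add: emeasure_vmeasure)
  then show "blinfun_apply (E ?B) x = blinfun_apply 0 x" by (simp add: y_def)
qed

lemma AE_vmeasure_norm:
  assumes "norm D \<le> r" shows "AE t in vmeasure x. \<bar>t\<bar> \<le> r"
proof -
  have "AE t in vmeasure x. \<not> r < s * t" if "s = 1 \<or> s = -1" for s
    using spectral_measure_support[OF that assms]
    by (intro AE_I[of _ _ "{t. r < s * t}"]) (auto simp: emeasure_vmeasure)
  then have "AE t in vmeasure x. \<not> r < 1 * t" "AE t in vmeasure x. \<not> r < -1 * t" by blast+
  then show ?thesis by eventually_elim auto
qed

text \<open>The simple functions round t down to a multiple of 1/(n+1) on [-r, r]. Since the scalar
  measures live on that interval, the quadratic form of A n - D is at most |x|^2/(n+1), and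
  \<open>norm_selfadjoint_le\<close> turns this into norm convergence.\<close>

lemma fcalc_D:
  assumes r: "norm D \<le> r"
  shows "fcalc (\<lambda>t. t * indicator {-r..r} t) D"
proof -
  define J where "J n = {\<lfloor>- (real (Suc n) * r)\<rfloor>..\<lfloor>real (Suc n) * r\<rfloor>}" for n
  define S where "S n k = {t. \<lfloor>real (Suc n) * t\<rfloor> = k} \<inter> {-r..r}" for n k
  define F where "F n t = (\<Sum>k\<in>J n. of_int k / real (Suc n) * indicator (S n k) t)" for n t
  define A where "A n = (\<Sum>k\<in>J n. (of_int k / real (Suc n)) *\<^sub>R E (S n k))" for n
  have S: "S n k \<in> sets borel" for n k unfolding S_def by measurable
  have step: "step (F n) (A n)" for n
    unfolding F_def A_def by (intro step_sum step.scale step.indicator S) (simp add: J_def)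
  have F_eq: "F n t = of_int \<lfloor>real (Suc n) * t\<rfloor> / real (Suc n) * indicator {-r..r} t" for n t
  proof (cases "t \<in> {-r..r}")
    case True
    let ?k = "\<lfloor>real (Suc n) * t\<rfloor>"
    have "real (Suc n) * t \<le> real (Suc n) * r" "- (real (Suc n) * r) \<le> real (Suc n) * t"
      using True mult_left_mono[of "-r" t "real (Suc n)"] by (auto intro!: mult_left_mono simp del: of_nat_Suc)
    then have "?k \<in> J n" unfolding J_def by (auto intro!: floor_mono simp del: of_nat_Suc)
    then have "F n t = (\<Sum>k\<in>{?k}. of_int k / real (Suc n) * indicator (S n k) t)"
      unfolding F_def by (intro sum.mono_neutral_right) (auto simp: J_def S_def indicator_def)
    also have "\<dots> = of_int ?k / real (Suc n)" using True by (simp add: S_def)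
    finally show ?thesis using True by simp
  next
    case False
    then have "F n t = 0" unfolding F_def by (intro sum.neutral) (auto simp: S_def indicator_def)
    with False show ?thesis by simp
  qed
  have F_dist: "\<bar>F n t - t * indicator {-r..r} t\<bar> \<le> 1 / real (Suc n)" for n t
  proof -
    let ?m = "real (Suc n)"
    have "of_int \<lfloor>?m * t\<rfloor> \<le> ?m * t" "?m * t \<le> of_int \<lfloor>?m * t\<rfloor> + 1" by linarith+
    then have "\<bar>of_int \<lfloor>?m * t\<rfloor> - ?m * t\<bar> / ?m \<le> 1 / ?m"
      by (intro divide_right_mono) linarith+
    moreover have "of_int \<lfloor>?m * t\<rfloor> / ?m - t = (of_int \<lfloor>?m * t\<rfloor> - ?m * t) / ?m"
      by (simp add: diff_divide_distrib del: of_nat_Suc)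
    ultimately have "\<bar>of_int \<lfloor>?m * t\<rfloor> / ?m - t\<bar> \<le> 1 / ?m"
      by (simp add: abs_divide del: of_nat_Suc)
    then show ?thesis by (cases "t \<in> {-r..r}") (auto simp: F_eq simp del: of_nat_Suc)
  qed
  have "norm (A n - D) \<le> 1 / real (Suc n)" for n
  proof (rule norm_selfadjoint_le)
    show "A n - D \<in> clinear_ops" "adj (A n - D) = A n - D"
      using step_properties[OF step[of n]] D_clinear by (simp_all add: clinear_diff adj_diff D_adj)
    fix x
    have iF: "integrable (vmeasure x) (F n)" and mF: "F n \<in> borel_measurable borel"
      using step_properties[OF step[of n]] by (auto intro: integrable_vmeasure_bounded)
    have ae: "AE t in vmeasure x. \<bar>F n t - t\<bar> \<le> 1 / real (Suc n)"
      using AE_vmeasure_norm[OF r, of x]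
    proof eventually_elim
      case (elim t)
      then have "t \<in> {-r..r}" by (auto simp: abs_le_iff)
      with F_dist[of n t] show ?case by simp
    qed
    have "Re (cinner (blinfun_apply (A n - D) x) x) = (\<integral>t. F n t \<partial>vmeasure x) - (\<integral>t. t \<partial>vmeasure x)"
      using step_properties[OF step[of n]]
      by (simp add: blinfun.diff_left cinner_simps integral_vmeasure_D)
    also have "\<dots> = (\<integral>t. F n t - t \<partial>vmeasure x)"
      using iF integrable_vmeasure_D[of x] by simp
    finally show "\<bar>Re (cinner (blinfun_apply (A n - D) x) x)\<bar> \<le> 1 / real (Suc n) * (norm x)\<^sup>2"
      using integral_vmeasure_bound[OF _ ae] mF by simp
  qed simp
  then have "(\<lambda>n. A n - D) \<longlonglongrightarrow> 0"
    by (intro Lim_null_comparison[OF _ LIMSEQ_inverse_real_of_nat])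
      (simp add: inverse_eq_divide)
  then have "A \<longlonglongrightarrow> D" by (rule LIM_zero_cancel)
  moreover have "uniform_limit UNIV F (\<lambda>t. t * indicator {-r..r} t) sequentially"
    unfolding uniform_limit_iff
  proof (intro allI impI)
    fix e :: real assume "e > 0"
    then have "\<forall>\<^sub>F n in sequentially. inverse (real (Suc n)) < e"
      using LIMSEQ_inverse_real_of_nat by (intro order_tendstoD)
    then show "\<forall>\<^sub>F n in sequentially. \<forall>t\<in>UNIV. dist (F n t) (t * indicator {-r..r} t) < e"
    proof eventually_elim
      case (elim n)
      then show ?case using F_dist[of n] unfolding dist_real_def inverse_eq_divide
        by (auto intro: order_le_less_trans)
    qed
  qed
  ultimately show ?thesis unfolding fcalc_def using step by blast
qed

lemma fcalc_power:
  assumes "norm D \<le> r"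
  shows "fcalc (\<lambda>t. (t * indicator {-r..r} t) ^ n) (op_power D n)"
  by (induction n) (simp_all add: fcalc_id fcalc_mult[OF fcalc_D[OF assms]])

text \<open>Converts convergence of scalar integrals into strong convergence of operators.\<close>

lemma norm_fcalc_sq:
  assumes "fcalc f a"
  shows "(norm (blinfun_apply a x))\<^sup>2 = (\<integral>t. (f t)\<^sup>2 \<partial>vmeasure x)"
proof -
  have "cinner (blinfun_apply a x) (blinfun_apply a x) = cinner (blinfun_apply (a \<ast> a) x) x"
    using cinner_adj[OF fcalc_clinear[OF assms], of "blinfun_apply a x" x] fcalc_adj[OF assms] by simp
  also have "\<dots> = of_real (\<integral>t. f t * f t \<partial>vmeasure x)"
    by (rule fcalc_cinner[OF fcalc_mult[OF assms assms]])
  finally show ?thesis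
    unfolding cinner_self_eq_norm of_real_eq_iff by (simp add: power2_eq_square)
qed

end

section \<open>Spectral projections of intervals\<close>

text \<open>Normality concerns directed families, so the approximation must be monotone;
  \<open>has_distribution\<close> concerns moments, so it must be polynomial. The functions f m,
  built from the distance to [a, b], decrease to the indicator; Stone--Weierstrass replaces them by
  polynomials, shifted upward so that monotonicity survives the error.\<close>

lemma polynomials_decreasing_to_indicator:
  fixes a b r :: real
  obtains g :: "nat \<Rightarrow> real \<Rightarrow> real"
  where "\<And>m. real_polynomial_function (g m)"
    and "\<And>m t. t \<in> {-r..r} \<Longrightarrow> indicator {a..b} t \<le> g m t"
    and "\<And>m t. t \<in> {-r..r} \<Longrightarrow> g m t \<le> 5"
    and "\<And>m t. t \<in> {-r..r} \<Longrightarrow> g (Suc m) t \<le> g m t"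
    and "\<And>t. t \<in> {-r..r} \<Longrightarrow> (\<lambda>m. g m t) \<longlonglongrightarrow> indicator {a..b} t"
proof -
  define d where "d t = max 0 (max (a - t) (t - b))" for t
  define f where "f m t = max 0 (1 - real m * d t)" for m t
  have d0: "d t \<ge> 0" for t by (simp add: d_def)
  have d_in: "d t = 0 \<longleftrightarrow> t \<in> {a..b}" for t by (auto simp: d_def max_def)
  have f_bounds: "0 \<le> f m t" "f m t \<le> 1" "indicator {a..b} t \<le> f m t" for m t
    using d0[of t] d_in[of t] by (auto simp: f_def indicator_def)
  have f_dec: "f (Suc m) t \<le> f m t" for m t
    using d0[of t] mult_right_mono[of "real m" "real (Suc m)" "d t"] by (auto simp: f_def)
  have f_lim: "(\<lambda>m. f m t) \<longlonglongrightarrow> indicator {a..b} t" for t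
  proof (cases "t \<in> {a..b}")
    case True
    then have "f m t = 1" for m using d_in[of t] by (simp add: f_def)
    then show ?thesis using True by simp
  next
    case False
    then have d: "d t > 0" using d0[of t] d_in[of t] by (auto simp: order_le_less)
    obtain N :: nat where N: "1 / d t < real N" using reals_Archimedean2 by blast
    have "f m t = 0" if "m \<ge> N" for m
    proof -
      have "1 / d t < real m" using N that by linarith
      then have "1 < real m * d t" using d by (simp add: field_simps)
      then show ?thesis by (simp add: f_def)
    qed
    then have "\<forall>\<^sub>F m in sequentially. f m t = indicator {a..b} t"
      using False unfolding eventually_sequentially by (intro exI[of _ N]) auto
    then show ?thesis by (rule tendsto_eventually)
  qed
  have "\<exists>q. real_polynomial_function q \<and> (\<forall>t\<in>{-r..r}. \<bar>f m t - q t\<bar> < (1/2)^m)" for m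
  proof -
    have "continuous_on {-r..r} (f m)" unfolding f_def d_def by (intro continuous_intros)
    then obtain q where "real_polynomial_function q" "\<And>t. t \<in> {-r..r} \<Longrightarrow> \<bar>f m t - q t\<bar> < (1/2)^m"
      by (rule Stone_Weierstrass_real_polynomial_function[OF compact_Icc, where e = "(1/2)^m"]) auto
    then show ?thesis by blast
  qed
  then have "\<exists>q. \<forall>m. real_polynomial_function (q m) \<and> (\<forall>t\<in>{-r..r}. \<bar>f m t - q m t\<bar> < (1/2)^m)"
    by (intro choice allI)
  then obtain q where q: "\<And>m. real_polynomial_function (q m)"
    "\<And>m t. t \<in> {-r..r} \<Longrightarrow> \<bar>f m t - q m t\<bar> < (1/2)^m" by blast
  \<comment> \<open>With error below 2^-m, the shift puts g m between f m + 2 * 2^-m and f m + 4 *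
    2^-m. The upper margin at m + 1 equals the lower margin at m, which gives monotonicity; the
    bound 5 is 1 + 4.\<close>
  define g where "g m t = q m t + 3 * (1/2)^m" for m t
  have lo: "f m t + 2 * (1/2)^m \<le> g m t" and hi: "g m t \<le> f m t + 4 * (1/2)^m"
    if "t \<in> {-r..r}" for m t
    using q(2)[OF that, of m] unfolding g_def by linarith+
  show thesis
  proof
    show "real_polynomial_function (g m)" for m
      unfolding g_def
      by (rule real_polynomial_function.intros(3)[OF q(1) real_polynomial_function.intros(2)])
    fix t assume t: "t \<in> {-r..r}"
    show "indicator {a..b} t \<le> g m t" for m
      using lo[OF t, of m] f_bounds(3)[of t m] zero_le_power[of "1/2::real" m] by linarith
    have "(1/2::real)^m \<le> 1" for m by (simp add: power_le_one)
    then show "g m t \<le> 5" for m using hi[OF t, of m] f_bounds(2)[of m t] by (smt (verit))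
    show "g (Suc m) t \<le> g m t" for m
      using hi[OF t, of "Suc m"] lo[OF t, of m] f_dec[of m t] by simp
    have p: "(\<lambda>m. (1/2::real)^m) \<longlonglongrightarrow> 0" by (intro LIMSEQ_power_zero) simp
    show "(\<lambda>m. g m t) \<longlonglongrightarrow> indicator {a..b} t"
    proof (rule tendsto_sandwich[of "\<lambda>m. f m t + 2 * (1/2)^m" _ _ "\<lambda>m. f m t + 4 * (1/2)^m"])
      show "(\<lambda>m. f m t + 2 * (1/2)^m) \<longlonglongrightarrow> indicator {a..b} t"
        using tendsto_add[OF f_lim[of t] tendsto_mult_right_zero[OF p, of 2]] by simp
      show "(\<lambda>m. f m t + 4 * (1/2)^m) \<longlonglongrightarrow> indicator {a..b} t"
        using tendsto_add[OF f_lim[of t] tendsto_mult_right_zero[OF p, of 4]] by simp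
    qed (use lo[OF t] hi[OF t] in auto)
  qed
qed

section \<open>The uniform law and polynomials in the diagonal operator\<close>

abbreviation unif :: "real measure" where
  "unif \<equiv> uniform_measure lborel {0..1}"

lemma prob_space_unif: "prob_space unif"
  by (rule prob_space_uniform_measure) auto

lemma AE_unif: "AE t in unif. t \<in> {0..1}"
  by (rule AE_uniform_measureI) auto

lemma integrable_unif_continuous:
  fixes f :: "real \<Rightarrow> real"
  assumes "continuous_on UNIV f" shows "integrable unif f"
proof -
  interpret prob_space unif by (rule prob_space_unif)
  have "compact (f ` {0..1})"
    using assms by (intro compact_continuous_image) (auto intro: continuous_on_subset)
  then have "bounded (f ` {0..1})" by (rule compact_imp_bounded)
  then obtain K where K: "\<And>t. t \<in> {0..1} \<Longrightarrow> norm (f t) \<le> K"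
    unfolding bounded_iff by blast
  have "AE t in unif. norm (f t) \<le> K" using AE_unif by eventually_elim (rule K)
  moreover have "f \<in> borel_measurable borel"
    using assms by (rule borel_measurable_continuous_onI)
  ultimately show ?thesis by (intro integrable_const_bound) auto
qed

lemma (in tracial_algebra) star_algebra_subset:
  assumes "S \<subseteq> M" shows "star_algebra_generated S \<subseteq> M"
proof
  fix a assume "a \<in> star_algebra_generated S"
  then show "a \<in> M" using assms by induction auto
qed

lemma star_algebra_scaleR:
  "a \<in> star_algebra_generated S \<Longrightarrow> r *\<^sub>R a \<in> star_algebra_generated S"
  unfolding scalar_op_of_real[symmetric] by (rule star_algebra_generated.scale)

lemma star_algebra_zero: "0 \<in> star_algebra_generated S"
  using star_algebra_scaleR[OF star_algebra_generated.one, of 0] by simp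

lemma star_algebra_sum:
  "(\<And>i. i \<in> I \<Longrightarrow> a i \<in> star_algebra_generated S) \<Longrightarrow> sum a I \<in> star_algebra_generated S"
  by (induction I rule: infinite_finite_induct)
    (auto intro: star_algebra_zero star_algebra_generated.add)

lemma star_algebra_op_power: "op_power a n \<in> star_algebra_generated {a}"
  by (induction n) (auto intro: star_algebra_generated.intros)

locale uniform_diagonal = tracial_algebra M \<tau> + spectral_resolution D E
  for M :: "'h::chilbert_space bop set" and \<tau> and D :: "'h bop" and E +
  assumes D_M: "D \<in> M" and D_dist: "has_distribution \<tau> D unif"
begin

lemma alg_D_subset: "star_algebra_generated {D} \<subseteq> M"
  by (rule star_algebra_subset) (simp add: D_M)

text \<open>One operator h seen from two sides: its trace through the moments of D, its quadratic
  forms through the functional calculus.\<close>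

lemma polynomial_fcalc:
  assumes g: "real_polynomial_function g" and r: "norm D \<le> r"
  shows "\<exists>h \<in> star_algebra_generated {D}. fcalc (\<lambda>t. g (t * indicator {-r..r} t)) h
    \<and> \<tau> h = of_real (\<integral>t. g t \<partial>unif)"
proof -
  obtain c n where g: "g = (\<lambda>x. \<Sum>i\<le>n. c i * x ^ i)"
    using g unfolding real_polynomial_function_iff_sum by blast
  define h where "h = (\<Sum>i\<le>n. c i *\<^sub>R op_power D i)"
  have P: "op_power D i \<in> M" for i using alg_D_subset star_algebra_op_power by blast
  have "h \<in> star_algebra_generated {D}"
    unfolding h_def by (intro star_algebra_sum star_algebra_scaleR star_algebra_op_power)
  moreover have "fcalc (\<lambda>t. g (t * indicator {-r..r} t)) h"
    unfolding g h_def by (intro fcalc_sum fcalc_scale fcalc_power r finite_atMost)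
  moreover have "\<tau> h = of_real (\<integral>t. g t \<partial>unif)"
  proof -
    have "\<tau> h = (\<Sum>i\<le>n. of_real (c i) * \<tau> (op_power D i))"
      unfolding h_def using P by (simp add: tau_sum tau_scaleR)
    also have "\<dots> = of_real (\<Sum>i\<le>n. c i * (\<integral>t. t ^ i \<partial>unif))"
      using D_dist by (simp add: has_distribution_def)
    also have "(\<Sum>i\<le>n. c i * (\<integral>t. t ^ i \<partial>unif)) = (\<integral>t. g t \<partial>unif)"
      unfolding g by (subst Bochner_Integration.integral_sum)
        (auto intro!: integrable_unif_continuous continuous_intros)
    finally show ?thesis .
  qed
  ultimately show ?thesis by blast
qed

text \<open>Polynomials decreasing to the indicator give operators h m. Strong convergence places
  the projection in M, normality evaluates its trace as a limit of known integrals, and the trace of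
  h m - e then controls its L2 norm.\<close>

proposition interval_projection:
  assumes ab: "0 \<le> a" "a \<le> b" "b \<le> 1"
  shows interval_projection_M: "E {a..b} \<in> M"
    and interval_projection_tau: "\<tau> (E {a..b}) = of_real (b - a)"
    and interval_projection_approx:
      "\<epsilon> > 0 \<Longrightarrow> \<exists>h \<in> star_algebra_generated {D}. norm2 (h - E {a..b}) \<le> \<epsilon>"
proof -
  define r where "r = max 1 (norm D)"
  have r: "1 \<le> r" "norm D \<le> r" by (auto simp: r_def)
  obtain g where g: "\<And>m. real_polynomial_function (g m)"
    "\<And>m t. t \<in> {-r..r} \<Longrightarrow> indicator {a..b} t \<le> g m t"
    "\<And>m t. t \<in> {-r..r} \<Longrightarrow> g m t \<le> 5"
    "\<And>m t. t \<in> {-r..r} \<Longrightarrow> g (Suc m) t \<le> g m t"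
    "\<And>t. t \<in> {-r..r} \<Longrightarrow> (\<lambda>m. g m t) \<longlonglongrightarrow> indicator {a..b} t"
    using polynomials_decreasing_to_indicator[of r a b] by blast
  have g_cont: "continuous_on UNIV (g m)" for m
    using g(1) by (auto simp: real_polynomial_function_eq intro: continuous_on_polymonial_function)
  define c where "c t = t * indicator {-r..r} t" for t
  have c: "c t \<in> {-r..r}" for t using r by (simp add: c_def indicator_def)
  define e where "e = E {a..b}"
  have "\<exists>h. \<forall>m. h m \<in> star_algebra_generated {D} \<and> fcalc (\<lambda>t. g m (c t)) (h m)
      \<and> \<tau> (h m) = of_real (\<integral>t. g m t \<partial>unif)"
    unfolding c_def using polynomial_fcalc[OF g(1) r(2)] by (intro choice) blast
  then obtain h where h: "\<And>m. h m \<in> star_algebra_generated {D}"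
    "\<And>m. fcalc (\<lambda>t. g m (c t)) (h m)" "\<And>m. \<tau> (h m) = of_real (\<integral>t. g m t \<partial>unif)"
    by blast
  have hM: "h m \<in> M" for m using h(1) alg_D_subset by blast
  define u where "u m t = g m (c t) - indicator {a..b} t" for m t
  have fu: "fcalc (u m) (h m - e)" for m
    unfolding u_def e_def by (intro fcalc_diff h fcalc_step step.indicator) simp
  have u_ae: "AE t in vmeasure x. t \<in> {-r..r} \<and> c t = t" for x
    using AE_vmeasure_norm[OF r(2), of x] by eventually_elim (auto simp: c_def indicator_def)
  have u_pos: "AE t in vmeasure x. 0 \<le> u m t \<and> u m t \<le> 5" for x m
    using u_ae[of x]
  proof eventually_elim
    case (elim t)
    then show ?case using g(2,3)[of t m] by (auto simp: u_def indicator_def)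
  qed
  have u_lim: "AE t in vmeasure x. (\<lambda>m. u m t) \<longlonglongrightarrow> 0" for x
    using u_ae[of x]
  proof eventually_elim
    case (elim t)
    then show ?case using g(5)[of t] by (simp add: u_def LIM_zero)
  qed
  have um: "u m \<in> borel_measurable borel" for m by (rule fcalc_measurable[OF fu])
  have ui: "integrable (vmeasure x) (u m)" for x m by (rule fcalc_integrable[OF fu])
  have cin: "cinner (blinfun_apply (h m - e) x) x = of_real (\<integral>t. u m t \<partial>vmeasure x)" for m x
    by (rule fcalc_cinner[OF fu])
  \<comment> \<open>Dominated convergence for (u m)^2, with 25 the square of the bound on u, since
    |(h m - e) x|^2 is the integral of (u m)^2.\<close>
  have strong: "(\<lambda>m. blinfun_apply (h m) x) \<longlonglongrightarrow> blinfun_apply e x" for x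
  proof -
    interpret finite_measure "vmeasure x" by (rule finite_vmeasure)
    have "(\<lambda>m. \<integral>t. (u m t)\<^sup>2 \<partial>vmeasure x) \<longlonglongrightarrow> (\<integral>t. 0 \<partial>vmeasure x)"
    proof (rule integral_dominated_convergence[where w = "\<lambda>_. 25"])
      show "AE t in vmeasure x. (\<lambda>m. (u m t)\<^sup>2) \<longlonglongrightarrow> 0"
        using u_lim[of x]
      proof eventually_elim
        case (elim t)
        from tendsto_power[OF this, of 2] show ?case by simp
      qed
      show "AE t in vmeasure x. norm ((u m t)\<^sup>2) \<le> 25" for m
        using u_pos[of m x]
      proof eventually_elim
        case (elim t)
        then show ?case using power_mono[of "u m t" 5 2] by simp
      qed
    qed (use um in auto)
    then have "(\<lambda>m. (norm (blinfun_apply (h m - e) x))\<^sup>2) \<longlonglongrightarrow> 0"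
      by (simp add: norm_fcalc_sq[OF fu])
    then have "(\<lambda>m. sqrt ((norm (blinfun_apply (h m - e) x))\<^sup>2)) \<longlonglongrightarrow> sqrt 0"
      by (rule tendsto_real_sqrt)
    then have "(\<lambda>m. norm (blinfun_apply (h m - e) x)) \<longlonglongrightarrow> 0" by simp
    then show ?thesis
      by (simp add: blinfun.diff_left tendsto_norm_zero_iff LIM_zero_iff)
  qed
  show eM: "E {a..b} \<in> M"
    using M_strong_limit[OF hM strong] by (simp add: e_def)
  have e_adj: "adj e = e" by (simp add: e_def)
  have hint: "integrable unif (g m)" for m by (rule integrable_unif_continuous[OF g_cont])
  have int_lim: "(\<lambda>m. \<integral>t. g m t \<partial>unif) \<longlonglongrightarrow> b - a"
  proof -
    interpret prob_space unif by (rule prob_space_unif)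
    have "(\<lambda>m. \<integral>t. g m t \<partial>unif) \<longlonglongrightarrow> (\<integral>t. indicator {a..b} t \<partial>unif)"
    proof (rule integral_dominated_convergence[where w = "\<lambda>_. 5"])
      show "AE t in unif. (\<lambda>m. g m t) \<longlonglongrightarrow> indicator {a..b} t"
        using AE_unif by eventually_elim (rule g(5), use r in auto)
      show "AE t in unif. norm (g m t) \<le> 5" for m
        using AE_unif
      proof eventually_elim
        case (elim t)
        then have t: "t \<in> {-r..r}" using r by auto
        have "0 \<le> (indicator {a..b} t :: real)" by simp
        then have "0 \<le> g m t" using g(2)[OF t, of m] by linarith
        then show ?case using g(3)[OF t, of m] by simp
      qed
    qed (use borel_measurable_integrable[OF hint] in auto)
    also have "(\<integral>t. indicator {a..b} t \<partial>unif) = b - a"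
    proof -
      have "{0..1} \<inter> {a..b} = {a..b}" using ab by auto
      then show ?thesis using ab by (simp add: measure_uniform_measure)
    qed
    finally show ?thesis .
  qed
  \<comment> \<open>\<open>normal_functional\<close> is about suprema of positive elements, so the
    decreasing h m are reflected at 5. The bound g \<le> 5 makes each k m positive, and s is their
    least upper bound.\<close>
  define s where "s = 5 *\<^sub>R id_blinfun - e"
  define k where "k m = 5 *\<^sub>R id_blinfun - h m" for m
  have k_dec: "g n t \<le> g m t" if "m \<le> n" "t \<in> {-r..r}" for m n t
    using lift_Suc_antimono_le[of "\<lambda>m. g m t" m n] g(4)[OF that(2)] that(1) by blast
  have k_le: "op_le (k m) (k n)" if "m \<le> n" for m n
    unfolding op_le_def
  proof
    fix x
    have "fcalc (\<lambda>t. g m (c t) - g n (c t)) (h m - h n)" by (intro fcalc_diff h)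
    from fcalc_cinner[OF this, of x]
    have "cinner (blinfun_apply (k n - k m) x) x = of_real (\<integral>t. g m (c t) - g n (c t) \<partial>vmeasure x)"
      by (simp add: k_def)
    then show "cinner (blinfun_apply (k n - k m) x) x \<in> \<real>\<^sub>\<ge>\<^sub>0"
      using k_dec[OF that c] by (simp del: of_real_diff)
  qed
  have k_pos: "op_le 0 (k m)" for m
    unfolding op_le_def
  proof
    fix x
    have "fcalc (\<lambda>t. 5 * 1 - g m (c t)) (k m)"
      unfolding k_def by (intro fcalc_diff h fcalc_scale fcalc_id)
    from fcalc_cinner[OF this, of x]
    show "cinner (blinfun_apply (k m - 0) x) x \<in> \<real>\<^sub>\<ge>\<^sub>0"
      using g(3)[OF c] by (simp del: of_real_diff)
  qed
  have k_s: "op_le (k m) s" for m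
    unfolding op_le_def
  proof
    fix x
    have "0 \<le> (\<integral>t. u m t \<partial>vmeasure x)"
      by (rule integral_nonneg_AE) (use u_pos[of m x] in auto)
    then show "cinner (blinfun_apply (s - k m) x) x \<in> \<real>\<^sub>\<ge>\<^sub>0"
      using cin[of m x] by (simp add: s_def k_def)
  qed
  have s_least: "op_le s d" if d: "\<And>m. op_le (k m) d" for d
    unfolding op_le_def
  proof
    fix x
    have "(\<lambda>m. cinner (blinfun_apply (d - k m) x) x) \<longlonglongrightarrow> cinner (blinfun_apply (d - s) x) x"
      unfolding k_def s_def blinfun.diff_left
      by (intro tendsto_cinner tendsto_diff tendsto_const strong)
    then show "cinner (blinfun_apply (d - s) x) x \<in> \<real>\<^sub>\<ge>\<^sub>0"
      by (rule Lim_in_closed_set[OF closed_nonneg_Reals_complex _ _, rotated 2])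
        (use d in \<open>auto simp: op_le_def\<close>)
  qed
  have sM: "s \<in> M" and kM: "k m \<in> M" for m using eM hM by (simp_all add: s_def k_def e_def)
  have normal: "normal_functional M \<tau>" using tracial by (simp add: tracial_W_star_space_def)
  have "Re (\<tau> s) = (SUP d\<in>range k. Re (\<tau> d))"
  proof (rule normal[unfolded normal_functional_def, rule_format], intro conjI ballI impI)
    fix p q assume "p \<in> range k" "q \<in> range k"
    then obtain m n where "p = k m" "q = k n" by blast
    then show "\<exists>d\<in>range k. op_le p d \<and> op_le q d"
      by (intro bexI[of _ "k (max m n)"]) (auto intro: k_le)
  qed (use sM kM k_pos k_s s_least in auto)
  also have "\<dots> = (SUP m. Re (\<tau> (k m)))" by (simp add: image_image)
  also have "\<dots> = 5 - (b - a)"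
  proof (rule LIMSEQ_unique[OF LIMSEQ_incseq_SUP])
    have tk: "Re (\<tau> (k m)) = 5 - (\<integral>t. g m t \<partial>unif)" for m
      using hM h(3) by (simp add: k_def tau_diff tau_scaleR tau_id)
    have int_le: "(\<integral>t. g n t \<partial>unif) \<le> (\<integral>t. g m t \<partial>unif)" if "m \<le> n" for m n
    proof (rule integral_mono_AE[OF hint hint])
      show "AE t in unif. g n t \<le> g m t"
        using AE_unif by eventually_elim (rule k_dec[OF that], use r in auto)
    qed
    then show "incseq (\<lambda>m. Re (\<tau> (k m)))" by (simp add: incseq_def tk)
    show "(\<lambda>m. Re (\<tau> (k m))) \<longlonglongrightarrow> 5 - (b - a)"
      unfolding tk by (intro tendsto_intros int_lim)
    then show "bdd_above (range (\<lambda>m. Re (\<tau> (k m))))"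
      by (intro Bseq_bdd_above convergent_imp_Bseq) (auto simp: convergent_def)
  qed
  finally have "Re (\<tau> e) = b - a"
    using eM by (simp add: s_def tau_diff tau_scaleR tau_id e_def)
  moreover have "\<tau> e \<in> \<real>" using eM e_adj by (intro tau_selfadjoint) (simp_all add: e_def)
  ultimately show tau_e: "\<tau> (E {a..b}) = of_real (b - a)"
    unfolding e_def by (simp add: complex_eq_iff complex_is_Real_iff)
  \<comment> \<open>Almost everywhere 0 \<le> u \<le> 5, so 5 u - u^2 \<ge> 0: the square of h m - e
    is dominated by 5 (h m - e), and convergence of traces becomes L2 convergence.\<close>
  have n2: "(norm2 (h m - e))\<^sup>2 \<le> 5 * ((\<integral>t. g m t \<partial>unif) - (b - a))" for m
  proof -
    let ?d = "h m - e"
    have dM: "?d \<in> M" "adj ?d = ?d"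
      using hM eM fcalc_adj[OF fu[of m]] by (simp_all add: e_def)
    have f: "fcalc (\<lambda>t. 5 * u m t - u m t * u m t) (5 *\<^sub>R ?d - ?d \<ast> ?d)"
      by (intro fcalc_diff fcalc_scale fcalc_mult fu)
    have "0 \<le> Re (\<tau> (5 *\<^sub>R ?d - ?d \<ast> ?d))"
    proof (rule tau_positive)
      show "5 *\<^sub>R ?d - ?d \<ast> ?d \<in> M" using dM by simp
      show "adj (5 *\<^sub>R ?d - ?d \<ast> ?d) = 5 *\<^sub>R ?d - ?d \<ast> ?d" by (rule fcalc_adj[OF f])
      fix x
      have "AE t in vmeasure x. 0 \<le> 5 * u m t - u m t * u m t"
        using u_pos[of m x]
      proof eventually_elim
        case (elim t)
        then show ?case using mult_right_mono[of "u m t" 5 "u m t"] by simp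
      qed
      then show "0 \<le> Re (cinner (blinfun_apply (5 *\<^sub>R ?d - ?d \<ast> ?d) x) x)"
        unfolding fcalc_cinner[OF f] by (simp only: Re_complex_of_real integral_nonneg_AE)
    qed
    moreover have "\<tau> (5 *\<^sub>R ?d - ?d \<ast> ?d) = 5 * \<tau> ?d - \<tau> (?d \<ast> ?d)"
      using dM(1) by (simp add: tau_diff tau_scaleR del: M_diff)
    moreover have "\<tau> ?d = of_real ((\<integral>t. g m t \<partial>unif) - (b - a))"
      using hM eM tau_e h(3) by (simp add: tau_diff e_def)
    ultimately show ?thesis using norm2_sq[OF dM(1)] dM(2) by simp
  qed
  show "\<exists>h \<in> star_algebra_generated {D}. norm2 (h - E {a..b}) \<le> \<epsilon>" if "\<epsilon> > 0"
  proof -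
    have "(\<lambda>m. 5 * ((\<integral>t. g m t \<partial>unif) - (b - a))) \<longlonglongrightarrow> 5 * ((b - a) - (b - a))"
      by (intro tendsto_intros int_lim)
    then have "\<forall>\<^sub>F m in sequentially. 5 * ((\<integral>t. g m t \<partial>unif) - (b - a)) < \<epsilon>\<^sup>2"
      using that by (intro order_tendstoD) auto
    then obtain m where "5 * ((\<integral>t. g m t \<partial>unif) - (b - a)) < \<epsilon>\<^sup>2"
      by (auto simp: eventually_sequentially)
    then have "(norm2 (h m - e))\<^sup>2 \<le> \<epsilon>\<^sup>2" using n2[of m] by linarith
    then have "norm2 (h m - e) \<le> \<epsilon>"
      by (rule power2_le_imp_le) (use that in simp)
    then show ?thesis using h(1) by (auto simp: e_def)
  qed
qed

end

section \<open>Chebyshev polynomials and the semicircle law\<close>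

text \<open>Shifted indices: \<open>cheb (n + 1) t = U\<^sub>n (t / 2)\<close>, and \<open>cheb 0 = 0\<close> plays the role of \<open>U\<^sub>-\<^sub>1\<close>.\<close>

fun cheb :: "nat \<Rightarrow> real \<Rightarrow> real" where
  "cheb 0 t = 0"
| "cheb (Suc 0) t = 1"
| "cheb (Suc (Suc n)) t = t * cheb (Suc n) t - cheb n t"

lemma cheb_cos: "cheb n (2 * cos x) * sin x = sin (real n * x)"
proof (induction n rule: induct_nat_012[case_names 0 1 ge2])
  case (ge2 n)
  have "cheb (Suc (Suc n)) (2 * cos x) * sin x =
      2 * cos x * sin (real (Suc n) * x) - sin (real n * x)"
    using ge2 by (simp add: left_diff_distrib mult.assoc)
  also have "\<dots> = sin (real (Suc (Suc n)) * x)"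
  proof -
    have "(real (Suc (Suc n)) * x + real n * x) / 2 = real (Suc n) * x"
      "(real (Suc (Suc n)) * x - real n * x) / 2 = x" by (simp_all add: field_simps)
    then have "sin (real (Suc (Suc n)) * x) + sin (real n * x) = 2 * sin (real (Suc n) * x) * cos x"
      using sin_plus_sin[of "real (Suc (Suc n)) * x" "real n * x"] by (simp only:)
    then show ?thesis unfolding diff_eq_eq by (simp only: mult_ac)
  qed
  finally show ?case .
qed auto

lemma cheb_continuous: "continuous_on S (cheb n)"
  by (induction n rule: induct_nat_012) (auto intro!: continuous_intros simp: cheb.simps[abs_def])

text \<open>With t = 2 cos \<theta> the integrand becomes 2 sin(n \<theta>) and dt = -2 sin \<theta>
  d\<theta>; the product-to-sum formula produces the antiderivative F, which vanishes at \<theta> =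
  0 and \<theta> = \<pi>. The condition n \<ge> 2 makes the divisor k = n - 1 nonzero.\<close>

lemma integral_cheb_semicircle:
  assumes "n \<ge> 2" shows "(\<integral>t. cheb n t \<partial>semicircle_distribution) = 0"
proof -
  define k where "k = n - 1"
  have k: "k \<ge> 1" "n = Suc k" using assms by (auto simp: k_def)
  define \<theta> where "\<theta> t = arccos (t / 2)" for t
  define F where "F t = - 2 * (sin (real k * \<theta> t) / real k - sin (real (k + 2) * \<theta> t) / real (k + 2))" for t
  define f where "f t = cheb n t * sqrt (4 - t\<^sup>2)" for t
  have f_eq: "f t = 2 * sin (real n * \<theta> t)" and sin_\<theta>: "sin (\<theta> t) = sqrt (4 - t\<^sup>2) / 2"
    if "t \<in> {-2..2}" for t
  proof -
    have "4 - t\<^sup>2 = 4 * (1 - (t / 2)\<^sup>2)" by (simp add: power_divide)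
    then have "sqrt (4 - t\<^sup>2) = 2 * sqrt (1 - (t / 2)\<^sup>2)" by (simp only: real_sqrt_mult real_sqrt_four)
    then show s: "sin (\<theta> t) = sqrt (4 - t\<^sup>2) / 2"
      using that by (simp add: \<theta>_def sin_arccos)
    have "2 * cos (\<theta> t) = t" using that by (simp add: \<theta>_def cos_arccos)
    then show "f t = 2 * sin (real n * \<theta> t)"
      using cheb_cos[of n "\<theta> t"] by (simp add: f_def s)
  qed
  have "(f has_integral F 2 - F (-2)) {-2..2}"
  proof (rule fundamental_theorem_of_calculus_interior)
    show "continuous_on {-2..2} F"
      unfolding F_def \<theta>_def using k by (intro continuous_intros) auto
    fix t :: real assume t: "t \<in> {-2<..<2}"
    then have t': "t \<in> {-2..2}" by simp
    have "\<bar>t\<bar>\<^sup>2 < 2\<^sup>2" by (rule power_strict_mono) (use t in auto)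
    then have w: "sqrt (4 - t\<^sup>2) > 0" by simp
    have "((\<lambda>t. arccos (t / 2)) has_real_derivative inverse (- sqrt (1 - (t / 2)\<^sup>2)) * (1 / 2)) (at t)"
      by (rule DERIV_chain2[OF DERIV_arccos]) (use t in \<open>auto intro!: derivative_eq_intros\<close>)
    moreover have "inverse (- sqrt (1 - (t / 2)\<^sup>2)) * (1 / 2) = - (1 / sqrt (4 - t\<^sup>2))"
    proof -
      have "sqrt (1 - (t / 2)\<^sup>2) = sqrt (4 - t\<^sup>2) / 2"
        using sin_\<theta>[OF t'] t by (simp add: \<theta>_def sin_arccos)
      then show ?thesis by (simp add: inverse_eq_divide)
    qed
    ultimately have d\<theta>: "(\<theta> has_real_derivative - (1 / sqrt (4 - t\<^sup>2))) (at t)"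
      by (simp add: \<theta>_def[abs_def])
    define v where "v = - (1 / sqrt (4 - t\<^sup>2))"
    have dsin: "((\<lambda>t. sin (c * \<theta> t) / c) has_real_derivative cos (c * \<theta> t) * v) (at t)"
      if "c \<noteq> 0" for c
      using that by (auto intro!: derivative_eq_intros d\<theta>[folded v_def])
    have "real k \<noteq> 0" "real (k + 2) \<noteq> 0" using k by auto
    then have "(F has_real_derivative - 2 * (cos (real k * \<theta> t) * v - cos (real (k + 2) * \<theta> t) * v)) (at t)"
      unfolding F_def[abs_def] by (intro DERIV_cmult DERIV_diff dsin)
    moreover have "- 2 * (cos (real k * \<theta> t) * v - cos (real (k + 2) * \<theta> t) * v)
        = - 2 * v * (cos (real k * \<theta> t) - cos (real (k + 2) * \<theta> t))"
      by (simp only: left_diff_distrib right_diff_distrib mult_ac)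
    moreover have "cos (real k * \<theta> t) - cos (real (k + 2) * \<theta> t) = 2 * sin (real n * \<theta> t) * sin (\<theta> t)"
    proof -
      have "(real k * \<theta> t + real (k + 2) * \<theta> t) / 2 = real n * \<theta> t"
        "(real (k + 2) * \<theta> t - real k * \<theta> t) / 2 = \<theta> t"
        using k by (simp_all add: field_simps)
      then show ?thesis using cos_diff_cos[of "real k * \<theta> t" "real (k + 2) * \<theta> t"] by simp
    qed
    moreover have "- 2 * v * (2 * sin (real n * \<theta> t) * sin (\<theta> t)) = f t"
      using w by (simp add: v_def sin_\<theta>[OF t'] f_eq[OF t'])
    ultimately show "(F has_vector_derivative f t) (at t)"
      by (simp add: has_real_derivative_iff_has_vector_derivative)
  qed simp
  moreover have "F 2 = 0" by (simp add: F_def \<theta>_def)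
  moreover have "F (-2) = 0"
  proof -
    have "\<theta> (-2) = pi" by (simp add: \<theta>_def)
    then show ?thesis unfolding F_def by (simp only: sin_npi) simp
  qed
  ultimately have hi: "(f has_integral 0) {-2..2}" by simp
  have cont: "continuous_on {-2..2} f"
    unfolding f_def by (intro continuous_intros cheb_continuous)
  have "(\<integral>t. cheb n t \<partial>semicircle_distribution) =
      (\<integral>t. (1 / (2 * pi) * sqrt (4 - t\<^sup>2) * indicator {-2..2} t) *\<^sub>R cheb n t \<partial>lborel)"
    unfolding semicircle_distribution_def
  proof (rule integral_density)
    show "cheb n \<in> borel_measurable lborel"
      using borel_measurable_continuous_onI[OF cheb_continuous] by simp
    have "t\<^sup>2 \<le> 4" if "t \<in> {-2..2}" for t :: real
      using that power_mono[of "\<bar>t\<bar>" 2 2] by auto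
    then show "AE t in lborel. 0 \<le> 1 / (2 * pi) * sqrt (4 - t\<^sup>2) * indicator {-2..2} t"
      by (auto simp: indicator_def)
  qed measurable
  also have "\<dots> = (\<integral>t. 1 / (2 * pi) * (indicator {-2..2} t *\<^sub>R f t) \<partial>lborel)"
    by (intro Bochner_Integration.integral_cong) (simp_all add: f_def mult_ac)
  also have "\<dots> = 1 / (2 * pi) * (LINT t:{-2..2}|lborel. f t)"
    by (simp add: set_lebesgue_integral_def)
  also have "(LINT t:{-2..2}|lborel. f t) = 0"
    using set_borel_integral_eq_integral(2)[OF borel_integrable_atLeastAtMost'[OF cont]] hi
    by (simp add: integral_unique)
  finally show ?thesis by simp
qed

text \<open>A relation between polynomial functions and operators, so that traces given by moments
  can be compared with integrals without naming coefficients.\<close>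

inductive poly_op :: "'h::chilbert_space bop \<Rightarrow> (real \<Rightarrow> real) \<Rightarrow> 'h bop \<Rightarrow> bool" for a where
  power: "poly_op a (\<lambda>t. t ^ n) (op_power a n)"
| scale: "poly_op a f b \<Longrightarrow> poly_op a (\<lambda>t. r * f t) (r *\<^sub>R b)"
| add: "poly_op a f b \<Longrightarrow> poly_op a g c \<Longrightarrow> poly_op a (\<lambda>t. f t + g t) (b + c)"

lemma poly_op_mult:
  assumes "poly_op a f b" shows "poly_op a (\<lambda>t. t * f t) (a \<ast> b)"
  using assms
proof induction
  case (power n)
  then show ?case using poly_op.power[of a "Suc n"] by simp
next
  case (scale f b r)
  then show ?case using poly_op.scale[OF scale.IH, of r]
    by (simp add: bounded_bilinear.scaleR_right[OF bounded_bilinear_blinfun_compose] mult.left_commute)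
next
  case (add f b g c)
  then show ?case using poly_op.add[OF add.IH] by (simp add: compose_simps distrib_left)
qed

lemma poly_op_algebra: "poly_op a f b \<Longrightarrow> b \<in> star_algebra_generated {a}"
  by (induction rule: poly_op.induct)
    (auto intro: star_algebra_op_power star_algebra_scaleR star_algebra_generated.add)

lemma (in tracial_algebra) poly_op_tau:
  assumes a: "a \<in> M" and dist: "has_distribution \<tau> a \<mu>" and p: "poly_op a f b"
  shows "b \<in> M \<and> integrable \<mu> f \<and> \<tau> b = of_real (\<integral>t. f t \<partial>\<mu>)"
  using p
proof induction
  case (power n)
  have P: "prob_space \<mu>" and s: "sets \<mu> = sets borel"
    using dist by (auto simp: has_distribution_def)
  interpret prob_space \<mu> by (rule P)
  obtain r where r: "AE t in \<mu>. \<bar>t\<bar> \<le> r" using dist by (auto simp: has_distribution_def)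
  have "AE t in \<mu>. norm (t ^ n) \<le> r ^ n"
    using r by eventually_elim (simp add: power_abs power_mono)
  moreover have "(\<lambda>t. t ^ n) \<in> borel_measurable \<mu>"
    by (subst measurable_cong_sets[OF s refl]) measurable
  ultimately have "integrable \<mu> (\<lambda>t. t ^ n)" by (rule integrable_const_bound)
  moreover have "op_power a n \<in> M" by (induction n) (auto simp: a)
  ultimately show ?case using dist by (simp add: has_distribution_def)
next
  case (scale f b r)
  then show ?case by (simp add: tau_scaleR)
next
  case (add f b g c)
  then show ?case by (simp add: tau_add)
qed

fun cheb_op :: "'h::chilbert_space bop \<Rightarrow> nat \<Rightarrow> 'h bop" where
  "cheb_op a 0 = 0"
| "cheb_op a (Suc 0) = id_blinfun"
| "cheb_op a (Suc (Suc n)) = a \<ast> cheb_op a (Suc n) - cheb_op a n"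

lemma cheb_op_poly: "poly_op a (cheb n) (cheb_op a n)"
proof (induction n rule: induct_nat_012[case_names 0 1 ge2])
  case 0
  show ?case using poly_op.scale[OF poly_op.power[of a 0], of 0] by (simp add: cheb.simps[abs_def])
next
  case 1
  show ?case using poly_op.power[of a 0] by (simp add: cheb.simps[abs_def])
next
  case (ge2 n)
  show ?case
    using poly_op.add[OF poly_op_mult[OF ge2(2)] poly_op.scale[OF ge2(1), of "-1"]]
    by (simp add: cheb.simps[abs_def])
qed

lemma cheb_op_commute: "cheb_op a n \<ast> a = a \<ast> cheb_op a n"
  by (induction n rule: induct_nat_012) (simp_all add: compose_simps)

section \<open>The Schwinger--Dyson equation\<close>

lemma foldr_compose_snoc:
  "foldr (o\<^sub>L) (as @ [a]) id_blinfun = foldr (o\<^sub>L) as id_blinfun \<ast> a"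
proof -
  have "foldr (o\<^sub>L) as b = foldr (o\<^sub>L) as id_blinfun \<ast> b" for b
    by (induction as) (simp_all add: compose_assoc)
  then show ?thesis by simp
qed

locale free_semicircular = tracial_algebra M \<tau>
  for M :: "'h::chilbert_space bop set" and \<tau> +
  fixes D X :: "'h bop"
  assumes D_in_M: "D \<in> M" and X_in_M: "X \<in> M" and free: "free_pair \<tau> D X"
    and X_dist: "has_distribution \<tau> X semicircle_distribution"
begin

text \<open>\<open>True\<close> labels the algebra of D and \<open>False\<close> that of X, as in
  \<open>free_pair\<close>.\<close>

definition alg :: "bool \<Rightarrow> 'h bop set" where
  "alg i = star_algebra_generated (if i then {D} else {X})"

lemma alg_M [simp]: "a \<in> alg i \<Longrightarrow> a \<in> M"
  using star_algebra_subset[of "{D}"] star_algebra_subset[of "{X}"] D_in_M X_in_M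
  by (auto simp: alg_def split: if_splits)

lemma alg_mult: "a \<in> alg i \<Longrightarrow> b \<in> alg i \<Longrightarrow> a \<ast> b \<in> alg i"
  and alg_X: "X \<in> alg False"
  by (auto simp: alg_def intro: star_algebra_generated.intros)

section \<open>Centred alternating words\<close>

definition centre :: "'h bop \<Rightarrow> 'h bop" where
  "centre a = a - scalar_op (\<tau> a)"

lemma centre_alg: "a \<in> alg i \<Longrightarrow> centre a \<in> alg i"
  using star_algebra_generated.add[OF _ star_algebra_generated.scale[OF star_algebra_generated.one,
      of "- \<tau> a"], of a]
  by (simp add: alg_def centre_def scalar_op_minus)

lemma tau_centre: "a \<in> alg i \<Longrightarrow> \<tau> (centre a) = 0"
  by (simp add: centre_def tau_diff tau_scalar_op)

lemma compose_centre: "r \<in> M \<Longrightarrow> r \<ast> a = r \<ast> centre a + \<tau> a \<odot> r"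
  by (simp add: centre_def compose_simps scalar_op_commute[of r])

text \<open>Both end labels are recorded: the first decides whether a Chebyshev letter may be put in
  front, the last whether a new factor opens a letter or merges. Words grow on the right because the
  derivative is computed along right multiplication.\<close>

inductive alternating :: "bool \<Rightarrow> bool \<Rightarrow> 'h bop \<Rightarrow> bool" where
  single: "a \<in> alg i \<Longrightarrow> \<tau> a = 0 \<Longrightarrow> alternating i i a"
| snoc: "alternating i j r \<Longrightarrow> a \<in> alg (\<not> j) \<Longrightarrow> \<tau> a = 0 \<Longrightarrow> alternating i (\<not> j) (r \<ast> a)"

lemma alternating_M: "alternating i j r \<Longrightarrow> r \<in> M"
  by (induction rule: alternating.induct) auto

lemma alternating_Cons:
  "alternating i j r \<Longrightarrow> a \<in> alg (\<not> i) \<Longrightarrow> \<tau> a = 0 \<Longrightarrow> alternating (\<not> i) j (a \<ast> r)"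
proof (induction rule: alternating.induct)
  case (single b i)
  then show ?case using alternating.snoc[OF alternating.single[of a "\<not> i"], of b] by simp
next
  case (snoc i j r b)
  then show ?case using alternating.snoc[of "\<not> i" j "a \<ast> r" b] by (simp add: compose_assoc)
qed

text \<open>Translation to the indexed lists of \<open>free_family\<close>. The clause on the last
  label strengthens the induction: it makes the neighbouring labels differ at the seam.\<close>

lemma alternating_list:
  "alternating i j r \<Longrightarrow> \<exists>as is. as \<noteq> [] \<and> length is = length as
    \<and> (\<forall>k < length as. as ! k \<in> alg (is ! k) \<and> \<tau> (as ! k) = 0)
    \<and> (\<forall>k. Suc k < length as \<longrightarrow> is ! k \<noteq> is ! Suc k)
    \<and> is ! (length as - 1) = j \<and> r = foldr (o\<^sub>L) as id_blinfun"
proof (induction rule: alternating.induct)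
  case (single a i)
  then show ?case by (intro exI[of _ "[a]"] exI[of _ "[i]"]) auto
next
  case (snoc i j r a)
  then obtain as "is" where h: "as \<noteq> []" "length is = length as"
    "\<And>k. k < length as \<Longrightarrow> as ! k \<in> alg (is ! k) \<and> \<tau> (as ! k) = 0"
    "\<And>k. Suc k < length as \<Longrightarrow> is ! k \<noteq> is ! Suc k"
    "is ! (length as - 1) = j" "r = foldr (o\<^sub>L) as id_blinfun" by blast
  have "is ! k \<noteq> (is @ [\<not> j]) ! Suc k" if "Suc k = length as" for k
  proof -
    have "k = length as - 1" using that by simp
    then show ?thesis using that h(2,5) by (simp add: nth_append)
  qed
  with h(1-5) snoc(2,3) have "as @ [a] \<noteq> [] \<and> length (is @ [\<not> j]) = length (as @ [a])
    \<and> (\<forall>k < length (as @ [a]). (as @ [a]) ! k \<in> alg ((is @ [\<not> j]) ! k) \<and> \<tau> ((as @ [a]) ! k) = 0)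
    \<and> (\<forall>k. Suc k < length (as @ [a]) \<longrightarrow> (is @ [\<not> j]) ! k \<noteq> (is @ [\<not> j]) ! Suc k)
    \<and> (is @ [\<not> j]) ! (length (as @ [a]) - 1) = (\<not> j)"
    by (auto simp: nth_append less_Suc_eq)
  moreover have "r \<ast> a = foldr (o\<^sub>L) (as @ [a]) id_blinfun"
    by (simp only: foldr_compose_snoc h(6))
  ultimately show ?case by blast
qed

lemma alternating_tau:
  assumes "alternating i j r" shows "\<tau> r = 0"
proof -
  have "free_family \<tau> alg"
    using free unfolding free_pair_def alg_def[abs_def] .
  then show ?thesis using alternating_list[OF assms] unfolding free_family_def by blast
qed

section \<open>Chebyshev letters in front of reduced words, and the derivative\<close>

abbreviation V :: "nat \<Rightarrow> 'h bop" where "V \<equiv> cheb_op X"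

lemma V_alg: "V n \<in> alg False"
  using poly_op_algebra[OF cheb_op_poly] by (simp add: alg_def)

lemma V_M [simp]: "V n \<in> M"
  by (rule alg_M[OF V_alg])

lemma V_tau: "n \<ge> 2 \<Longrightarrow> \<tau> (V n) = 0"
  using poly_op_tau[OF X_in_M X_dist cheb_op_poly] integral_cheb_semicircle by simp

text \<open>The possible right factors of a leading V n: nothing, or a centred word starting in the
  algebra of D. For n \<ge> 2 the product with V n is again centred and alternating.\<close>

definition reduced :: "'h bop \<Rightarrow> bool" where
  "reduced r \<longleftrightarrow> r = id_blinfun \<or> (\<exists>j. alternating True j r)"

lemma reduced_M: "reduced r \<Longrightarrow> r \<in> M"
  by (auto simp: reduced_def alternating_M)

lemma V_reduced_tau:
  assumes "reduced r" "n \<ge> 2" shows "\<tau> (V n \<ast> r) = 0"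
proof (cases "r = id_blinfun")
  case False
  then obtain j where "alternating True j r" using assms by (auto simp: reduced_def)
  then have "alternating (\<not> True) j (V n \<ast> r)"
    by (rule alternating_Cons) (simp_all add: V_alg V_tau assms)
  then show ?thesis by (rule alternating_tau)
qed (simp add: V_tau assms)

text \<open>Either c opens a new letter or it merges with the last one; centring then splits off a
  multiple of the old word or of the word without its last letter. Merging into a single letter
  leaves a multiple of the identity, which \<open>reduced\<close> therefore admits.\<close>

lemma alternating_times:
  assumes r: "alternating True j r" and c: "c \<in> alg i"
  shows "\<exists>r' r'' \<gamma>. reduced r' \<and> reduced r'' \<and> r \<ast> c = r' + \<gamma> \<odot> r''"
proof (cases "i = j")
  case False
  then have "alternating True (\<not> j) (r \<ast> centre c)"
    using c by (intro alternating.snoc r centre_alg tau_centre[of c i]) auto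
  then show ?thesis
    using compose_centre[OF alternating_M[OF r], of c] r unfolding reduced_def by blast
next
  case True
  from r show ?thesis
  proof cases
    case single
    then have rc: "r \<ast> c \<in> alg True" using c True alg_mult by blast
    then have "alternating True True (centre (r \<ast> c))"
      by (intro alternating.single centre_alg tau_centre)
    moreover have "r \<ast> c = centre (r \<ast> c) + \<tau> (r \<ast> c) \<odot> id_blinfun" by (simp add: centre_def)
    ultimately show ?thesis unfolding reduced_def by blast
  next
    case (snoc j' s a)
    have ac: "a \<ast> c \<in> alg (\<not> j')" using snoc c True alg_mult by blast
    then have "alternating True (\<not> j') (s \<ast> centre (a \<ast> c))"
      using snoc by (intro alternating.snoc centre_alg tau_centre) auto
    moreover have "r \<ast> c = s \<ast> centre (a \<ast> c) + \<tau> (a \<ast> c) \<odot> s"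
      using compose_centre[of s "a \<ast> c"] snoc alternating_M by (simp add: compose_assoc)
    ultimately show ?thesis using snoc unfolding reduced_def by blast
  qed
qed

text \<open>
  \<open>sd_span P y\<close>: \<open>P\<close> is a noncommutative polynomial in \<open>X\<close> and \<open>alg True\<close>, and
  \<open>y = (\<tau> \<otimes> id) (\<partial>P)\<close> for the free difference quotient \<open>\<partial>\<close> with respect to \<open>X\<close>.
  On a polynomial starting with \<open>V (k + 1)\<close> followed by an alternating centred word,
  \<open>(\<tau> \<otimes> id) \<partial>\<close> acts as a left annihilation operator.
\<close>

inductive sd_span :: "'h bop \<Rightarrow> 'h bop \<Rightarrow> bool" where
  word: "reduced r \<Longrightarrow> sd_span (V (Suc k) \<ast> r) (V k \<ast> r)"
| add: "sd_span P y \<Longrightarrow> sd_span P' y' \<Longrightarrow> sd_span (P + P') (y + y')"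
| scale: "sd_span P y \<Longrightarrow> sd_span (c \<odot> P) (c \<odot> y)"

lemma sd_span_id: "sd_span id_blinfun 0"
  using sd_span.word[of id_blinfun 0] by (simp add: reduced_def)

lemma sd_span_M: "sd_span P y \<Longrightarrow> P \<in> M \<and> y \<in> M"
  by (induction rule: sd_span.induct) (auto simp: reduced_M)

text \<open>By the recurrence X V(k+1) = V(k+2) + V(k), and the leading V(k+2) yields a word of
  trace zero.\<close>

lemma sd_span_tau: "sd_span P y \<Longrightarrow> \<tau> (X \<ast> P) = \<tau> y"
proof (induction rule: sd_span.induct)
  case (word r k)
  have "X \<ast> (V (Suc k) \<ast> r) = V (Suc (Suc k)) \<ast> r + V k \<ast> r"
    by (simp add: compose_simps)
  also have "\<tau> \<dots> = \<tau> (V (Suc (Suc k)) \<ast> r) + \<tau> (V k \<ast> r)"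
    by (intro tau_add M_compose alg_M[OF V_alg] reduced_M[OF word])
  finally show ?case using V_reduced_tau[OF word, of "Suc (Suc k)"] by simp
next
  case (add P y P' y')
  then show ?case
    using sd_span_M[OF add(1)] sd_span_M[OF add(2)] by (simp add: compose_simps tau_add X_in_M)
next
  case (scale P y c)
  then show ?case using sd_span_M[OF scale(1)]
    by (simp add: scalar_op_commute_left[of X] tau_scale X_in_M)
qed

lemma sd_span_word_times:
  assumes "alternating True j r" "c \<in> alg i"
  shows "sd_span (V (Suc k) \<ast> r \<ast> c) (V k \<ast> r \<ast> c)"
proof -
  obtain r' r'' \<gamma> where h: "reduced r'" "reduced r''" "r \<ast> c = r' + \<gamma> \<odot> r''"
    using alternating_times[OF assms] by blast
  have "V n \<ast> r \<ast> c = V n \<ast> r' + \<gamma> \<odot> (V n \<ast> r'')" for n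
    using h(3) scalar_op_commute_left[OF M_clinear[OF alg_M[OF V_alg]]]
    by (simp add: compose_simps)
  then show ?thesis using h(1,2) by (auto intro: sd_span.intros)
qed

text \<open>Elements of the algebra of D are constants for \<partial>. If r is the identity, c opens
  the word and has to be centred; otherwise it is absorbed at the right end, away from the leading
  V.\<close>

lemma sd_span_times_D:
  "sd_span P y \<Longrightarrow> c \<in> alg True \<Longrightarrow> sd_span (P \<ast> c) (y \<ast> c)"
proof (induction rule: sd_span.induct)
  case (word r k)
  show ?case
  proof (cases "r = id_blinfun")
    case True
    have "alternating True True (centre c)"
      using word(2) by (intro alternating.single centre_alg tau_centre)
    then have red: "reduced (centre c)" "reduced id_blinfun" by (auto simp: reduced_def)
    have eq: "V n \<ast> r \<ast> c = V n \<ast> centre c + \<tau> c \<odot> (V n \<ast> id_blinfun)" for n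
      unfolding True compose_id by (rule compose_centre[OF V_M])
    show ?thesis unfolding eq using red by (intro sd_span.add sd_span.scale sd_span.word)
  next
    case False
    then show ?thesis using word sd_span_word_times by (auto simp: reduced_def)
  qed
qed (auto simp: compose_simps intro: sd_span.intros)

text \<open>The product rule \<partial>(P X) = (\<partial>P) X + P \<otimes> 1, where \<tau>
  \<otimes> id sends the last term to \<tau>(P). A word with nontrivial r has trace zero and changes
  at its right end; for r = 1 the Chebyshev recurrence applies.\<close>

lemma sd_span_times_X: "sd_span P y \<Longrightarrow> sd_span (P \<ast> X) (y \<ast> X + scalar_op (\<tau> P))"
proof (induction rule: sd_span.induct)
  case (word r k)
  show ?case
  proof (cases "r = id_blinfun")
    case True
    have id: "reduced id_blinfun" by (simp add: reduced_def)
    have VX: "V (Suc n) \<ast> X = V (Suc (Suc n)) + V n" for n by (simp add: cheb_op_commute)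
    show ?thesis
    proof (cases k)
      \<comment> \<open>P = V 1 = 1 has derivative V 0 = 0, while P X = V 2 has derivative V 1 = 1.
        Here the product rule consists of its scalar term \<tau>(P) = 1.\<close>
      case 0
      then show ?thesis using sd_span.word[OF id, of 1] True by (simp add: tau_id)
    next
      case (Suc m)
      have "sd_span (V (Suc (Suc k)) + V k) (V (Suc k) + V m)"
        using sd_span.add[OF sd_span.word[OF id, of "Suc k"] sd_span.word[OF id, of m]] Suc by simp
      then show ?thesis
        using True VX[of k] VX[of m] V_tau[of "Suc k"] Suc by simp
    qed
  next
    case False
    then obtain j where j: "alternating True j r" using word by (auto simp: reduced_def)
    have "\<tau> (V (Suc k) \<ast> r) = 0"
      using V_reduced_tau[OF word, of "Suc k"] alternating_tau[OF j] by (cases k) simp_all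
    then show ?thesis using sd_span_word_times[OF j alg_X, of k] by simp
  qed
next
  case (add P y P' y')
  then show ?case using sd_span.add[OF add.IH] sd_span_M[OF add(1)] sd_span_M[OF add(2)]
    by (simp add: compose_simps tau_add scalar_op_add add_ac)
next
  case (scale P y c)
  then show ?case using sd_span.scale[OF scale.IH, of c] sd_span_M[OF scale(1)]
    by (simp add: compose_simps tau_scale scalar_op_mult)
qed

text \<open>The graph of P \<mapsto> (\<tau> \<otimes> id)(\<partial>P), closed in the L2 norm with
  one polynomial serving both components. Being a relation, it raises no question of
  closability.\<close>

definition sd :: "'h bop \<Rightarrow> 'h bop \<Rightarrow> bool" where
  "sd P y \<longleftrightarrow> P \<in> M \<and> y \<in> M \<and>
    (\<forall>\<epsilon>>0. \<exists>P' y'. sd_span P' y' \<and> norm2 (P - P') \<le> \<epsilon> \<and> norm2 (y - y') \<le> \<epsilon>)"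

lemma sd_span_sd: "sd_span P y \<Longrightarrow> sd P y"
  unfolding sd_def using sd_span_M[of P y]
  by (intro conjI allI impI exI[of _ P] exI[of _ y]) auto

lemma sd_id: "sd id_blinfun 0"
  by (rule sd_span_sd[OF sd_span_id])

lemma sd_M: "sd P y \<Longrightarrow> P \<in> M" "sd P y \<Longrightarrow> y \<in> M"
  by (auto simp: sd_def)

text \<open>Both sides are continuous in \<open>norm2\<close>. The tolerance is chosen so that the
  total error is d/2, half of the supposed discrepancy.\<close>

theorem Schwinger_Dyson:
  assumes sd: "sd P y" shows "\<tau> (X \<ast> P) = \<tau> y"
proof (rule ccontr)
  assume "\<tau> (X \<ast> P) \<noteq> \<tau> y"
  define d where "d = cmod (\<tau> (X \<ast> P) - \<tau> y)"
  have d: "d > 0" using \<open>\<tau> (X \<ast> P) \<noteq> \<tau> y\<close> by (simp add: d_def)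
  define \<epsilon> where "\<epsilon> = d / 2 / (norm X + 1)"
  have e: "\<epsilon> > 0" using d by (simp add: \<epsilon>_def add_nonneg_pos)
  obtain P' y' where h: "sd_span P' y'" "norm2 (P - P') \<le> \<epsilon>" "norm2 (y - y') \<le> \<epsilon>"
    using sd e unfolding sd_def by blast
  note M = sd_M[OF sd] sd_span_M[OF h(1)] X_in_M
  have "\<tau> (X \<ast> P) - \<tau> y = \<tau> (X \<ast> (P - P')) - \<tau> (y - y')"
    using sd_span_tau[OF h(1)] M by (simp add: tau_diff compose_simps)
  then have "d \<le> cmod (\<tau> (X \<ast> (P - P'))) + cmod (\<tau> (y - y'))"
    by (simp add: d_def norm_triangle_ineq4)
  also have "cmod (\<tau> (X \<ast> (P - P'))) \<le> norm X * \<epsilon>"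
    using tau_le_norm2[of "X \<ast> (P - P')"] norm2_compose_left[of X "P - P'"] M
      mult_left_mono[OF h(2) norm_ge_zero[of X]] by simp
  also have "cmod (\<tau> (y - y')) \<le> \<epsilon>"
    using tau_le_norm2[of "y - y'"] h(3) M by simp
  finally have "d \<le> (norm X + 1) * \<epsilon>" by (simp add: algebra_simps)
  also have "\<dots> = d / 2"
  proof -
    have "c \<noteq> 0 \<Longrightarrow> c * (a / c) = a" for a c :: real by simp
    moreover have "norm X + 1 \<noteq> 0" using norm_ge_zero[of X] by linarith
    ultimately show ?thesis unfolding \<epsilon>_def by blast
  qed
  finally show False using d by simp
qed

lemma sd_add:
  assumes "sd P y" "sd Q z" shows "sd (P + Q) (y + z)"
  unfolding sd_def
proof (intro conjI allI impI)
  fix \<epsilon> :: real assume e: "\<epsilon> > 0"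
  obtain P' y' where h: "sd_span P' y'" "norm2 (P - P') \<le> \<epsilon> / 2" "norm2 (y - y') \<le> \<epsilon> / 2"
    using assms(1) e unfolding sd_def by (metis half_gt_zero)
  obtain Q' z' where g: "sd_span Q' z'" "norm2 (Q - Q') \<le> \<epsilon> / 2" "norm2 (z - z') \<le> \<epsilon> / 2"
    using assms(2) e unfolding sd_def by (metis half_gt_zero)
  note M = sd_M[OF assms(1)] sd_M[OF assms(2)] sd_span_M[OF h(1)] sd_span_M[OF g(1)]
  have "norm2 (P + Q - (P' + Q')) \<le> \<epsilon>" "norm2 (y + z - (y' + z')) \<le> \<epsilon>"
    using norm2_triangle[of "P - P'" "Q - Q'"] norm2_triangle[of "y - y'" "z - z'"] M h g
    by (simp_all add: add_diff_add)
  then show "\<exists>P' y'. sd_span P' y' \<and> norm2 (P + Q - P') \<le> \<epsilon> \<and> norm2 (y + z - y') \<le> \<epsilon>"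
    using sd_span.add[OF h(1) g(1)] by blast
qed (use sd_M[OF assms(1)] sd_M[OF assms(2)] in auto)

lemma sd_scale:
  assumes "sd P y" shows "sd (c \<odot> P) (c \<odot> y)"
  unfolding sd_def
proof (intro conjI allI impI)
  fix \<epsilon> :: real assume e: "\<epsilon> > 0"
  define \<delta> where "\<delta> = \<epsilon> / (cmod c + 1)"
  have d: "\<delta> > 0" using e by (simp add: \<delta>_def add_nonneg_pos)
  have cd: "cmod c * \<delta> \<le> \<epsilon>"
    using e by (simp add: \<delta>_def divide_le_eq add_nonneg_pos mult.commute distrib_left)
  obtain P' y' where h: "sd_span P' y'" "norm2 (P - P') \<le> \<delta>" "norm2 (y - y') \<le> \<delta>"
    using assms d unfolding sd_def by blast
  note M = sd_M[OF assms] sd_span_M[OF h(1)]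
  have "norm2 (c \<odot> u - c \<odot> v) \<le> \<epsilon>" if "u \<in> M" "v \<in> M" "norm2 (u - v) \<le> \<delta>" for u v
    using norm2_scale[of "u - v" c] that mult_left_mono[OF that(3) norm_ge_zero[of c]] cd
    by (simp add: compose_simps)
  then show "\<exists>P' y'. sd_span P' y' \<and> norm2 (c \<odot> P - P') \<le> \<epsilon> \<and> norm2 (c \<odot> y - y') \<le> \<epsilon>"
    using sd_span.scale[OF h(1)] h M by blast
qed (use sd_M[OF assms] in auto)

lemma sd_sum: "finite I \<Longrightarrow> (\<And>i. i \<in> I \<Longrightarrow> sd (P i) (y i)) \<Longrightarrow> sd (sum P I) (sum y I)"
proof (induction I rule: finite_induct)
  case empty
  show ?case using sd_scale[OF sd_id, of 0] by simp
qed (simp add: sd_add)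

lemma sd_times_X:
  assumes "sd P y" shows "sd (P \<ast> X) (y \<ast> X + scalar_op (\<tau> P))"
  unfolding sd_def
proof (intro conjI allI impI)
  fix \<epsilon> :: real assume e: "\<epsilon> > 0"
  define \<delta> where "\<delta> = \<epsilon> / (norm X + 1)"
  have d: "\<delta> > 0" using e by (simp add: \<delta>_def add_nonneg_pos)
  have Xd: "\<delta> * norm X + \<delta> = \<epsilon>"
  proof -
    have "\<delta> * (norm X + 1) = \<epsilon>" by (simp add: \<delta>_def add_nonneg_eq_0_iff)
    then show ?thesis by (simp add: distrib_left)
  qed
  obtain P' y' where h: "sd_span P' y'" "norm2 (P - P') \<le> \<delta>" "norm2 (y - y') \<le> \<delta>"
    using assms d unfolding sd_def by blast
  note M = sd_M[OF assms] sd_span_M[OF h(1)] X_in_M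
  have X: "norm2 ((u - v) \<ast> X) \<le> \<delta> * norm X" if "u \<in> M" "v \<in> M" "norm2 (u - v) \<le> \<delta>" for u v
    using norm2_compose_right[of X "u - v"] that mult_right_mono[OF that(3) norm_ge_zero[of X]] M
    by simp
  have "norm2 (P \<ast> X - P' \<ast> X) \<le> \<epsilon>"
    using X[of P P'] h M Xd d by (simp add: compose_simps)
  moreover have "norm2 (scalar_op (\<tau> P) - scalar_op (\<tau> P')) \<le> \<delta>"
  proof -
    have "(scalar_op (\<tau> P) :: 'h bop) - scalar_op (\<tau> P') = \<tau> (P - P') \<odot> id_blinfun"
      using M by (simp add: tau_diff scalar_op_diff)
    then have "norm2 (scalar_op (\<tau> P) - scalar_op (\<tau> P')) \<le> cmod (\<tau> (P - P'))"
      using norm2_scale[of id_blinfun "\<tau> (P - P')"] by (simp only: norm2_id M_id mult_1_right)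
    then show ?thesis using tau_le_norm2[of "P - P'"] M h by simp
  qed
  then have "norm2 (y \<ast> X + scalar_op (\<tau> P) - (y' \<ast> X + scalar_op (\<tau> P'))) \<le> \<epsilon>"
    using norm2_triangle[of "(y - y') \<ast> X" "scalar_op (\<tau> P) - scalar_op (\<tau> P')"]
      X[of y y'] h M Xd by (simp add: compose_simps add_diff_add)
  ultimately show "\<exists>P' y'. sd_span P' y' \<and> norm2 (P \<ast> X - P') \<le> \<epsilon>
      \<and> norm2 (y \<ast> X + scalar_op (\<tau> P) - y') \<le> \<epsilon>"
    using sd_span_times_X[OF h(1)] by blast
qed (use sd_M[OF assms] X_in_M in auto)

text \<open>The coefficients by which a word may be multiplied: the L2 closure of the algebra of D
  inside M, which contains the interval projections.\<close>

definition approximable :: "'h bop \<Rightarrow> bool" where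
  "approximable b \<longleftrightarrow> b \<in> M \<and> (\<forall>\<epsilon>>0. \<exists>h \<in> alg True. norm2 (h - b) \<le> \<epsilon>)"

lemma sd_times_approximable:
  assumes sd: "sd P y" and b: "approximable b" shows "sd (P \<ast> b) (y \<ast> b)"
  unfolding sd_def
proof (intro conjI allI impI)
  fix \<epsilon> :: real assume e: "\<epsilon> > 0"
  have bM: "b \<in> M" using b by (simp add: approximable_def)
  define \<delta> where "\<delta> = \<epsilon> / 2 / (norm b + 1)"
  have d: "\<delta> > 0" using e by (simp add: \<delta>_def add_nonneg_pos)
  have bd: "\<delta> * norm b \<le> \<epsilon> / 2"
  proof -
    have "\<delta> * norm b \<le> \<delta> * (norm b + 1)" using d by simp
    also have "\<dots> = \<epsilon> / 2"
    proof -
      have "c \<noteq> 0 \<Longrightarrow> (a / c) * c = a" for a c :: real by simp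
      moreover have "norm b + 1 \<noteq> 0" using norm_ge_zero[of b] by linarith
      ultimately show ?thesis unfolding \<delta>_def by blast
    qed
    finally show ?thesis .
  qed
  obtain P' y' where h: "sd_span P' y'" "norm2 (P - P') \<le> \<delta>" "norm2 (y - y') \<le> \<delta>"
    using sd d unfolding sd_def by blast
  note M = sd_M[OF sd] sd_span_M[OF h(1)] bM
  \<comment> \<open>L2-approximating b helps against factors bounded in operator norm. So P' and y'
    are fixed before c, and the tolerance \<eta> depends on their norms, over which the L2
    approximation gives no control.\<close>
  define K where "K = norm P' + norm y' + 1"
  define \<eta> where "\<eta> = \<epsilon> / (2 * K)"
  have K: "K > 0" by (simp add: K_def add_nonneg_pos)
  then have eta: "\<eta> > 0" using e by (simp add: \<eta>_def)
  obtain c where c: "c \<in> alg True" "norm2 (c - b) \<le> \<eta>"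
    using b eta unfolding approximable_def by blast
  have "norm2 (u \<ast> b - v \<ast> c) \<le> \<epsilon>"
    if "u \<in> M" "v \<in> M" "norm2 (u - v) \<le> \<delta>" "norm v \<le> K" for u v
  proof -
    have n: "norm2 (b - c) = norm2 (c - b)"
      using M c by (intro norm2_minus_commute) auto
    have "norm2 (u \<ast> b - v \<ast> c) \<le> norm2 (u \<ast> b - v \<ast> b) + norm2 (v \<ast> b - v \<ast> c)"
      using that M c by (intro norm2_triangle_diff) auto
    also have "norm2 (u \<ast> b - v \<ast> b) \<le> \<delta> * norm b"
      using norm2_compose_right[of b "u - v"] that mult_right_mono[OF that(3) norm_ge_zero[of b]] M
      by (simp add: compose_simps)
    also have "norm2 (v \<ast> b - v \<ast> c) \<le> norm v * norm2 (b - c)"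
      using norm2_compose_left[of v "b - c"] that M c by (simp add: compose_simps)
    also have "\<dots> \<le> K * \<eta>" unfolding n
      using that(4) c K M by (intro mult_mono) (auto intro: norm2_nonneg)
    also have "K * \<eta> = \<epsilon> / 2" using K by (simp add: \<eta>_def)
    finally show ?thesis using bd by simp
  qed
  from this[of P P'] this[of y y'] show "\<exists>P' y'. sd_span P' y' \<and> norm2 (P \<ast> b - P') \<le> \<epsilon>
      \<and> norm2 (y \<ast> b - y') \<le> \<epsilon>"
    using sd_span_times_D[OF h(1) c(1)] h M by (auto simp: K_def)
qed (use sd_M[OF sd] b in \<open>auto simp: approximable_def\<close>)

text \<open>Norm limits are also L2 limits. This closedness admits resolvents, which are limits of
  polynomial iterates.\<close>

lemma sd_limit:
  assumes sd: "\<And>n. sd (P n) (y n)" and lim: "P \<longlonglongrightarrow> P'" "y \<longlonglongrightarrow> y'"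
  shows "sd P' y'"
  unfolding sd_def
proof (intro conjI allI impI)
  show PM: "P' \<in> M" and yM: "y' \<in> M"
    using M_limit[OF _ lim(1)] M_limit[OF _ lim(2)] sd_M[OF sd] by blast+
  fix \<epsilon> :: real assume e: "\<epsilon> > 0"
  then have "\<forall>\<^sub>F n in sequentially. dist (P n) P' < \<epsilon> / 2 \<and> dist (y n) y' < \<epsilon> / 2"
    by (intro eventually_conj tendstoD lim) auto
  then obtain n where n: "norm (P' - P n) < \<epsilon> / 2" "norm (y' - y n) < \<epsilon> / 2"
    by (auto simp: eventually_sequentially dist_norm norm_minus_commute)
  obtain Q z where h: "sd_span Q z" "norm2 (P n - Q) \<le> \<epsilon> / 2" "norm2 (y n - z) \<le> \<epsilon> / 2"
    using sd[of n] e unfolding sd_def by (metis half_gt_zero)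
  note M = sd_M[OF sd] sd_span_M[OF h(1)] PM yM
  have "norm2 (P' - Q) \<le> \<epsilon>"
    using norm2_triangle_diff[of P' "P n" Q] norm2_le_norm[of "P' - P n"] n h M by simp
  moreover have "norm2 (y' - z) \<le> \<epsilon>"
    using norm2_triangle_diff[of y' "y n" z] norm2_le_norm[of "y' - y n"] n h M by simp
  ultimately show "\<exists>Q z. sd_span Q z \<and> norm2 (P' - Q) \<le> \<epsilon> \<and> norm2 (y' - z) \<le> \<epsilon>"
    using h(1) by blast
qed

end

section \<open>The discrete Dyson equations\<close>

lemma contraction_limit:
  fixes e d :: "nat \<Rightarrow> real"
  assumes q: "0 \<le> q" "q < 1" and e0: "\<And>n. 0 \<le> e n"
    and rec: "\<And>n. e (Suc n) \<le> q * e n + d n" and d: "d \<longlonglongrightarrow> 0"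
  shows "e \<longlonglongrightarrow> 0"
proof (rule LIMSEQ_I)
  fix r :: real assume r: "r > 0"
  \<comment> \<open>Makes r/2 the fixed point of t \<mapsto> q t + s.\<close>
  define s where "s = r * (1 - q) / 2"
  have s: "s > 0" using r q by (simp add: s_def)
  obtain N where N: "\<And>n. n \<ge> N \<Longrightarrow> d n < s"
    using order_tendstoD(2)[OF d s] by (auto simp: eventually_sequentially)
  have bound: "e (N + k) \<le> q ^ k * e N + r / 2" for k
  proof (induction k)
    case 0
    show ?case using r by simp
  next
    case (Suc k)
    have "e (N + Suc k) \<le> q * e (N + k) + s" using rec[of "N + k"] N[of "N + k"] by simp
    also have "\<dots> \<le> q * (q ^ k * e N + r / 2) + s"
      using Suc q by (intro add_right_mono mult_left_mono) auto
    also have "\<dots> = q ^ Suc k * e N + r / 2" by (simp add: s_def field_simps)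
    finally show ?case .
  qed
  have "(\<lambda>k. q ^ k * e N) \<longlonglongrightarrow> 0"
    using q by (intro tendsto_mult_left_zero LIMSEQ_power_zero) simp
  then obtain K where K: "\<And>k. k \<ge> K \<Longrightarrow> q ^ k * e N < r / 2"
    using order_tendstoD(2)[of _ 0 sequentially "r / 2"] r by (force simp: eventually_sequentially)
  have "norm (e n - 0) < r" if "n \<ge> N + K" for n
  proof -
    have "K \<le> n - N" "N + (n - N) = n" using that by simp_all
    then show ?thesis using bound[of "n - N"] K[of "n - N"] e0[of n] by simp
  qed
  then show "\<exists>no. \<forall>n\<ge>no. norm (e n - 0) < r" by blast
qed

text \<open>Two contractions of the complete set M yield a left and a right inverse of 1 - K, which
  therefore coincide.\<close>

lemma (in tracial_algebra) Neumann_inverse: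
  assumes K: "K \<in> M" "norm K < 1"
  obtains Q where "Q \<in> M" "Q = id_blinfun + Q \<ast> K" "Q = id_blinfun + K \<ast> Q"
    "norm Q \<le> 1 / (1 - norm K)"
proof -
  have closed: "closed M"
    unfolding closed_sequential_limits using M_limit by blast
  note comp = complete_eq_closed[THEN iffD2, OF closed]
  have "\<exists>!Q. Q \<in> M \<and> id_blinfun + Q \<ast> K = Q"
  proof (rule Banach_fix[OF comp, of "norm K" "\<lambda>Q. id_blinfun + Q \<ast> K"])
    show "dist (id_blinfun + P \<ast> K) (id_blinfun + Q \<ast> K) \<le> norm K * dist P Q" for P Q
      using norm_blinfun_compose[of "P - Q" K] by (simp add: dist_norm compose_simps mult.commute)
  qed (use K M_id in auto)
  then obtain Q where Q: "Q \<in> M" "Q = id_blinfun + Q \<ast> K" by metis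
  have "\<exists>!Q. Q \<in> M \<and> id_blinfun + K \<ast> Q = Q"
  proof (rule Banach_fix[OF comp, of "norm K" "\<lambda>Q. id_blinfun + K \<ast> Q"])
    show "dist (id_blinfun + K \<ast> P) (id_blinfun + K \<ast> Q) \<le> norm K * dist P Q" for P Q
      using norm_blinfun_compose[of K "P - Q"] by (simp add: dist_norm compose_simps)
  qed (use K M_id in auto)
  then obtain Q' where Q': "Q' = id_blinfun + K \<ast> Q'" by metis
  have "Q \<ast> (id_blinfun - K) = id_blinfun" using Q(2) by (simp add: compose_simps diff_eq_eq)
  moreover have "(id_blinfun - K) \<ast> Q' = id_blinfun" using Q' by (simp add: compose_simps diff_eq_eq)
  ultimately have "Q = Q'" by (metis compose_assoc compose_id)
  have "norm Q \<le> norm (id_blinfun :: 'h bop) + norm (Q \<ast> K)"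
    using norm_triangle_ineq[of id_blinfun "Q \<ast> K"] Q(2) by simp
  also have "\<dots> \<le> 1 + norm Q * norm K" by (intro add_mono norm_blinfun_id_le norm_blinfun_compose)
  finally have "norm Q * (1 - norm K) \<le> 1" by (simp add: right_diff_distrib)
  then have "norm Q \<le> 1 / (1 - norm K)" using K(2) by (simp add: pos_le_divide_eq)
  then show thesis using that Q Q' \<open>Q = Q'\<close> by blast
qed

locale projection_grid = free_semicircular M \<tau> D X
  for M :: "'h::chilbert_space bop set" and \<tau> D X +
  fixes n :: nat and p :: "nat \<Rightarrow> 'h bop"
  assumes p_approx: "k < n \<Longrightarrow> approximable (p k)"
    and p_adj: "k < n \<Longrightarrow> adj (p k) = p k"
    and p_mult: "j < n \<Longrightarrow> k < n \<Longrightarrow> p j \<ast> p k = (if j = k then p k else 0)"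
begin

lemma p_M [simp]: "k < n \<Longrightarrow> p k \<in> M"
  using p_approx by (simp add: approximable_def)

section \<open>Triangular parts of X over the grid and their derivatives\<close>

definition psum :: "(nat \<Rightarrow> bool) \<Rightarrow> 'h bop" where
  "psum A = (\<Sum>k<n. if A k then p k else 0)"

lemma psum_M [simp]: "psum A \<in> M"
  unfolding psum_def by (rule M_sum) auto

lemma p_psum: "k < n \<Longrightarrow> p k \<ast> psum A = (if A k then p k else 0)"
proof -
  assume k: "k < n"
  have "p k \<ast> psum A = (\<Sum>j<n. if j = k then (if A k then p k else 0) else 0)"
    unfolding psum_def compose_simps using k by (intro sum.cong) (auto simp: p_mult)
  then show ?thesis using k by simp
qed

text \<open>R stays general because T_N belongs to (<) and its adjoint to the converse relation;
  exchanging them gives the second half of the Dyson system from the same lemmas.\<close>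

definition tri :: "(nat \<Rightarrow> nat \<Rightarrow> bool) \<Rightarrow> 'h bop" where
  "tri R = (\<Sum>j<n. \<Sum>k<n. if R j k then p j \<ast> X \<ast> p k else 0)"

lemma tri_M [simp]: "tri R \<in> M"
  unfolding tri_def by (intro M_sum) (auto simp: X_in_M)

lemma p_tri: "k < n \<Longrightarrow> p k \<ast> tri R = (\<Sum>m<n. if R k m then p k \<ast> X \<ast> p m else 0)"
proof -
  assume k: "k < n"
  have "p k \<ast> tri R = (\<Sum>j<n. if j = k then (\<Sum>m<n. if R k m then p k \<ast> X \<ast> p m else 0) else 0)"
    unfolding tri_def compose_simps(9)
  proof (intro sum.cong refl)
    fix j assume j: "j \<in> {..<n}"
    have "p k \<ast> (if R j m then p j \<ast> X \<ast> p m else 0) =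
        (if j = k then (if R k m then p k \<ast> X \<ast> p m else 0) else 0)" for m
      using p_mult[OF k, of j] j by (auto simp flip: compose_assoc)
    then show "(\<Sum>m<n. p k \<ast> (if R j m then p j \<ast> X \<ast> p m else 0)) =
        (if j = k then (\<Sum>m<n. if R k m then p k \<ast> X \<ast> p m else 0) else 0)" by simp
  qed
  then show ?thesis using k by simp
qed

lemma tau_p_p: "j < n \<Longrightarrow> m < n \<Longrightarrow> a \<in> M \<Longrightarrow> \<tau> (p m \<ast> a \<ast> p j) = (if j = m then \<tau> (p m \<ast> a) else 0)"
  using tau_trace[of "p m \<ast> a" "p j"] p_mult[of j m]
  by (auto simp: tau_zero simp flip: compose_assoc)

lemma sd_times_tri:
  assumes sd: "sd P y"
  shows "sd (P \<ast> tri R) (y \<ast> tri R + (\<Sum>j<n. \<Sum>k<n. if R j k then \<tau> (P \<ast> p j) \<odot> p k else 0))"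
proof -
  have "sd (if R j k then P \<ast> p j \<ast> X \<ast> p k else 0)
      (if R j k then y \<ast> p j \<ast> X \<ast> p k + \<tau> (P \<ast> p j) \<odot> p k else 0)" if "j < n" "k < n" for j k
    using sd_times_approximable[OF sd_times_X[OF sd_times_approximable[OF sd p_approx[OF that(1)]]]
        p_approx[OF that(2)]] sd_scale[OF sd_id, of 0] by (auto simp: compose_simps)
  then have "sd (\<Sum>j<n. \<Sum>k<n. if R j k then P \<ast> p j \<ast> X \<ast> p k else 0)
      (\<Sum>j<n. \<Sum>k<n. if R j k then y \<ast> p j \<ast> X \<ast> p k + \<tau> (P \<ast> p j) \<odot> p k else 0)"
    by (intro sd_sum) auto
  moreover have "(\<Sum>j<n. \<Sum>k<n. if R j k then P \<ast> p j \<ast> X \<ast> p k else 0) = P \<ast> tri R"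
    unfolding tri_def by (auto simp: compose_simps intro!: sum.cong)
  moreover have "(\<Sum>j<n. \<Sum>k<n. if R j k then y \<ast> p j \<ast> X \<ast> p k + \<tau> (P \<ast> p j) \<odot> p k else 0) =
      y \<ast> tri R + (\<Sum>j<n. \<Sum>k<n. if R j k then \<tau> (P \<ast> p j) \<odot> p k else 0)"
    unfolding tri_def
    by (simp add: compose_simps flip: sum.distrib) (auto simp: compose_simps intro!: sum.cong)
  ultimately show ?thesis by simp
qed

text \<open>The projection p_m in front leaves the row j = m of the triangle: by the trace property
  \<tau>(p_m a p_j) = 0 for j \<noteq> m.\<close>

lemma sd_p_times_tri:
  assumes sd: "sd (p m \<ast> a) y" and m: "m < n" and a: "a \<in> M"
  shows "sd (p m \<ast> a \<ast> (tri R - scalar_op c))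
    (y \<ast> (tri R - scalar_op c) + \<tau> (p m \<ast> a) \<odot> psum (R m))"
proof -
  have "(\<Sum>j<n. \<Sum>k<n. if R j k then \<tau> (p m \<ast> a \<ast> p j) \<odot> p k else 0) =
      (\<Sum>j<n. if j = m then \<Sum>k<n. if R m k then \<tau> (p m \<ast> a) \<odot> p k else 0 else 0)"
  proof (intro sum.cong refl)
    fix j assume j: "j \<in> {..<n}"
    have "(if R j k then \<tau> (p m \<ast> a \<ast> p j) \<odot> p k else 0) =
        (if j = m then (if R m k then \<tau> (p m \<ast> a) \<odot> p k else 0) else 0)" for k
      using tau_p_p[OF _ m a, of j] j by auto
    then show "(\<Sum>k<n. if R j k then \<tau> (p m \<ast> a \<ast> p j) \<odot> p k else 0) =
        (if j = m then \<Sum>k<n. if R m k then \<tau> (p m \<ast> a) \<odot> p k else 0 else 0)" by simp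
  qed
  also have "\<dots> = \<tau> (p m \<ast> a) \<odot> psum (R m)"
    using m by (auto simp: psum_def compose_simps intro!: sum.cong)
  finally have s: "(\<Sum>j<n. \<Sum>k<n. if R j k then \<tau> (p m \<ast> a \<ast> p j) \<odot> p k else 0) =
      \<tau> (p m \<ast> a) \<odot> psum (R m)" .
  have "sd (p m \<ast> a \<ast> tri R + (- c) \<odot> (p m \<ast> a))
      (y \<ast> tri R + \<tau> (p m \<ast> a) \<odot> psum (R m) + (- c) \<odot> y)"
    using sd_add[OF sd_times_tri[OF sd, of R] sd_scale[OF sd, of "- c"]] unfolding s .
  moreover have "u \<ast> (tri R - scalar_op c) = u \<ast> tri R + (- c) \<odot> u" if "u \<in> M" for u
    using scalar_op_commute[OF M_clinear[OF that], of c] by (simp add: compose_simps scalar_op_minus)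
  ultimately show ?thesis using sd_M[OF sd] by (simp add: add_ac)
qed

text \<open>Formally, differentiating P = p_m + P K gives Y = Y K + z w, which is solved by Y = z w
  Q. To make this rigorous the iterates of U \<mapsto> 1 + U K are differentiated exactly; they and
  their derivatives converge by \<open>contraction_limit\<close>, and \<open>sd\<close> is
  closed.\<close>

lemma sd_resolvent:
  fixes l l' z :: complex
  assumes asym: "\<And>j k. R j k \<Longrightarrow> \<not> R k j"
  defines "S \<equiv> tri R - scalar_op l" and "S' \<equiv> tri (\<lambda>j k. R k j) - scalar_op l'"
  assumes contr: "norm (z \<odot> (S' \<ast> S)) < 1"
    and Q: "Q \<in> M" "Q = id_blinfun + Q \<ast> (z \<odot> (S' \<ast> S))"
    and m: "m < n"
  shows "sd (p m \<ast> Q) (z \<odot> ((\<tau> (p m \<ast> Q) \<odot> psum (\<lambda>k. R k m) \<ast> S + \<tau> (p m \<ast> Q \<ast> S') \<odot> psum (R m)) \<ast> Q))"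
proof -
  have SM: "S \<in> M" "S' \<in> M" by (simp_all add: S_def S'_def)
  define K where "K = z \<odot> (S' \<ast> S)"
  have K: "K \<in> M" "norm K < 1" using SM contr by (simp_all add: K_def)
  \<comment> \<open>In p_m U S' S, the derivative of S' gives the first term and that of S the
    second.\<close>
  define w where "w U = \<tau> (p m \<ast> U) \<odot> psum (\<lambda>k. R k m) \<ast> S + \<tau> (p m \<ast> U \<ast> S') \<odot> psum (R m)" for U
  define q :: "nat \<Rightarrow> 'h bop" where "q = rec_nat id_blinfun (\<lambda>_ u. id_blinfun + u \<ast> K)"
  define Y where "Y = rec_nat 0 (\<lambda>i u. u \<ast> K + z \<odot> w (q i))"
  have q_simps: "q 0 = id_blinfun" "q (Suc i) = id_blinfun + q i \<ast> K"
    and Y_simps: "Y 0 = 0" "Y (Suc i) = Y i \<ast> K + z \<odot> w (q i)" for i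
    by (simp_all add: q_def Y_def)
  have qM: "q i \<in> M" for i by (induction i) (simp_all add: q_simps K)
  have sdp: "sd (p m) 0"
    using sd_times_approximable[OF sd_id p_approx[OF m]] by simp
  have sd: "sd (p m \<ast> q i) (Y i)" for i
  proof (induction i)
    case 0
    show ?case using sdp by (simp add: q_simps Y_simps)
  next
    case (Suc i)
    let ?P = "p m \<ast> q i"
    have "sd (?P \<ast> S') (Y i \<ast> S' + \<tau> ?P \<odot> psum (\<lambda>k. R k m))"
      unfolding S'_def by (rule sd_p_times_tri[OF Suc m qM])
    then have "sd (p m \<ast> (q i \<ast> S')) (Y i \<ast> S' + \<tau> ?P \<odot> psum (\<lambda>k. R k m))"
      by (simp only: compose_assoc)
    from sd_p_times_tri[OF this m, of R l]
    have "sd (p m \<ast> (q i \<ast> S') \<ast> S)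
        ((Y i \<ast> S' + \<tau> ?P \<odot> psum (\<lambda>k. R k m)) \<ast> S + \<tau> (p m \<ast> (q i \<ast> S')) \<odot> psum (R m))"
      using qM SM by (simp add: S_def)
    from sd_add[OF sdp sd_scale[OF this, of z]]
    have "sd (p m + z \<odot> (p m \<ast> (q i \<ast> S') \<ast> S))
      (z \<odot> ((Y i \<ast> S' + \<tau> ?P \<odot> psum (\<lambda>k. R k m)) \<ast> S + \<tau> (p m \<ast> (q i \<ast> S')) \<odot> psum (R m)))"
      by simp
    moreover have "p m + z \<odot> (p m \<ast> (q i \<ast> S') \<ast> S) = p m \<ast> q (Suc i)"
      using scalar_op_commute_left[OF M_clinear[OF qM[of i]]] scalar_op_commute_left[OF M_clinear[OF p_M[OF m]]]
      by (simp add: q_simps K_def compose_simps)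
    moreover have "z \<odot> ((Y i \<ast> S' + \<tau> ?P \<odot> psum (\<lambda>k. R k m)) \<ast> S + \<tau> (p m \<ast> (q i \<ast> S')) \<odot> psum (R m)) = Y (Suc i)"
      using scalar_op_commute_left[OF M_clinear[OF sd_M(2)[OF Suc]]]
      by (simp add: Y_simps K_def w_def compose_simps add_ac)
    ultimately show ?case by simp
  qed
  have e_q: "(\<lambda>i. norm (q i - Q)) \<longlonglongrightarrow> 0"
  proof (rule contraction_limit[where q = "norm K" and d = "\<lambda>_. 0"])
    fix i
    have "q (Suc i) - Q = (q i - Q) \<ast> K"
      using Q(2) by (simp add: q_simps compose_simps K_def algebra_simps)
    then show "norm (q (Suc i) - Q) \<le> norm K * norm (q i - Q) + 0"
      using norm_blinfun_compose[of "q i - Q" K] by (simp add: mult.commute)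
  qed (use K in auto)
  then have q_lim: "q \<longlonglongrightarrow> Q" by (simp add: tendsto_norm_zero_iff LIM_zero_iff)
  have w_lim: "(\<lambda>i. w (q i)) \<longlonglongrightarrow> w Q"
  proof -
    have scal: "(\<lambda>i. \<tau> (f i) \<odot> b) \<longlonglongrightarrow> \<tau> a \<odot> b"
      if "\<And>i. f i \<in> M" "f \<longlonglongrightarrow> a" for f a and b :: "'h bop"
    proof -
      have aM: "a \<in> M" using that M_limit by blast
      have "(\<lambda>i. \<tau> (f i) \<odot> b - \<tau> a \<odot> b) \<longlonglongrightarrow> 0"
      proof (rule Lim_null_comparison)
        have "norm (\<tau> (f i) \<odot> b - \<tau> a \<odot> b) \<le> cmod (\<tau> (f i) - \<tau> a) * norm b" for i
          using norm_scalar_op_compose[of "\<tau> (f i) - \<tau> a" b] by (simp add: scalar_op_diff compose_simps)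
        then show "\<forall>\<^sub>F i in sequentially. norm (\<tau> (f i) \<odot> b - \<tau> a \<odot> b) \<le> cmod (\<tau> (f i) - \<tau> a) * norm b"
          by simp
        show "(\<lambda>i. cmod (\<tau> (f i) - \<tau> a) * norm b) \<longlonglongrightarrow> 0"
          using tau_tendsto[OF that] by (intro tendsto_mult_left_zero tendsto_norm_zero LIM_zero)
      qed
      then show ?thesis by (rule LIM_zero_cancel)
    qed
    show ?thesis unfolding w_def
      by (intro tendsto_add tendsto_compose_op[OF scal tendsto_const] scal tendsto_compose_op
          tendsto_const q_lim) (use qM SM m in auto)
  qed
  define Y' where "Y' = z \<odot> (w Q \<ast> Q)"
  have Y'_eq: "Y' = Y' \<ast> K + z \<odot> w Q"
  proof -
    have QK: "id_blinfun + Q \<ast> K = Q" using Q(2) by (simp add: K_def)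
    have "Y' \<ast> K + z \<odot> w Q = z \<odot> (w Q \<ast> (id_blinfun + Q \<ast> K))"
      unfolding Y'_def by (simp add: compose_simps add.commute)
    then show ?thesis by (simp only: QK Y'_def)
  qed
  have "(\<lambda>i. norm (Y i - Y')) \<longlonglongrightarrow> 0"
  proof (rule contraction_limit[where q = "norm K" and d = "\<lambda>i. cmod z * norm (w (q i) - w Q)"])
    fix i
    have "Y (Suc i) - Y' = (Y i - Y') \<ast> K + z \<odot> (w (q i) - w Q)"
      using Y'_eq by (simp add: Y_simps compose_simps algebra_simps)
    then show "norm (Y (Suc i) - Y') \<le> norm K * norm (Y i - Y') + cmod z * norm (w (q i) - w Q)"
      using norm_triangle_ineq[of "(Y i - Y') \<ast> K" "z \<odot> (w (q i) - w Q)"]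
        norm_blinfun_compose[of "Y i - Y'" K] norm_scalar_op_compose[of z "w (q i) - w Q"]
      by (simp add: mult.commute)
    show "(\<lambda>i. cmod z * norm (w (q i) - w Q)) \<longlonglongrightarrow> 0"
      using w_lim by (intro tendsto_mult_right_zero tendsto_norm_zero LIM_zero)
  qed (use K in auto)
  then have Y_lim: "Y \<longlonglongrightarrow> Y'" by (simp add: tendsto_norm_zero_iff LIM_zero_iff)
  have "sd (p m \<ast> Q) Y'"
    by (rule sd_limit[OF sd _ Y_lim]) (intro tendsto_compose_op tendsto_const q_lim)
  then show ?thesis by (simp add: Y'_def w_def)
qed

lemma tau_p_psum:
  assumes "k < n" "a \<in> M" "b \<in> M"
  shows "\<tau> (psum A \<ast> a \<ast> b \<ast> p k) = (if A k then \<tau> (p k \<ast> a \<ast> b) else 0)"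
proof -
  have "\<tau> (psum A \<ast> a \<ast> b \<ast> p k) = \<tau> ((p k \<ast> psum A) \<ast> a \<ast> b)"
    using assms tau_trace[of "psum A \<ast> a \<ast> b" "p k"] by (simp add: compose_assoc)
  then show ?thesis using assms by (simp add: p_psum tau_zero)
qed

text \<open>A factor p_k S or p_k S' is expanded into blocks p_k X p_m and a scalar part, X is
  rotated to the front under the trace, and \<open>Schwinger_Dyson\<close> is applied. The
  derivative terms become products of scalars, and asymmetry of R removes the one that would leave
  the system.\<close>

proposition Dyson_equations:
  fixes l l' z :: complex
  assumes asym: "\<And>j k. R j k \<Longrightarrow> \<not> R k j"
  defines "S \<equiv> tri R - scalar_op l" and "S' \<equiv> tri (\<lambda>j k. R k j) - scalar_op l'"
  assumes contr: "norm (z \<odot> (S' \<ast> S)) < 1" and contr': "norm (z \<odot> (S \<ast> S')) < 1"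
    and Q: "Q \<in> M" "Q = id_blinfun + Q \<ast> (z \<odot> (S' \<ast> S))" "Q = id_blinfun + (z \<odot> (S' \<ast> S)) \<ast> Q"
    and Q': "Q' \<in> M" "Q' = id_blinfun + Q' \<ast> (z \<odot> (S \<ast> S'))" "Q' = id_blinfun + (z \<odot> (S \<ast> S')) \<ast> Q'"
    and k: "k < n"
  shows "\<tau> (p k \<ast> S \<ast> Q) = - l * \<tau> (p k \<ast> Q)
      + z * (\<Sum>m<n. if R k m then \<tau> (p m \<ast> Q) else 0) * \<tau> (p k \<ast> S \<ast> Q)"
    and "\<tau> (p k \<ast> Q) = \<tau> (p k) - z * l' * \<tau> (p k \<ast> S \<ast> Q)
      + z * (\<Sum>m<n. if R m k then \<tau> (p m \<ast> Q') else 0) * \<tau> (p k \<ast> Q)"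
proof -
  have SM: "S \<in> M" "S' \<in> M" by (simp_all add: S_def S'_def)
  note M = SM Q(1) Q'(1) X_in_M p_M[OF k]
  have zl: "u \<ast> (z \<odot> v) = z \<odot> (u \<ast> v)" if "u \<in> M" for u v
    using that by (intro scalar_op_commute_left) simp
  \<comment> \<open>Lets S Q be differentiated as Q' S, which begins with a resolvent and is thus
    covered by \<open>sd_resolvent\<close>.\<close>
  have SQ: "S \<ast> Q = Q' \<ast> S"
  proof -
    have "(id_blinfun - z \<odot> (S \<ast> S')) \<ast> S = S \<ast> (id_blinfun - z \<odot> (S' \<ast> S))"
      using SM by (simp add: compose_simps zl)
    moreover have "(id_blinfun - z \<odot> (S' \<ast> S)) \<ast> Q = id_blinfun"
      using Q(3) by (simp add: compose_simps diff_eq_eq)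
    moreover have "Q' \<ast> (id_blinfun - z \<odot> (S \<ast> S')) = id_blinfun"
      using Q'(2) by (simp add: compose_simps diff_eq_eq)
    ultimately show ?thesis by (metis compose_assoc compose_id)
  qed
  have p_T: "\<tau> (p k \<ast> (tri R' - scalar_op c) \<ast> a) =
      - c * \<tau> (p k \<ast> a) + (\<Sum>m<n. if R' k m then \<tau> (X \<ast> (p m \<ast> a \<ast> p k)) else 0)"
    if a: "a \<in> M" for R' c a
  proof -
    have "p k \<ast> (tri R' - scalar_op c) \<ast> a = p k \<ast> tri R' \<ast> a - c \<odot> (p k \<ast> a)"
      using scalar_op_commute[OF M_clinear[OF p_M[OF k]], of c]
      by (simp add: compose_simps flip: compose_assoc)
    moreover have "p k \<ast> tri R' \<ast> a = (\<Sum>m<n. if R' k m then p k \<ast> X \<ast> p m \<ast> a else 0)"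
      unfolding p_tri[OF k] by (auto simp: compose_simps intro!: sum.cong)
    moreover have "\<tau> (\<Sum>m<n. if R' k m then p k \<ast> X \<ast> p m \<ast> a else 0) =
        (\<Sum>m<n. if R' k m then \<tau> (X \<ast> (p m \<ast> a \<ast> p k)) else 0)"
    proof (subst tau_sum)
      have "\<tau> (p k \<ast> X \<ast> p m \<ast> a) = \<tau> (X \<ast> (p m \<ast> a \<ast> p k))" if "m < n" for m
        using tau_trace[of "p k" "X \<ast> p m \<ast> a"] a M that by (simp add: compose_assoc)
      then show "(\<Sum>m<n. \<tau> (if R' k m then p k \<ast> X \<ast> p m \<ast> a else 0)) =
          (\<Sum>m<n. if R' k m then \<tau> (X \<ast> (p m \<ast> a \<ast> p k)) else 0)"
        by (auto simp: tau_zero intro!: sum.cong)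
    qed (use M a in auto)
    moreover have "p k \<ast> tri R' \<ast> a \<in> M" "p k \<ast> a \<in> M" using M a by simp_all
    ultimately show ?thesis by (simp add: tau_diff tau_scale)
  qed
  \<comment> \<open>From R k m the projection p_k survives in the first sum of the derivative, while
    the second would require R m k.\<close>
  have c1: "\<tau> (X \<ast> (p m \<ast> Q \<ast> p k)) = z * \<tau> (p m \<ast> Q) * \<tau> (p k \<ast> S \<ast> Q)"
    if m: "m < n" and R: "R k m" for m
  proof -
    let ?w = "\<tau> (p m \<ast> Q) \<odot> psum (\<lambda>k. R k m) \<ast> S + \<tau> (p m \<ast> Q \<ast> S') \<odot> psum (R m)"
    have "sd (p m \<ast> Q) (z \<odot> (?w \<ast> Q))"
      using sd_resolvent[OF asym contr[unfolded S_def S'_def] Q(1) Q(2)[unfolded S_def S'_def] m]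
      unfolding S_def S'_def by blast
    from Schwinger_Dyson[OF sd_times_approximable[OF this p_approx[OF k]]]
    have "\<tau> (X \<ast> (p m \<ast> Q \<ast> p k)) = \<tau> (z \<odot> (\<tau> (p m \<ast> Q) \<odot> (psum (\<lambda>k. R k m) \<ast> S \<ast> Q \<ast> p k)
        + \<tau> (p m \<ast> Q \<ast> S') \<odot> (psum (R m) \<ast> id_blinfun \<ast> Q \<ast> p k)))"
      by (simp add: compose_simps)
    also have "\<dots> = z * (\<tau> (p m \<ast> Q) * \<tau> (p k \<ast> S \<ast> Q))"
      using M asym[OF R] R k by (simp add: tau_scale tau_add tau_p_psum del: compose_id)
    finally show ?thesis by simp
  qed
  show "\<tau> (p k \<ast> S \<ast> Q) = - l * \<tau> (p k \<ast> Q)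
      + z * (\<Sum>m<n. if R k m then \<tau> (p m \<ast> Q) else 0) * \<tau> (p k \<ast> S \<ast> Q)"
  proof -
    have "(\<Sum>m<n. if R k m then \<tau> (X \<ast> (p m \<ast> Q \<ast> p k)) else 0) =
        z * (\<Sum>m<n. if R k m then \<tau> (p m \<ast> Q) else 0) * \<tau> (p k \<ast> S \<ast> Q)"
      unfolding sum_distrib_left sum_distrib_right by (intro sum.cong) (auto simp: c1)
    then show ?thesis using p_T[OF Q(1), of R l] by (simp add: S_def)
  qed
  \<comment> \<open>Now R m k holds and the sum over R m survives. It occurs twice, from S' inside
    Q' and from the final S; the two contributions recombine through Q = 1 + z S' S Q.\<close>
  have c2: "\<tau> (X \<ast> (p m \<ast> (S \<ast> Q) \<ast> p k)) = \<tau> (p m \<ast> Q') * \<tau> (p k \<ast> Q)"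
    if m: "m < n" and R: "R m k" for m
  proof -
    let ?w = "\<tau> (p m \<ast> Q') \<odot> psum (R m) \<ast> S' + \<tau> (p m \<ast> Q' \<ast> S) \<odot> psum (\<lambda>k. R k m)"
    have "sd (p m \<ast> Q') (z \<odot> (?w \<ast> Q'))"
      using sd_resolvent[of "\<lambda>j k. R k j", OF _ contr'[unfolded S_def S'_def] Q'(1)
          Q'(2)[unfolded S_def S'_def] m] asym
      unfolding S_def S'_def by blast
    from sd_p_times_tri[OF this m Q'(1), of R l]
    have "sd (p m \<ast> Q' \<ast> S) (z \<odot> (?w \<ast> Q') \<ast> S + \<tau> (p m \<ast> Q') \<odot> psum (R m))"
      by (simp add: S_def)
    from Schwinger_Dyson[OF sd_times_approximable[OF this p_approx[OF k]]]
    have "\<tau> (X \<ast> (p m \<ast> Q' \<ast> S \<ast> p k)) = \<tau> (z \<odot> (\<tau> (p m \<ast> Q') \<odot> (psum (R m) \<ast> S' \<ast> (Q' \<ast> S) \<ast> p k)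
        + \<tau> (p m \<ast> Q' \<ast> S) \<odot> (psum (\<lambda>k. R k m) \<ast> id_blinfun \<ast> (Q' \<ast> S) \<ast> p k))
        + \<tau> (p m \<ast> Q') \<odot> (psum (R m) \<ast> id_blinfun \<ast> id_blinfun \<ast> p k))"
      by (simp only: compose_simps compose_id)
    also have "\<dots> = z * (\<tau> (p m \<ast> Q') * \<tau> (p k \<ast> S' \<ast> (Q' \<ast> S))) + \<tau> (p m \<ast> Q') * \<tau> (p k)"
      using M asym[OF R] R k by (simp add: tau_scale tau_add tau_p_psum del: compose_id) simp
    also have "\<dots> = \<tau> (p m \<ast> Q') * \<tau> (p k \<ast> (id_blinfun + (z \<odot> (S' \<ast> S)) \<ast> Q))"
    proof -
      have "p k \<ast> (id_blinfun + (z \<odot> (S' \<ast> S)) \<ast> Q) = p k + z \<odot> (p k \<ast> S' \<ast> (Q' \<ast> S))"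
        using M by (simp add: compose_simps zl SQ[symmetric])
      then show ?thesis using M by (simp add: tau_add tau_scale algebra_simps)
    qed
    also have "id_blinfun + (z \<odot> (S' \<ast> S)) \<ast> Q = Q" using Q(3) by simp
    finally show ?thesis by (simp add: SQ compose_assoc)
  qed
  have "\<tau> (p k \<ast> Q) = \<tau> (p k) + z * \<tau> (p k \<ast> S' \<ast> (S \<ast> Q))"
  proof -
    have "p k \<ast> Q = p k + z \<odot> (p k \<ast> S' \<ast> (S \<ast> Q))"
      using arg_cong[OF Q(3), of "\<lambda>u. p k \<ast> u"] M by (simp add: compose_simps zl)
    then show ?thesis using M by (metis M_compose M_scalar_op tau_add tau_scale)
  qed
  also have "\<tau> (p k \<ast> S' \<ast> (S \<ast> Q)) = - l' * \<tau> (p k \<ast> S \<ast> Q)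
      + (\<Sum>m<n. if R m k then \<tau> (X \<ast> (p m \<ast> (S \<ast> Q) \<ast> p k)) else 0)"
    using p_T[of "S \<ast> Q" "\<lambda>j k. R k j" l'] M by (simp add: S'_def compose_assoc)
  also have "(\<Sum>m<n. if R m k then \<tau> (X \<ast> (p m \<ast> (S \<ast> Q) \<ast> p k)) else 0) =
      (\<Sum>m<n. if R m k then \<tau> (p m \<ast> Q') else 0) * \<tau> (p k \<ast> Q)"
    unfolding sum_distrib_right by (intro sum.cong) (auto simp: c2)
  finally show "\<tau> (p k \<ast> Q) = \<tau> (p k) - z * l' * \<tau> (p k \<ast> S \<ast> Q)
      + z * (\<Sum>m<n. if R m k then \<tau> (p m \<ast> Q') else 0) * \<tau> (p k \<ast> Q)"
    by (simp add: algebra_simps)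
qed

text \<open>The factor \<tau>(p_k) supplies the decay 1/n that keeps sums over the grid bounded
  independently of n.\<close>

lemma tau_p_bound:
  assumes "k < n" "a \<in> M" shows "cmod (\<tau> (p k \<ast> a)) \<le> norm a * Re (\<tau> (p k))"
proof -
  have "\<tau> (p k \<ast> a) = \<tau> (adj (p k) \<ast> (a \<ast> p k))"
    using assms tau_trace[of "p k" "a \<ast> p k"] tau_trace[of "a" "p k"]
    by (simp add: p_adj p_mult compose_assoc)
  also have "cmod \<dots> \<le> norm2 (p k) * norm2 (a \<ast> p k)"
    using assms by (intro Cauchy_Schwarz_tau) auto
  also have "\<dots> \<le> norm2 (p k) * (norm a * norm2 (p k))"
    using assms by (intro mult_left_mono norm2_compose_left norm2_nonneg) auto
  also have "\<dots> = norm a * (norm2 (p k))\<^sup>2" by (simp add: power2_eq_square)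
  also have "(norm2 (p k))\<^sup>2 = Re (\<tau> (p k))" using assms by (simp add: norm2_sq p_adj p_mult)
  finally show ?thesis .
qed

end

section \<open>Solution of the Dyson equations\<close>

text \<open>Eliminating c from the first pair of equations and b from the second gives a_k
  \<Delta>_k = B_(k+1)/n and d_k \<Delta>_k = A_k/n. This is why A and B are multiplied by the same
  factor, in opposite directions.\<close>

lemma discrete_Dyson_solution:
  fixes a b c d :: "nat \<Rightarrow> complex" and l l' z :: complex and n :: nat and K :: real
  assumes n: "n > 0"
    and c: "\<And>k. k < n \<Longrightarrow> c k = - l * a k + z * (\<Sum>m<n. if k < m then a m else 0) * c k"
    and a: "\<And>k. k < n \<Longrightarrow> a k = 1 / of_nat n - z * l' * c k + z * (\<Sum>m<n. if m < k then d m else 0) * a k"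
    and b: "\<And>k. k < n \<Longrightarrow> b k = - l' * d k + z * (\<Sum>m<n. if m < k then d m else 0) * b k"
    and d: "\<And>k. k < n \<Longrightarrow> d k = 1 / of_nat n - z * l * b k + z * (\<Sum>m<n. if k < m then a m else 0) * d k"
    and bounds: "\<And>k. k < n \<Longrightarrow> cmod (a k) \<le> K / n" "\<And>k. k < n \<Longrightarrow> cmod (d k) \<le> K / n"
    and small: "cmod z * K \<le> 1/8" "cmod (z * (l * l')) \<le> 1/8" "cmod z \<le> 1/8"
  obtains \<Delta> where "cmod (\<Delta> - 1) \<le> 1/2"
    and "1 - z * (\<Sum>k<n. a k) = (1 - z / of_nat n / \<Delta>) ^ n"
    and "(\<Delta> + z * (l * l')) * (1 - z / of_nat n / \<Delta>) = 1 - z * (\<Sum>k<n. a k)"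
proof -
  define h where "h = z / of_nat n"
  \<comment> \<open>A sums indices strictly below k and B those from k on, so the equations at k
    involve A k and B (Suc k), and B 0 carries the full trace.\<close>
  define A where "A k = 1 - z * (\<Sum>m<k. d m)" for k
  define B where "B k = 1 - z * (\<Sum>m\<in>{k..<n}. a m)" for k
  define \<Delta> where "\<Delta> k = A k * B (Suc k) - z * (l * l')" for k
  have K0: "0 \<le> K"
    using order_trans[OF norm_ge_zero bounds(1)[OF n]] n by (simp add: zero_le_divide_iff)
  have sum_bound: "cmod (z * sum f I) \<le> 1/8"
    if "I \<subseteq> {..<n}" "\<And>k. k < n \<Longrightarrow> cmod (f k) \<le> K / n" for f and I :: "nat set"
  proof -
    have "cmod (sum f I) \<le> (\<Sum>k\<in>I. K / n)" by (rule sum_norm_le) (use that in auto)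
    also have "\<dots> \<le> (\<Sum>k<n. K / n)" using that(1) K0 by (intro sum_mono2) auto
    also have "\<dots> = K" using n by simp
    finally have "cmod z * cmod (sum f I) \<le> cmod z * K" by (rule mult_left_mono) simp
    then show ?thesis using small(1) by (simp add: norm_mult)
  qed
  have A1: "cmod (A k - 1) \<le> 1/8" if "k \<le> n" for k
    using sum_bound[of "{..<k}" d] bounds that by (auto simp: A_def)
  have B1: "cmod (B k - 1) \<le> 1/8" for k
  proof -
    have "{k..<n} \<subseteq> {..<n}" by auto
    then show ?thesis using sum_bound[of "{k..<n}" a] bounds(1) by (simp add: B_def)
  qed
  \<comment> \<open>Three errors of 1/8 and one product of 1/64 stay below 1/2, so each \<Delta> k
    has modulus at least 1/2.\<close>
  have \<Delta>1: "cmod (\<Delta> k - 1) \<le> 1/2" if "k < n" for k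
  proof -
    have "\<Delta> k - 1 = (A k - 1) * (B (Suc k) - 1) + (A k - 1) + (B (Suc k) - 1) - z * (l * l')"
      by (simp add: \<Delta>_def algebra_simps)
    also have "cmod \<dots> \<le> cmod (A k - 1) * cmod (B (Suc k) - 1) + cmod (A k - 1)
        + cmod (B (Suc k) - 1) + cmod (z * (l * l'))"
      by (intro norm_triangle_le_diff norm_triangle_le add_mono order_refl) (simp add: norm_mult)
    also have "\<dots> \<le> 1/8 * (1/8) + 1/8 + 1/8 + 1/8"
      using that by (intro add_mono mult_mono A1 B1 small) auto
    finally show ?thesis by simp
  qed
  have \<Delta>_ge: "1/2 \<le> cmod (\<Delta> k)" if "k < n" for k
    using \<Delta>1[OF that] norm_triangle_ineq2[of 1 "1 - \<Delta> k"] by (simp add: norm_minus_commute)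
  then have \<Delta>0: "\<Delta> k \<noteq> 0" if "k < n" for k using that by fastforce
  have sumA: "z * (\<Sum>m<n. if m < k then d m else 0) = 1 - A k" if "k < n" for k
  proof -
    have "(\<Sum>m<n. if m < k then d m else 0) = (\<Sum>m<k. d m)"
      using that by (intro sum.mono_neutral_cong_right) auto
    then show ?thesis by (simp add: A_def)
  qed
  have sumB: "z * (\<Sum>m<n. if k < m then a m else 0) = 1 - B (Suc k)" if "k < n" for k
  proof -
    have "(\<Sum>m<n. if k < m then a m else 0) = (\<Sum>m\<in>{Suc k..<n}. a m)"
      by (intro sum.mono_neutral_cong_right) auto
    then show ?thesis by (simp add: B_def)
  qed
  have a\<Delta>: "a k * \<Delta> k = B (Suc k) / of_nat n" if k: "k < n" for k
  proof -
    have 1: "c k * B (Suc k) = - l * a k" using c[OF k] unfolding sumB[OF k] by algebra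
    have 2: "a k * A k = 1 / of_nat n - z * l' * c k" using a[OF k] unfolding sumA[OF k] by algebra
    have "a k * \<Delta> k = (a k * A k) * B (Suc k) - z * (l * l') * a k"
      by (simp add: \<Delta>_def algebra_simps)
    also have "\<dots> = B (Suc k) / of_nat n - z * l' * (c k * B (Suc k)) - z * (l * l') * a k"
      unfolding 2 by (simp add: algebra_simps)
    finally show ?thesis unfolding 1 by (simp add: algebra_simps)
  qed
  have d\<Delta>: "d k * \<Delta> k = A k / of_nat n" if k: "k < n" for k
  proof -
    have 1: "b k * A k = - l' * d k" using b[OF k] unfolding sumA[OF k] by algebra
    have 2: "d k * B (Suc k) = 1 / of_nat n - z * l * b k" using d[OF k] unfolding sumB[OF k] by algebra
    have "d k * \<Delta> k = (d k * B (Suc k)) * A k - z * (l * l') * d k"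
      by (simp add: \<Delta>_def algebra_simps)
    also have "\<dots> = A k / of_nat n - z * l * (b k * A k) - z * (l * l') * d k"
      unfolding 2 by (simp add: algebra_simps)
    finally show ?thesis unfolding 1 by (simp add: algebra_simps)
  qed
  have A_Suc: "A (Suc k) = A k * (1 - h / \<Delta> k)" if k: "k < n" for k
  proof -
    have "d k = A k / of_nat n / \<Delta> k" using arg_cong[OF d\<Delta>[OF k], of "\<lambda>x. x / \<Delta> k"] \<Delta>0[OF k] by simp
    then have "A (Suc k) = A k - z * (A k / of_nat n / \<Delta> k)" by (simp add: A_def algebra_simps)
    then show ?thesis by (simp add: h_def algebra_simps)
  qed
  have B_Suc: "B k = B (Suc k) * (1 - h / \<Delta> k)" if k: "k < n" for k
  proof -
    have "a k = B (Suc k) / of_nat n / \<Delta> k" using arg_cong[OF a\<Delta>[OF k], of "\<lambda>x. x / \<Delta> k"] \<Delta>0[OF k] by simp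
    then have "B k = B (Suc k) - z * (B (Suc k) / of_nat n / \<Delta> k)"
      using k by (simp add: B_def sum.atLeast_Suc_lessThan[OF k] algebra_simps)
    then show ?thesis by (simp add: h_def algebra_simps)
  qed
  have AB: "A k * B k = B 0" if "k \<le> n" for k
    using that
  proof (induction k)
    case 0
    show ?case by (simp add: A_def)
  next
    case (Suc k)
    then have k: "k < n" by simp
    have "A (Suc k) * B (Suc k) = A k * (B (Suc k) * (1 - h / \<Delta> k))" using A_Suc[OF k] by (simp add: mult_ac)
    also have "\<dots> = A k * B k" using B_Suc[OF k] by simp
    finally show ?case using Suc by simp
  qed
  have \<phi>: "(\<Delta> k + z * (l * l')) * (1 - h / \<Delta> k) = B 0" if k: "k < n" for k
  proof -
    have "(\<Delta> k + z * (l * l')) * (1 - h / \<Delta> k) = A k * (B (Suc k) * (1 - h / \<Delta> k))"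
      by (simp add: \<Delta>_def mult.assoc)
    also have "\<dots> = A k * B k" by (simp only: B_Suc[OF k, symmetric])
    finally show ?thesis using AB[of k] k by simp
  qed
  \<comment> \<open>All \<Delta> k solve (x + z l l')(1 - h/x) = B 0, a quadratic equation. The
    difference of its left side at two points x, y contains the factor 1 + h z l l'/(x y), whose
    last term has modulus at most (1/64)/(1/4) = 1/16; so there is one root in the disc.\<close>
  have \<Delta>_const: "\<Delta> k = \<Delta> 0" if k: "k < n" for k
  proof (rule ccontr)
    assume ne: "\<Delta> k \<noteq> \<Delta> 0"
    let ?L = "z * (l * l')"
    have "(\<Delta> k + ?L) * (1 - h / \<Delta> k) - (\<Delta> 0 + ?L) * (1 - h / \<Delta> 0) =
        (\<Delta> k - \<Delta> 0) * (1 + h * ?L / (\<Delta> k * \<Delta> 0))"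
      using \<Delta>0[OF k] \<Delta>0[OF n] by (simp add: field_simps)
    then have "1 + h * ?L / (\<Delta> k * \<Delta> 0) = 0"
      unfolding \<phi>[OF k] \<phi>[OF n] using ne by simp
    then have "h * ?L / (\<Delta> k * \<Delta> 0) = - 1" by (simp only: add_eq_0_iff)
    then have "1 = cmod h * cmod ?L / (cmod (\<Delta> k) * cmod (\<Delta> 0))"
      by (metis norm_divide norm_minus_cancel norm_mult norm_one)
    also have "\<dots> \<le> (1/8 * (1/8)) / (1/2 * (1/2))"
    proof (intro frac_le mult_mono \<Delta>_ge k n small)
      have "cmod h \<le> cmod z / 1" unfolding h_def norm_divide norm_of_nat
        by (rule divide_left_mono) (use n in auto)
      then show "cmod h \<le> 1/8" using small(3) by simp
    qed auto
    finally show False by simp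
  qed
  have "B (n - k) = (1 - h / \<Delta> 0) ^ k" if "k \<le> n" for k
    using that
  proof (induction k)
    case 0
    show ?case by (simp add: B_def)
  next
    case (Suc k)
    then have k: "n - Suc k < n" "Suc (n - Suc k) = n - k" by auto
    show ?case using B_Suc[OF k(1)] \<Delta>_const[OF k(1)] Suc unfolding k(2) by (simp add: mult.commute)
  qed
  from this[of n] have "B 0 = (1 - h / \<Delta> 0) ^ n" by simp
  moreover have "B 0 = 1 - z * (\<Sum>k<n. a k)" by (simp add: B_def atLeast0LessThan)
  ultimately show thesis
    using that[of "\<Delta> 0"] \<Delta>1[OF n] \<phi>[OF n] unfolding h_def by simp
qed

text \<open>With w = u/m, the quantity m Ln(1 + w) differs from u by at most 2 |u| |w|, which tends
  to 0. The base is allowed to vary because \<Delta> depends on N.\<close>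

lemma tendsto_power_exp:
  fixes u :: "nat \<Rightarrow> complex" and m :: "nat \<Rightarrow> nat"
  assumes u: "u \<longlonglongrightarrow> v" and m: "filterlim m at_top sequentially"
  shows "(\<lambda>i. (1 + u i / of_nat (m i)) ^ m i) \<longlonglongrightarrow> exp v"
proof -
  define w where "w i = u i / of_nat (m i)" for i
  have inv: "(\<lambda>i. inverse (of_nat (m i) :: complex)) \<longlonglongrightarrow> 0"
    by (rule filterlim_compose[OF lim_inverse_n m])
  then have w0: "w \<longlonglongrightarrow> 0"
    using tendsto_mult[OF u inv] by (simp add: w_def[abs_def] divide_inverse)
  have "\<forall>\<^sub>F i in sequentially. cmod (w i) < 1/2"
    using order_tendstoD(2)[OF tendsto_norm[OF w0], of "1/2"] by simp
  moreover have "\<forall>\<^sub>F i in sequentially. m i \<ge> 1"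
    using m unfolding filterlim_at_top by blast
  ultimately have ev: "\<forall>\<^sub>F i in sequentially. cmod (w i) < 1/2 \<and> m i \<ge> 1" by eventually_elim simp
  have "(\<lambda>i. of_nat (m i) * Ln (1 + w i) - u i) \<longlonglongrightarrow> 0"
  proof (rule Lim_null_comparison)
    show "\<forall>\<^sub>F i in sequentially. norm (of_nat (m i) * Ln (1 + w i) - u i) \<le> cmod (u i) * (2 * cmod (w i))"
      using ev
    proof eventually_elim
      case (elim i)
      have mw: "of_nat (m i) * w i = u i" using elim by (simp add: w_def)
      have "cmod (Ln (1 + w i) - w i) \<le> (cmod (w i))\<^sup>2 / (1 - cmod (w i))"
        by (rule Ln_approx_linear) (use elim in simp)
      also have "\<dots> \<le> (cmod (w i))\<^sup>2 / (1/2)" using elim by (intro divide_left_mono) auto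
      finally have le: "cmod (Ln (1 + w i) - w i) \<le> 2 * (cmod (w i))\<^sup>2" by simp
      have "norm (of_nat (m i) * Ln (1 + w i) - u i) = real (m i) * cmod (Ln (1 + w i) - w i)"
        unfolding mw[symmetric] by (simp add: norm_mult flip: right_diff_distrib)
      also have "\<dots> \<le> real (m i) * (2 * (cmod (w i))\<^sup>2)" using le by (rule mult_left_mono) simp
      also have "\<dots> = cmod (of_nat (m i) * w i) * (2 * cmod (w i))"
        by (simp add: norm_mult power2_eq_square)
      finally show ?case unfolding mw .
    qed
    have "(\<lambda>i. cmod (u i) * (2 * cmod (w i))) \<longlonglongrightarrow> cmod v * (2 * 0)"
      by (intro tendsto_mult tendsto_norm u tendsto_const tendsto_norm_zero w0)
    then show "(\<lambda>i. cmod (u i) * (2 * cmod (w i))) \<longlonglongrightarrow> 0" by simp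
  qed
  from tendsto_exp[OF tendsto_add[OF this u]]
  have "(\<lambda>i. exp (of_nat (m i) * Ln (1 + w i))) \<longlonglongrightarrow> exp v" by simp
  moreover have "\<forall>\<^sub>F i in sequentially. exp (of_nat (m i) * Ln (1 + w i)) = (1 + u i / of_nat (m i)) ^ m i"
    using ev
  proof eventually_elim
    case (elim i)
    have "1 + w i \<noteq> 0"
    proof
      assume "1 + w i = 0"
      then have "w i = -1" by (simp add: add_eq_0_iff)
      then show False using elim by simp
    qed
    then show ?case by (simp add: exp_of_nat_mult w_def)
  qed
  ultimately show ?thesis by (rule Lim_transform_eventually)
qed

section \<open>Germs at infinity\<close>

text \<open>The claimed value of \<open>\<R>(z) + 1/z\<close>, that is, of the compositional inverse of the Cauchy transform.\<close>

definition R_plus_inverse :: "complex \<Rightarrow> complex \<Rightarrow> complex" where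
  "R_plus_inverse L z = - (1 / ((1 - z) * Ln (1 - z))) + L / (1 - z)"

text \<open>Passing to the reciprocal turns the pole at 0 into a zero of a holomorphic \<phi> with
  derivative 1 there, which is locally injective.\<close>

lemma R_plus_inverse_reciprocal:
  obtains r \<phi> where "r > 0" "inj_on \<phi> (ball 0 r)" "\<phi> \<midarrow>0\<rightarrow> 0" "\<phi> 0 = 0"
    "\<And>z. z \<in> ball 0 r \<Longrightarrow> z \<noteq> 0 \<Longrightarrow> R_plus_inverse L z = inverse (\<phi> z)"
proof -
  define \<phi> where "\<phi> z = - ((1 - z) * Ln (1 - z)) / (1 - L * Ln (1 - z))" for z :: complex
  have Ln_cont: "continuous_on (ball 0 1) (\<lambda>z. 1 - L * Ln (1 - z))"
    by (intro continuous_intros) (auto simp: complex_nonpos_Reals_iff dest: complex_Re_le_cmod[THEN order_le_less_trans])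
  define S where "S = ball 0 1 \<inter> (\<lambda>z. 1 - L * Ln (1 - z)) -` (- {0})"
  have S: "open S" "0 \<in> S"
    using continuous_on_open_vimage[OF open_ball, THEN iffD1, OF Ln_cont, rule_format, of "- {0}"]
    by (auto simp: S_def Int_commute)
  have notneg: "1 - z \<notin> \<real>\<^sub>\<le>\<^sub>0" if "z \<in> S" for z
    using that complex_Re_le_cmod[of z] by (auto simp: S_def complex_nonpos_Reals_iff)
  have hol: "\<phi> holomorphic_on S"
    unfolding \<phi>_def by (intro holomorphic_intros) (use notneg in \<open>auto simp: S_def\<close>)
  have "(\<phi> has_field_derivative 1) (at 0)"
    unfolding \<phi>_def by (auto intro!: derivative_eq_intros simp: complex_nonpos_Reals_iff)
  then have "deriv \<phi> 0 \<noteq> 0" using DERIV_imp_deriv by fastforce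
  then obtain r where r: "r > 0" "ball 0 r \<subseteq> S" "inj_on \<phi> (ball 0 r)"
    using has_complex_derivative_locally_injective[OF hol S(2,1)] by metis
  have "isCont \<phi> 0"
    using holomorphic_on_imp_continuous_on[OF hol] S continuous_on_eq_continuous_at by blast
  then have "\<phi> \<midarrow>0\<rightarrow> 0" by (simp add: isCont_def \<phi>_def)
  moreover have "R_plus_inverse L z = inverse (\<phi> z)" if z: "z \<in> ball 0 r" "z \<noteq> 0" for z
  proof -
    have zS: "z \<in> S" using z r by blast
    have 1: "1 - z \<noteq> 0" using notneg[OF zS] by auto
    have 2: "Ln (1 - z) \<noteq> 0"
    proof
      assume e: "Ln (1 - z) = 0"
      have "1 - z = exp (Ln (1 - z))" by (rule exp_Ln[OF 1, symmetric])
      also have "\<dots> = 1" by (simp only: e exp_zero)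
      finally show False using z(2) by simp
    qed
    have "- (1 / (u * y)) + L / u = inverse (- (u * y) / (1 - L * y))" if "u \<noteq> 0" "y \<noteq> 0" for u y
      using that by (simp add: field_simps)
    from this[OF 1 2] show ?thesis by (simp add: R_plus_inverse_def \<phi>_def)
  qed
  ultimately show thesis using that[of r \<phi>] r by (simp add: \<phi>_def)
qed

text \<open>\<open>inv\<close> is a one-sided identity. Taken at the point R_plus_inverse L z it
  says that z and G (R_plus_inverse L z) have the same image under \<open>R_plus_inverse L\<close>;
  injectivity of \<phi> near 0 then identifies them.\<close>

lemma inverse_near_infinity_R_plus_inverse:
  assumes inv: "\<forall>\<^sub>F \<zeta> in at_infinity. R_plus_inverse L (G \<zeta>) = \<zeta>"
    and lim: "(G \<longlongrightarrow> 0) at_infinity"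
  shows "inverse_near_infinity G (R_plus_inverse L)"
proof -
  obtain r \<phi> where r: "r > 0" "inj_on \<phi> (ball 0 r)" "\<phi> \<midarrow>0\<rightarrow> 0" "\<phi> 0 = 0"
    "\<And>z. z \<in> ball 0 r \<Longrightarrow> z \<noteq> 0 \<Longrightarrow> R_plus_inverse L z = inverse (\<phi> z)"
    using R_plus_inverse_reciprocal[of L] by blast
  have ball: "\<forall>\<^sub>F z in at 0. z \<in> ball 0 r \<and> z \<noteq> 0"
    using r(1) by (auto simp: eventually_at dist_commute intro!: exI[of _ r])
  have "\<forall>\<^sub>F z in at 0. \<phi> z \<noteq> 0"
    using ball
  proof eventually_elim
    case (elim z)
    then show ?case using inj_onD[OF r(2), of z 0] r(1,4) by auto
  qed
  with r(3) have "filterlim \<phi> (at 0) (at 0)" by (simp add: filterlim_at)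
  then have "filterlim (\<lambda>z. inverse (\<phi> z)) at_infinity (at 0)"
    by (rule filterlim_compose[OF filterlim_inverse_at_infinity])
  moreover have "\<forall>\<^sub>F z in at 0. inverse (\<phi> z) = R_plus_inverse L z"
    using ball by eventually_elim (simp add: r(5))
  ultimately have inf: "filterlim (R_plus_inverse L) at_infinity (at 0)"
    using filterlim_cong[OF refl refl] by fast
  have "\<forall>\<^sub>F z in at 0. G (R_plus_inverse L z) = z"
  proof -
    have "((\<lambda>z. G (R_plus_inverse L z)) \<longlongrightarrow> 0) (at 0)" by (rule filterlim_compose[OF lim inf])
    then have "\<forall>\<^sub>F z in at 0. dist (G (R_plus_inverse L z)) 0 < r" using r(1) by (rule tendstoD)
    moreover have "\<forall>\<^sub>F z in at 0. R_plus_inverse L (G (R_plus_inverse L z)) = R_plus_inverse L z"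
      using inf inv by (rule eventually_compose_filterlim[rotated])
    moreover have "\<forall>\<^sub>F z in at 0. cmod (R_plus_inverse L 0) + 1 \<le> cmod (R_plus_inverse L z)"
      using inf by (auto simp: filterlim_at_infinity[OF order_refl] add_nonneg_pos)
    ultimately show ?thesis using ball
    proof eventually_elim
      case (elim z)
      let ?w = "G (R_plus_inverse L z)"
      have w: "?w \<in> ball 0 r" "?w \<noteq> 0" using elim by (auto simp: dist_commute)
      have "inverse (\<phi> ?w) = inverse (\<phi> z)" using elim r(5)[OF w] r(5)[of z] by simp
      then show ?case using inj_onD[OF r(2), of ?w z] w elim by simp
    qed
  qed
  with inv inf show ?thesis by (simp add: inverse_near_infinity_def)
qed

text \<open>F (G (K z)) equals both K z and F z. Hence the \<open>SOME\<close> in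
  \<open>R_transform\<close> determines a germ at 0.\<close>

lemma inverse_near_infinity_unique:
  assumes "inverse_near_infinity G K" "inverse_near_infinity G F"
  shows "\<forall>\<^sub>F z in at 0. K z = F z"
proof -
  have "\<forall>\<^sub>F z in at 0. F (G (K z)) = K z"
    using assms unfolding inverse_near_infinity_def
    by (intro eventually_compose_filterlim[of "\<lambda>\<zeta>. F (G \<zeta>) = \<zeta>" at_infinity K]) auto
  moreover have "\<forall>\<^sub>F z in at 0. G (K z) = z" using assms by (simp add: inverse_near_infinity_def)
  ultimately show ?thesis by eventually_elim simp
qed

text \<open>\<open>remove_sings\<close> at a point depends on a punctured neighbourhood of that
  point, so agreement off 0 determines the value at 0 as well.\<close>

lemma eventually_remove_sings_cong:
  assumes "\<forall>\<^sub>F z in at (0::complex). f z = g z"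
  shows "\<forall>\<^sub>F z in nhds 0. remove_sings f z = remove_sings g z"
proof -
  obtain S where S: "open S" "0 \<in> S" "\<And>z. z \<in> S \<Longrightarrow> z \<noteq> 0 \<Longrightarrow> f z = g z"
    using assms by (auto simp: eventually_at_topological)
  have "remove_sings f z = remove_sings g z" if "z \<in> S" for z
  proof (rule remove_sings_cong[OF _ refl])
    show "\<forall>\<^sub>F w in at z. f w = g w"
    proof (cases "z = 0")
      case False
      then show ?thesis using S that
        by (auto simp: eventually_at_topological intro!: exI[of _ "S - {0}"])
    qed (use assms in simp)
  qed
  then show ?thesis using S by (auto simp: eventually_nhds)
qed

section \<open>The quasi-nilpotent DT-operator\<close>

lemma (in projection_grid) adj_tri:
  assumes "adj X = X" shows "adj (tri R) = tri (\<lambda>j k. R k j)"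
proof -
  have "adj (tri R) = (\<Sum>j<n. \<Sum>k<n. if R j k then p k \<ast> X \<ast> p j else 0)"
    unfolding tri_def
  proof (subst adj_sum)
    show "(\<Sum>j<n. adj (\<Sum>k<n. if R j k then p j \<ast> X \<ast> p k else 0)) =
        (\<Sum>j<n. \<Sum>k<n. if R j k then p k \<ast> X \<ast> p j else 0)"
    proof (intro sum.cong refl, subst adj_sum)
      fix j assume j: "j \<in> {..<n}"
      show "(\<Sum>k<n. adj (if R j k then p j \<ast> X \<ast> p k else 0)) =
          (\<Sum>k<n. if R j k then p k \<ast> X \<ast> p j else 0)"
        using j assms by (intro sum.cong) (auto simp: X_in_M p_adj compose_assoc)
    qed (auto intro!: M_clinear simp: X_in_M)
  qed (auto intro!: M_clinear M_sum simp: X_in_M)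
  also have "\<dots> = tri (\<lambda>j k. R k j)"
    unfolding tri_def by (rule sum.swap)
  finally show ?thesis .
qed

text \<open>The Dyson equations are used for (<) with S, Q and for the converse relation with adj S,
  Q', where l and its conjugate change places. The bound 1/16 keeps both resolvents below 2 in norm,
  and with K = 2 it gives the 1/8 demanded by \<open>discrete_Dyson_solution\<close>.\<close>

proposition (in projection_grid) grid_resolvent:
  fixes z l :: complex and C :: real
  assumes n: "n > 0" and p_tau: "\<And>k. k < n \<Longrightarrow> \<tau> (p k) = 1 / of_nat n"
    and p_sum: "(\<Sum>k<n. p k) = id_blinfun" and X_adj: "adj X = X"
  defines "S \<equiv> tri (<) - scalar_op l"
  assumes C: "1 \<le> C" "cmod l \<le> C" "norm S \<le> C" and z: "cmod z * C\<^sup>2 \<le> 1/16"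
    and Q: "Q \<in> M" "Q = id_blinfun + Q \<ast> (z \<odot> (adj S \<ast> S))" "Q = id_blinfun + (z \<odot> (adj S \<ast> S)) \<ast> Q"
      "norm Q \<le> 2"
  shows "\<exists>\<Delta>. cmod (\<Delta> - 1) \<le> 1/2
    \<and> 1 - z * \<tau> Q = (1 - z / of_nat n / \<Delta>) ^ n
    \<and> (\<Delta> + z * of_real ((cmod l)\<^sup>2)) * (1 - z / of_nat n / \<Delta>) = 1 - z * \<tau> Q"
proof -
  let ?R = "(<) :: nat \<Rightarrow> nat \<Rightarrow> bool" and ?R' = "\<lambda>j k :: nat. k < j"
  have SM: "S \<in> M" by (simp add: S_def)
  have S': "adj S = tri ?R' - scalar_op (cnj l)"
    by (simp add: S_def adj_tri[OF X_adj])
  have nS': "norm (adj S) \<le> C" using norm_adj_le[of S] C(3) SM by simp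
  have small: "norm (z \<odot> (a \<ast> b)) \<le> 1/16" if "norm a \<le> C" "norm b \<le> C" for a b :: "'h bop"
  proof -
    have "norm (z \<odot> (a \<ast> b)) \<le> cmod z * (norm a * norm b)"
      by (rule order_trans[OF norm_scalar_op_compose]) (intro mult_left_mono norm_blinfun_compose norm_ge_zero)
    also have "\<dots> \<le> cmod z * (C * C)"
      using that C by (intro mult_left_mono mult_mono) auto
    finally show ?thesis using z by (simp add: power2_eq_square)
  qed
  have K1: "norm (z \<odot> (adj S \<ast> S)) < 1" and K2: "norm (z \<odot> (S \<ast> adj S)) \<le> 1/16"
    using small[OF nS' C(3)] small[OF C(3) nS'] by simp_all
  then have K2': "norm (z \<odot> (S \<ast> adj S)) < 1" by simp
  obtain Q' where Q': "Q' \<in> M" "Q' = id_blinfun + Q' \<ast> (z \<odot> (S \<ast> adj S))"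
    "Q' = id_blinfun + (z \<odot> (S \<ast> adj S)) \<ast> Q'" "norm Q' \<le> 1 / (1 - norm (z \<odot> (S \<ast> adj S)))"
    by (rule Neumann_inverse[of "z \<odot> (S \<ast> adj S)"]) (use SM K2' in auto)
  have "1 / (1 - norm (z \<odot> (S \<ast> adj S))) \<le> 1 / (1/2)"
    using K2 by (intro divide_left_mono) auto
  from order_trans[OF Q'(4) this] have nQ': "norm Q' \<le> 2" by simp
  have bnd: "cmod (\<tau> (p k \<ast> a)) \<le> 2 / n" if "k < n" "a \<in> M" "norm a \<le> 2" for k a
    using tau_p_bound[OF that(1,2)] that(3) p_tau[OF that(1)] n
    by (simp add: Re_divide_of_nat) (smt (verit) divide_right_mono of_nat_0_le_iff)

  have zC: "cmod z \<le> cmod z * C\<^sup>2"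
    using C(1) by (intro mult_le_cancel_left1[THEN iffD2]) (auto simp: one_le_power)
  have ll: "l * cnj l = of_real ((cmod l)\<^sup>2)" by (rule complex_norm_square[symmetric])
  obtain \<Delta> where "cmod (\<Delta> - 1) \<le> 1/2"
    "1 - z * (\<Sum>k<n. \<tau> (p k \<ast> Q)) = (1 - z / of_nat n / \<Delta>) ^ n"
    "(\<Delta> + z * (l * cnj l)) * (1 - z / of_nat n / \<Delta>) = 1 - z * (\<Sum>k<n. \<tau> (p k \<ast> Q))"
  proof (rule discrete_Dyson_solution[OF n, where a = "\<lambda>k. \<tau> (p k \<ast> Q)" and d = "\<lambda>k. \<tau> (p k \<ast> Q')"
        and c = "\<lambda>k. \<tau> (p k \<ast> S \<ast> Q)" and b = "\<lambda>k. \<tau> (p k \<ast> adj S \<ast> Q')" and l = l and l' = "cnj l" and K = 2 and z = z])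
    fix k assume k: "k < n"
    note D = Dyson_equations[where R = ?R and l = l and l' = "cnj l" and z = z and Q = Q and Q' = Q' and k = k,
        folded S', folded S_def, OF _ K1 K2' Q(1-3) Q'(1-3) k]
    note D' = Dyson_equations[where R = ?R' and l = "cnj l" and l' = l and z = z and Q = Q' and Q' = Q and k = k,
        folded S', folded S_def, OF _ K2' K1 Q'(1-3) Q(1-3) k]
    show "\<tau> (p k \<ast> S \<ast> Q) = - l * \<tau> (p k \<ast> Q) + z * (\<Sum>m<n. if k < m then \<tau> (p m \<ast> Q) else 0) * \<tau> (p k \<ast> S \<ast> Q)"
      by (rule D(1)) simp
    show "\<tau> (p k \<ast> Q) = 1 / of_nat n - z * cnj l * \<tau> (p k \<ast> S \<ast> Q)
        + z * (\<Sum>m<n. if m < k then \<tau> (p m \<ast> Q') else 0) * \<tau> (p k \<ast> Q)"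
      unfolding p_tau[OF k, symmetric] by (rule D(2)) simp
    show "\<tau> (p k \<ast> adj S \<ast> Q') = - cnj l * \<tau> (p k \<ast> Q')
        + z * (\<Sum>m<n. if m < k then \<tau> (p m \<ast> Q') else 0) * \<tau> (p k \<ast> adj S \<ast> Q')"
      by (rule D'(1)) simp
    show "\<tau> (p k \<ast> Q') = 1 / of_nat n - z * l * \<tau> (p k \<ast> adj S \<ast> Q')
        + z * (\<Sum>m<n. if k < m then \<tau> (p m \<ast> Q) else 0) * \<tau> (p k \<ast> Q')"
      unfolding p_tau[OF k, symmetric] by (rule D'(2)) simp
    show "cmod (\<tau> (p k \<ast> Q)) \<le> 2 / n" "cmod (\<tau> (p k \<ast> Q')) \<le> 2 / n"
      using bnd[OF k] Q(1,4) Q'(1) nQ' by auto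
  next
    show "cmod z * 2 \<le> 1/8" "cmod z \<le> 1/8" using zC z by simp_all
    have "cmod (z * (l * cnj l)) = cmod z * (cmod l)\<^sup>2" by (simp add: norm_mult power2_eq_square)
    also have "\<dots> \<le> cmod z * C\<^sup>2" using C(2) by (intro mult_left_mono power_mono) auto
    finally show "cmod (z * (l * cnj l)) \<le> 1/8" using z by simp
  qed
  moreover have "(\<Sum>k<n. \<tau> (p k \<ast> Q)) = \<tau> Q"
  proof -
    have "(\<Sum>k<n. \<tau> (p k \<ast> Q)) = \<tau> ((\<Sum>k<n. p k) \<ast> Q)"
      unfolding compose_simps(8) by (rule tau_sum[symmetric]) (use Q(1) in simp)
    then show ?thesis by (simp add: p_sum)
  qed
  ultimately show ?thesis unfolding ll by metis
qed

context uniform_diagonal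
begin

section \<open>Closed grid intervals as an orthogonal partition of unity\<close>

lemma E_idem: "B \<in> sets borel \<Longrightarrow> E B \<ast> E B = E B"
  using E_Int[of B B] by simp

lemma projection_eq_zero:
  assumes "a \<in> M" "adj a = a" "a \<ast> a = a" "\<tau> a = 0" shows "a = 0"
  using tau_faithful[of a] assms by simp

text \<open>Neighbouring closed grid intervals share an endpoint. Its projection has trace 0 and
  vanishes by faithfulness, so the overlap does no harm.\<close>

lemma E_point:
  assumes "0 \<le> t" "t \<le> 1" shows "E {t} = 0"
  using projection_eq_zero[of "E {t..t}"] interval_projection_M[of t t] interval_projection_tau[of t t]
    E_idem[of "{t..t}"] assms by simp

lemma E_split:
  assumes "0 \<le> a" "a \<le> b" "b \<le> c" "c \<le> 1"
  shows "E {a..c} = E {a..b} + E {b..c}"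
proof -
  have "{a..c} = {a..b} \<union> {b<..c}" "{b..c} = {b} \<union> {b<..c}" "{a..b} \<inter> {b<..c} = {}"
    using assms by auto
  then show ?thesis
    using E_Un[of "{a..b}" "{b<..c}"] E_Un[of "{b}" "{b<..c}"] E_point[of b] assms by simp
qed

lemma E_unit: "E {0..1} = id_blinfun"
proof -
  let ?F = "id_blinfun - E {0..1}"
  have "?F = 0"
  proof (rule projection_eq_zero)
    show "?F \<in> M" using interval_projection_M[of 0 1] by simp
    show "adj ?F = ?F" using interval_projection_M[of 0 1] by simp
    show "?F \<ast> ?F = ?F" using E_idem[of "{0..1}"] by (simp add: compose_simps)
    show "\<tau> ?F = 0"
      using interval_projection_M[of 0 1] interval_projection_tau[of 0 1] by (simp add: tau_diff tau_id)
  qed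
  then show ?thesis by simp
qed

definition grid :: "nat \<Rightarrow> nat \<Rightarrow> 'h bop" where
  "grid n k = E {real k / real n..real (Suc k) / real n}"

lemma grid_bounds:
  assumes "k < n" shows "0 \<le> real k / real n" "real k / real n \<le> real (Suc k) / real n" "real (Suc k) / real n \<le> 1"
  using assms by (auto simp: divide_right_mono divide_le_eq_1)

lemma grid_mult_less:
  assumes "j < k" "k < n" shows "grid n j \<ast> grid n k = 0"
proof -
  let ?A = "{real j / real n..real (Suc j) / real n}" and ?B = "{real k / real n..real (Suc k) / real n}"
  have "grid n j \<ast> grid n k = E (?A \<inter> ?B)" unfolding grid_def by (rule E_Int[symmetric]) simp_all
  also have "\<dots> = 0"
  proof (cases "k = Suc j")
    case True
    have "{x..y} \<inter> {y..w} = {y}" if "x \<le> y" "y \<le> w" for x y w :: real using that by auto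
    moreover have "j < n" using assms by simp
    ultimately have "?A \<inter> ?B = {real k / real n}"
      using grid_bounds(2)[of j n] grid_bounds(2)[OF assms(2)] unfolding True by blast
    then show ?thesis using E_point[of "real k / real n"] grid_bounds[of k n] assms by simp
  next
    case False
    then have "real (Suc j) / real n < real k / real n"
      using assms by (intro divide_strict_right_mono) auto
    then have "?A \<inter> ?B = {}" by auto
    then show ?thesis by simp
  qed
  finally show ?thesis .
qed

lemma grid_sum:
  assumes "j \<le> m" "m \<le> n" "n > 0"
  shows "E {real j / real n..real m / real n} = (\<Sum>k\<in>{j..<m}. grid n k)"
  using assms
proof (induction m)
  case 0
  then show ?case using E_point[of 0] by simp
next
  case (Suc m)
  show ?case
  proof (cases "j = Suc m")
    \<comment> \<open>An empty sum against a one-point interval.\<close>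
    case True
    then show ?thesis using E_point[of "real (Suc m) / real n"] Suc by (simp add: divide_le_eq_1)
  next
    case False
    then have "E {real j / real n..real (Suc m) / real n} =
        E {real j / real n..real m / real n} + grid n m"
      unfolding grid_def using Suc grid_bounds[of m n]
      by (intro E_split) (auto intro!: divide_right_mono)
    then show ?thesis using Suc False by simp
  qed
qed

end

lemma (in uniform_diagonal) projection_grid_grid:
  assumes "free_semicircular M \<tau> D X" shows "projection_grid M \<tau> D X n (grid n)"
proof -
  interpret free_semicircular M \<tau> D X by (rule assms)
  show ?thesis
  proof
    fix k assume k: "k < n"
    show "approximable (grid n k)"
      unfolding approximable_def alg_def grid_def
      using interval_projection_M[OF grid_bounds[OF k]] interval_projection_approx[OF grid_bounds[OF k]] by auto
    show "adj (grid n k) = grid n k" by (simp add: grid_def)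
  next
    fix j k assume jk: "j < n" "k < n"
    have adj: "adj (grid n i) = grid n i" and M: "i < n \<Longrightarrow> grid n i \<in> M" for i
      using interval_projection_M[OF grid_bounds[of i n]] by (auto simp: grid_def)
    consider "j < k" | "j = k" | "k < j" by linarith
    then show "grid n j \<ast> grid n k = (if j = k then grid n k else 0)"
    proof cases
      case 3
      have "adj (grid n k \<ast> grid n j) = grid n j \<ast> grid n k" using M jk adj by simp
      then show ?thesis using grid_mult_less[OF 3 jk(1)] 3 by simp
    qed (use grid_mult_less[of j k n] jk E_idem in \<open>auto simp: grid_def\<close>)
  qed
qed

text \<open>The zero-based j stands for j + 1 in \<open>DT_approx\<close>, so its tail interval is
  the union of the cells with k > j: the triangle is strict.\<close>

lemma (in uniform_diagonal) DT_approx_tri: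
  assumes free: "free_semicircular M \<tau> D X"
  shows "DT_approx E X N = projection_grid.tri X (2 ^ N) (grid (2 ^ N)) (<)"
proof -
  define n :: nat where "n = 2 ^ N"
  interpret projection_grid M \<tau> D X n "grid n" by (rule projection_grid_grid[OF free])
  have n: "n > 0" by (simp add: n_def)
  have "DT_approx E X N = (\<Sum>j<n. E {(real (Suc j) - 1) / 2 ^ N..real (Suc j) / 2 ^ N} \<ast> X
      \<ast> E {real (Suc j) / 2 ^ N..1})"
    unfolding DT_approx_def n_def
    by (rule sum.reindex_bij_witness[of _ Suc "\<lambda>j. j - 1"]) auto
  also have "\<dots> = (\<Sum>j<n. grid n j \<ast> X \<ast> (\<Sum>k\<in>{Suc j..<n}. grid n k))"
  proof (intro sum.cong refl)
    fix j assume j: "j \<in> {..<n}"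
    have "E {real (Suc j) / real n..real n / real n} = (\<Sum>k\<in>{Suc j..<n}. grid n k)"
      using j n by (intro grid_sum) auto
    then show "E {(real (Suc j) - 1) / 2 ^ N..real (Suc j) / 2 ^ N} \<ast> X \<ast> E {real (Suc j) / 2 ^ N..1} =
        grid n j \<ast> X \<ast> (\<Sum>k\<in>{Suc j..<n}. grid n k)"
      using n by (simp add: grid_def n_def)
  qed
  also have "\<dots> = (\<Sum>j<n. \<Sum>k<n. if j < k then grid n j \<ast> X \<ast> grid n k else 0)"
    unfolding compose_simps(9) by (intro sum.cong refl sum.mono_neutral_cong_left) auto
  finally have "DT_approx E X N = tri (<)" unfolding tri_def .
  then show ?thesis unfolding n_def .
qed

text \<open>1/z - a = (1/z)(1 - z a), so z Q inverts it; uniqueness of inverses resolves the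
  definite description in \<open>op_inverse\<close>.\<close>

lemma (in tracial_algebra) op_inverse_resolvent:
  assumes Q: "Q \<in> M" "Q = id_blinfun + Q \<ast> (z \<odot> a)" "Q = id_blinfun + (z \<odot> a) \<ast> Q"
    and a: "a \<in> M" and z: "z \<noteq> 0"
  shows "cauchy_transform \<tau> a (1 / z) = z * \<tau> Q"
proof -
  have "op_inverse (scalar_op (1 / z) - a) = z \<odot> Q"
    unfolding op_inverse_def
  proof (rule the_equality)
    have za: "scalar_op (1 / z) - a = (1 / z) \<odot> (id_blinfun - z \<odot> a)"
    proof -
      have "(1 / z) \<odot> (z \<odot> a) = scalar_op (1 / z * z) \<ast> a"
        by (simp only: scalar_op_mult compose_assoc)
      also have "\<dots> = a" using z by simp
      finally show ?thesis by (simp add: bounded_bilinear.diff_right[OF bounded_bilinear_blinfun_compose])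
    qed
    have 1: "(id_blinfun - z \<odot> a) \<ast> Q = id_blinfun" "Q \<ast> (id_blinfun - z \<odot> a) = id_blinfun"
      using Q(2,3) by (simp_all add: compose_simps diff_eq_eq)
    have c: "(u \<odot> x) \<ast> (v \<odot> y) = (u * v) \<odot> (x \<ast> y)" if "x \<in> M" for u v and x y :: "'h bop"
      using scalar_op_commute_left[OF M_clinear[OF that], of v y] by (simp add: scalar_op_mult compose_assoc)
    show inv: "(scalar_op (1 / z) - a) \<ast> (z \<odot> Q) = id_blinfun \<and> (z \<odot> Q) \<ast> (scalar_op (1 / z) - a) = id_blinfun"
      unfolding za using c Q(1) a z 1 by simp
    fix b assume b: "(scalar_op (1 / z) - a) \<ast> b = id_blinfun \<and> b \<ast> (scalar_op (1 / z) - a) = id_blinfun"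
    have "b = b \<ast> ((scalar_op (1 / z) - a) \<ast> (z \<odot> Q))" using inv by simp
    also have "\<dots> = z \<odot> Q" unfolding compose_assoc[symmetric] using b by simp
    finally show "b = z \<odot> Q" .
  qed
  then show ?thesis using Q(1) by (simp add: cauchy_transform_def tau_scale)
qed

text \<open>One constant bounds all approximants, so the finite-grid equations hold for every N at
  the same z, and the limit is taken in these scalar equations.\<close>

theorem (in tracial_algebra) cauchy_transform_DT:
  fixes T :: "'h bop" and l :: complex
  assumes DT: "quasinilpotent_DT M \<tau> T"
  defines "S \<equiv> T - scalar_op l"
  obtains \<delta> where "\<delta> > 0"
    and "\<And>z. z \<noteq> 0 \<Longrightarrow> cmod z < \<delta> \<Longrightarrow>
      R_plus_inverse (of_real ((cmod l)\<^sup>2)) (cauchy_transform \<tau> (adj S \<ast> S) (1 / z)) = 1 / z"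
    and "\<And>z. z \<noteq> 0 \<Longrightarrow> cmod z < \<delta> \<Longrightarrow> cmod (cauchy_transform \<tau> (adj S \<ast> S) (1 / z)) \<le> 2 * cmod z"
proof -
  obtain D X E where h: "D \<in> M" "X \<in> M" "adj D = D" "adj X = X" "free_pair \<tau> D X"
    "has_distribution \<tau> D unif" "has_distribution \<tau> X semicircle_distribution"
    "spectral_measure D E" and lim: "DT_approx E X \<longlonglongrightarrow> T"
    using DT unfolding quasinilpotent_DT_def by blast
  interpret uniform_diagonal M \<tau> D E
    by unfold_locales (use h in auto)
  interpret free_semicircular M \<tau> D X
    by unfold_locales (use h in auto)
  define n :: "nat \<Rightarrow> nat" where "n N = 2 ^ N" for N
  have grid: "projection_grid M \<tau> D X (n N) (grid (n N))" for N
    by (rule projection_grid_grid) unfold_locales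
  define SN where "SN N = DT_approx E X N - scalar_op l" for N
  have SN_tri: "SN N = projection_grid.tri X (n N) (grid (n N)) (<) - scalar_op l" for N
    unfolding SN_def n_def by (subst DT_approx_tri) (auto intro: free_semicircular_axioms)
  have SN_M: "SN N \<in> M" for N
  proof -
    interpret projection_grid M \<tau> D X "n N" "grid (n N)" by (rule grid)
    show ?thesis by (simp add: SN_tri)
  qed
  have SN_lim: "SN \<longlonglongrightarrow> S" unfolding SN_def S_def by (intro tendsto_diff lim tendsto_const)
  then have SM: "S \<in> M" using M_limit SN_M by blast
  have "Bseq SN" using SN_lim by (simp add: convergent_imp_Bseq convergent_def exI[of _ S])
  then obtain C0 where C0: "\<And>N. norm (SN N) \<le> C0" by (auto simp: Bseq_def)
  \<comment> \<open>Bounds S, every SN and l at once; the 1 gives |z| \<le> |z| C^2.\<close>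
  define C where "C = max (max 1 (cmod l)) (max C0 (norm S))"
  have C: "1 \<le> C" "cmod l \<le> C" "norm (SN N) \<le> C" "norm S \<le> C" for N
    using C0[of N] by (auto simp: C_def)
  define \<delta> where "\<delta> = 1 / (16 * C\<^sup>2)"
  have \<delta>: "\<delta> > 0" using C(1) by (simp add: \<delta>_def)
  have main: "R_plus_inverse (of_real ((cmod l)\<^sup>2)) (cauchy_transform \<tau> (adj S \<ast> S) (1 / z)) = 1 / z
      \<and> cmod (cauchy_transform \<tau> (adj S \<ast> S) (1 / z)) \<le> 2 * cmod z"
    if z0: "z \<noteq> 0" and z: "cmod z < \<delta>" for z
  proof -
    have zC: "cmod z * C\<^sup>2 \<le> 1/16"
      using z C(1) by (simp add: \<delta>_def field_simps)
    define K where "K U = z \<odot> (adj U \<ast> U)" for U :: "'h bop"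
    have K_small: "norm (K U) \<le> 1/16" and K_M: "K U \<in> M" if "U \<in> M" "norm U \<le> C" for U
    proof -
      have "norm (K U) \<le> cmod z * (norm (adj U) * norm U)"
        unfolding K_def
        by (rule order_trans[OF norm_scalar_op_compose]) (intro mult_left_mono norm_blinfun_compose norm_ge_zero)
      also have "\<dots> \<le> cmod z * (C * C)"
        using that C(1) norm_adj_le[of U] by (intro mult_left_mono mult_mono) auto
      finally show "norm (K U) \<le> 1/16" using zC by (simp add: power2_eq_square)
      show "K U \<in> M" using that by (simp add: K_def)
    qed
    have res_ex: "\<exists>Q. Q \<in> M \<and> Q = id_blinfun + Q \<ast> K U \<and> Q = id_blinfun + K U \<ast> Q \<and> norm Q \<le> 2"
      if "U \<in> M" "norm U \<le> C" for U
    proof (rule Neumann_inverse[OF K_M[OF that]])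
      show "norm (K U) < 1" using K_small[OF that] by simp
      fix Q assume Q: "Q \<in> M" "Q = id_blinfun + Q \<ast> K U" "Q = id_blinfun + K U \<ast> Q"
        "norm Q \<le> 1 / (1 - norm (K U))"
      have "1 / (1 - norm (K U)) \<le> 1 / (1/2)"
        using K_small[OF that] by (intro divide_left_mono) auto
      from order_trans[OF Q(4) this] have "norm Q \<le> 2" by simp
      with Q(1-3) show ?thesis by blast
    qed
    define res where "res U = (SOME Q. Q \<in> M \<and> Q = id_blinfun + Q \<ast> K U
      \<and> Q = id_blinfun + K U \<ast> Q \<and> norm Q \<le> 2)" for U
    have res_all: "res U \<in> M \<and> res U = id_blinfun + res U \<ast> K U
        \<and> res U = id_blinfun + K U \<ast> res U \<and> norm (res U) \<le> 2" if "U \<in> M" "norm U \<le> C" for U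
      unfolding res_def by (rule someI_ex[OF res_ex[OF that]])
    note res = res_all[THEN conjunct1] res_all[THEN conjunct2, THEN conjunct1]
      res_all[THEN conjunct2, THEN conjunct2, THEN conjunct1]
      res_all[THEN conjunct2, THEN conjunct2, THEN conjunct2]
    define Q where "Q N = res (SN N)" for N
    note Q = res[OF SN_M C(3), folded Q_def]
    define Q\<^sub>0 where "Q\<^sub>0 = res S"
    note Q0 = res[OF SM C(4), folded Q\<^sub>0_def]
    have "(\<lambda>N. adj (SN N)) \<longlonglongrightarrow> adj S"
      by (rule tendsto_adj) (use SN_M SM SN_lim in auto)
    then have K_lim: "(\<lambda>N. K (SN N)) \<longlonglongrightarrow> K S"
      unfolding K_def by (intro tendsto_scalar_op tendsto_compose_op SN_lim)
    have "(\<lambda>N. Q N - Q\<^sub>0) \<longlonglongrightarrow> 0"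
    proof (rule Lim_null_comparison)
      have "norm (Q N - Q\<^sub>0) \<le> 4 * norm (K (SN N) - K S)" for N
      proof -
        \<comment> \<open>The resolvent identity, which makes Q N converge at the rate of K (SN
          N).\<close>
        have "Q N \<ast> (K (SN N) - K S) \<ast> Q\<^sub>0 = (Q N \<ast> K (SN N)) \<ast> Q\<^sub>0 - Q N \<ast> (K S \<ast> Q\<^sub>0)"
          by (simp add: compose_simps)
        also have "Q N \<ast> K (SN N) = Q N - id_blinfun" using Q(2)[of N] by (simp add: eq_diff_eq add.commute)
        also have "K S \<ast> Q\<^sub>0 = Q\<^sub>0 - id_blinfun" using Q0(3) by (simp add: eq_diff_eq add.commute)
        finally have "Q N - Q\<^sub>0 = Q N \<ast> (K (SN N) - K S) \<ast> Q\<^sub>0" by (simp add: compose_simps)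
        then have "norm (Q N - Q\<^sub>0) \<le> norm (Q N) * norm (K (SN N) - K S) * norm Q\<^sub>0"
          using norm_blinfun_compose[of "Q N \<ast> (K (SN N) - K S)" Q\<^sub>0]
            mult_right_mono[OF norm_blinfun_compose[of "Q N" "K (SN N) - K S"] norm_ge_zero[of Q\<^sub>0]] by simp
        also have "\<dots> \<le> 2 * norm (K (SN N) - K S) * 2"
          using Q(4)[of N] Q0(4) by (intro mult_mono) auto
        finally show ?thesis by simp
      qed
      then show "\<forall>\<^sub>F N in sequentially. norm (Q N - Q\<^sub>0) \<le> 4 * norm (K (SN N) - K S)" by simp
      show "(\<lambda>N. 4 * norm (K (SN N) - K S)) \<longlonglongrightarrow> 0"
        using K_lim by (intro tendsto_mult_right_zero tendsto_norm_zero LIM_zero)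
    qed
    then have "Q \<longlonglongrightarrow> Q\<^sub>0" by (rule LIM_zero_cancel)
    then have tau_lim: "(\<lambda>N. \<tau> (Q N)) \<longlonglongrightarrow> \<tau> Q\<^sub>0" by (rule tau_tendsto[OF Q(1)])
    define L where "L = complex_of_real ((cmod l)\<^sup>2)"
    define g where "g = z * \<tau> Q\<^sub>0"
    have "\<exists>\<Delta>. cmod (\<Delta> - 1) \<le> 1/2 \<and> 1 - z * \<tau> (Q N) = (1 - z / of_nat (n N) / \<Delta>) ^ n N
        \<and> (\<Delta> + z * L) * (1 - z / of_nat (n N) / \<Delta>) = 1 - z * \<tau> (Q N)" for N
    proof -
      interpret G: projection_grid M \<tau> D X "n N" "grid (n N)" by (rule grid)
      have n: "n N > 0" by (simp add: n_def)
      show ?thesis unfolding L_def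
      proof (rule G.grid_resolvent[OF n, where l = l and C = C and z = z])
        show "\<tau> (grid (n N) k) = 1 / of_nat (n N)" if "k < n N" for k
          using interval_projection_tau[OF grid_bounds[OF that]]
          by (simp add: grid_def diff_divide_distrib[symmetric])
        show "(\<Sum>k<n N. grid (n N) k) = id_blinfun"
          using grid_sum[of 0 "n N" "n N"] n E_unit by (simp add: atLeast0LessThan)
      qed (use h C zC Q[of N] in \<open>simp_all add: SN_tri[symmetric] K_def[symmetric]\<close>)
    qed
    then obtain \<Delta> where \<Delta>: "\<And>N. cmod (\<Delta> N - 1) \<le> 1/2"
      "\<And>N. 1 - z * \<tau> (Q N) = (1 - z / of_nat (n N) / \<Delta> N) ^ n N"
      "\<And>N. (\<Delta> N + z * L) * (1 - z / of_nat (n N) / \<Delta> N) = 1 - z * \<tau> (Q N)"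
      by metis
    have \<Delta>_ge: "1/2 \<le> cmod (\<Delta> N)" for N
      using \<Delta>(1)[of N] norm_triangle_ineq2[of 1 "1 - \<Delta> N"] by (simp add: norm_minus_commute)
    have \<Delta>0: "\<Delta> N \<noteq> 0" for N
    proof
      assume "\<Delta> N = 0"
      then show False using \<Delta>_ge[of N] by simp
    qed
    have n_lim: "filterlim n at_top sequentially"
      unfolding n_def by (rule filterlim_subseq) (simp add: strict_mono_def)
    have inv_n: "(\<lambda>N. inverse (of_nat (n N) :: complex)) \<longlonglongrightarrow> 0"
      by (rule filterlim_compose[OF lim_inverse_n n_lim])
    have h_lim: "(\<lambda>N. z / of_nat (n N) / \<Delta> N) \<longlonglongrightarrow> 0"
    proof (rule Lim_null_comparison)
      have "norm (z / of_nat (n N) / \<Delta> N) \<le> cmod z * cmod (inverse (of_nat (n N) :: complex)) * 2" for N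
      proof -
        have "norm (z / of_nat (n N) / \<Delta> N) = cmod z * cmod (inverse (of_nat (n N) :: complex)) * (1 / cmod (\<Delta> N))"
          by (simp add: norm_divide norm_mult norm_inverse divide_inverse)
        also have "\<dots> \<le> cmod z * cmod (inverse (of_nat (n N) :: complex)) * (1 / (1/2))"
          using \<Delta>_ge[of N] \<Delta>0[of N] by (intro mult_left_mono divide_left_mono) auto
        finally show ?thesis by simp
      qed
      then show "\<forall>\<^sub>F N in sequentially. norm (z / of_nat (n N) / \<Delta> N) \<le> cmod z * cmod (inverse (of_nat (n N) :: complex)) * 2"
        by simp
      show "(\<lambda>N. cmod z * cmod (inverse (of_nat (n N) :: complex)) * 2) \<longlonglongrightarrow> 0"
        by (intro tendsto_mult_left_zero tendsto_mult_right_zero tendsto_norm_zero inv_n)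
    qed
    define d where "d = 1 - g - z * L"
    have \<Delta>_lim: "\<Delta> \<longlonglongrightarrow> d"
    proof -
      have "(\<lambda>N. (1 - z * \<tau> (Q N)) / (1 - z / of_nat (n N) / \<Delta> N) - z * L) \<longlonglongrightarrow> (1 - g) / (1 - 0) - z * L"
        unfolding g_def by (intro tendsto_intros tau_lim h_lim) auto
      moreover have "\<forall>\<^sub>F N in sequentially. (1 - z * \<tau> (Q N)) / (1 - z / of_nat (n N) / \<Delta> N) - z * L = \<Delta> N"
      proof -
        have "\<forall>\<^sub>F N in sequentially. cmod (z / of_nat (n N) / \<Delta> N) < 1"
          using order_tendstoD(2)[OF tendsto_norm[OF h_lim], of 1] by simp
        then show ?thesis
        proof eventually_elim
          case (elim N)
          then have "1 - z / of_nat (n N) / \<Delta> N \<noteq> 0" by auto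
          then show ?case unfolding \<Delta>(3)[of N, symmetric] by simp
        qed
      qed
      ultimately show ?thesis by (simp add: d_def Lim_transform_eventually)
    qed
    have d1: "cmod (d - 1) \<le> 1/2"
      by (rule LIMSEQ_le_const2[OF tendsto_norm[OF tendsto_diff[OF \<Delta>_lim tendsto_const]]]) (use \<Delta>(1) in auto)
    then have d_ge: "1/2 \<le> cmod d"
      using norm_triangle_ineq2[of 1 "1 - d"] by (simp add: norm_minus_commute)
    then have d0: "d \<noteq> 0" by auto
    have "(\<lambda>N. (1 + (- z / \<Delta> N) / of_nat (n N)) ^ n N) \<longlonglongrightarrow> exp (- z / d)"
      by (intro tendsto_power_exp n_lim tendsto_divide tendsto_const \<Delta>_lim d0)
    moreover have "(1 + (- z / \<Delta> N) / of_nat (n N)) ^ n N = 1 - z * \<tau> (Q N)" for N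
      unfolding \<Delta>(2) by (simp add: mult.commute)
    ultimately have "(\<lambda>N. 1 - z * \<tau> (Q N)) \<longlonglongrightarrow> exp (- z / d)" by simp
    moreover have "(\<lambda>N. 1 - z * \<tau> (Q N)) \<longlonglongrightarrow> 1 - g"
      unfolding g_def by (intro tendsto_intros tau_lim)
    ultimately have exp_eq: "1 - g = exp (- z / d)" using LIMSEQ_unique by blast
    have "cmod z \<le> cmod z * C\<^sup>2"
      using C(1) by (intro mult_le_cancel_left1[THEN iffD2]) (auto simp: one_le_power)
    then have "cmod z \<le> 1/16" using zC by linarith
    then have "cmod (- z / d) \<le> (1/16) / (1/2)"
      unfolding norm_divide norm_minus_cancel using d_ge by (intro frac_le) auto
    then have "cmod (- z / d) \<le> 1/8" by simp
    \<comment> \<open>Keeps the exponent in the strip where the principal logarithm inverts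
      exp.\<close>
    then have "\<bar>Im (- z / d)\<bar> < pi"
      using abs_Im_le_cmod[of "- z / d"] pi_gt3 by linarith
    then have Ln_eq: "Ln (1 - g) = - z / d" unfolding exp_eq by (intro Ln_exp) auto
    have g1: "1 - g \<noteq> 0" unfolding exp_eq by simp
    have "R_plus_inverse L g = (d / z + L) / (1 - g)"
    proof -
      have "- (1 / (u * (- z / d))) + L / u = (d / z + L) / u" if "u \<noteq> 0" for u
        using that z0 d0 by (simp add: field_simps)
      from this[OF g1] show ?thesis unfolding R_plus_inverse_def Ln_eq .
    qed
    also have "d / z + L = (1 - g) / z" using z0 by (simp add: d_def field_simps)
    finally have R: "R_plus_inverse L g = 1 / z" using g1 by simp
    have ct: "cauchy_transform \<tau> (adj S \<ast> S) (1 / z) = g"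
      unfolding g_def by (rule op_inverse_resolvent) (use Q0 SM z0 in \<open>simp_all add: K_def\<close>)
    have "cmod g \<le> cmod z * 2"
      unfolding g_def norm_mult using tau_le_norm[OF Q0(1)] Q0(4) by (intro mult_left_mono) auto
    then show ?thesis unfolding ct using R by (simp add: L_def mult.commute)
  qed
  show thesis
    by (rule that[OF \<delta>]) (use main in auto)
qed

theorem theorem3p1:
  fixes M :: "('h::chilbert_space \<Rightarrow>\<^sub>L 'h) set"
    and \<tau> :: "('h \<Rightarrow>\<^sub>L 'h) \<Rightarrow> complex"
    and T T\<^sub>l :: "'h \<Rightarrow>\<^sub>L 'h"
    and l :: complex
  assumes "tracial_W_star_space M \<tau>"
    and "quasinilpotent_DT M \<tau> T"
    and "T\<^sub>l = T - scalar_op l"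
  shows "\<forall>\<^sub>F z in nhds 0. R_transform \<tau> (adj T\<^sub>l o\<^sub>L T\<^sub>l) z =
    remove_sings (\<lambda>z. - (1 / ((1 - z) * Ln (1 - z))) - 1 / z
      + complex_of_real ((cmod l)\<^sup>2) / (1 - z)) z"
proof -
  interpret tracial_algebra M \<tau> by unfold_locales (rule assms)
  define L where "L = complex_of_real ((cmod l)\<^sup>2)"
  define G where "G = cauchy_transform \<tau> (adj T\<^sub>l o\<^sub>L T\<^sub>l)"
  define F where "F = R_plus_inverse L"
  obtain \<delta> where \<delta>: "\<delta> > 0"
    "\<And>z. z \<noteq> 0 \<Longrightarrow> cmod z < \<delta> \<Longrightarrow> F (G (1 / z)) = 1 / z"
    "\<And>z. z \<noteq> 0 \<Longrightarrow> cmod z < \<delta> \<Longrightarrow> cmod (G (1 / z)) \<le> 2 * cmod z"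
    using cauchy_transform_DT[OF assms(2), of l] unfolding F_def G_def L_def assms(3) by blast
  have ev: "\<forall>\<^sub>F \<zeta> :: complex in at_infinity. \<zeta> \<noteq> 0 \<and> cmod (1 / \<zeta>) < \<delta>"
  proof -
    have "\<forall>\<^sub>F \<zeta> :: complex in at_infinity. 1 / \<delta> + 1 \<le> cmod \<zeta>"
      by (auto simp: eventually_at_infinity)
    then show ?thesis
    proof eventually_elim
      case (elim \<zeta>)
      have "1 / \<delta> < cmod \<zeta>" using elim by linarith
      moreover have "0 < 1 / \<delta>" using \<delta>(1) by simp
      ultimately have "0 < cmod \<zeta>" by linarith
      with \<open>1 / \<delta> < cmod \<zeta>\<close> have "1 / cmod \<zeta> < \<delta>" using \<delta>(1) by (simp add: field_simps)
      with \<open>0 < cmod \<zeta>\<close> show ?case by (simp add: norm_divide)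
    qed
  qed
  then have "\<forall>\<^sub>F \<zeta> in at_infinity. F (G \<zeta>) = \<zeta>"
  proof eventually_elim
    case (elim \<zeta>)
    then show ?case using \<delta>(2)[of "1 / \<zeta>"] by simp
  qed
  moreover have "(G \<longlongrightarrow> 0) at_infinity"
  proof (rule Lim_null_comparison)
    show "\<forall>\<^sub>F \<zeta> in at_infinity. norm (G \<zeta>) \<le> 2 * cmod (inverse \<zeta>)"
      using ev
    proof eventually_elim
      case (elim \<zeta>)
      then show ?case using \<delta>(3)[of "1 / \<zeta>"] by (simp add: inverse_eq_divide)
    qed
    show "((\<lambda>\<zeta>::complex. 2 * cmod (inverse \<zeta>)) \<longlongrightarrow> 0) at_infinity"
      by (intro tendsto_mult_right_zero tendsto_norm_zero tendsto_inverse_0)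
  qed
  ultimately have GF: "inverse_near_infinity G F"
    unfolding F_def by (rule inverse_near_infinity_R_plus_inverse)
  define K where "K = (SOME K. inverse_near_infinity G K)"
  have "inverse_near_infinity G K" unfolding K_def by (rule someI[of "inverse_near_infinity G", OF GF])
  then have "\<forall>\<^sub>F z in at 0. K z = F z" using GF by (rule inverse_near_infinity_unique)
  then have "\<forall>\<^sub>F z in at 0. K z - 1 / z = - (1 / ((1 - z) * Ln (1 - z))) - 1 / z + L / (1 - z)"
    by eventually_elim (simp add: F_def R_plus_inverse_def)
  then show ?thesis
    unfolding R_transform_def Let_def K_def G_def L_def by (rule eventually_remove_sings_cong)
qed

end
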